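(* Let $\psi\in\mathbf{\Psi}_n$, $(X,\|\cdot\|)$ be Asplund, and $\Omega_1,\ldots,\Omega_n\subset X$ be closed with $\bar x\in\bigcap_{i=1}^n\Omega_i$. If $\{\Omega_1,\ldots,\Omega_n\}$ is extremal at $\bar x$ with respect to $|\!|\!|\cdot|\!|\!|_\psi$, then, for any $\varepsilon>0$, there exist $x_i\in\Omega_i\cap B_\varepsilon(\bar x)$ and $x_i^*\in N^F_{\Omega_i}(x_i)$ $(i=1,\ldots,n)$ such that $\|\sum_{i=1}^nx_i^*\|<\varepsilon$ and $|\!|\!|(x_1^*,\ldots,x_n^* )|\!|\!|_{\psi^*}=1$.
   Context: Let $(X,\|\cdot\|)$ be a normed vector space, $n\ge2$. $\Omega_n\subset\mathbb{R}^n$ here (for the function class) is not to be confused with the sets: let $\Delta_n:=\{t\in\mathbb{R}^n\mid t_i\ge0,\ \sum_i t_i=1\}$ and $\Delta_n^\circ:=\{t\in\Delta_n\mid t_i<1\ \forall i\}$. $\mathbf{\Psi}_n$ is the class of convex continuous $\psi:\Delta_n\to\mathbb{R}$ with (B1) $\psi(\mathbf{e}_i)=1$ for all standard unit vectors $\mathbf{e}_i$ and (B2) $\psi(t)\ge(1-t_i)\psi\big(\frac{t_1}{1-t_i},\ldots,\frac{t_{i-1}}{1-t_i},0,\frac{t_{i+1}}{1-t_i},\ldots,\frac{t_n}{1-t_i}\big)$ for all $t\in\Delta_n^\circ$, $i=1,\ldots,n$. For $\psi\in\mathbf{\Psi}_n$, $|\!|\!|x|\!|\!|_\psi:=\big(\sum_{i}\|x_i\|\big)\,\psi\big(\frac{\|x_1\|}{\sum_{i}\|x_i\|},\ldots,\frac{\|x_n\|}{\sum_{i}\|x_i\|}\big)$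 for $0\ne x\in X^n$, $|\!|\!|0|\!|\!|_\psi:=0$; its dual norm on $(X^n)^*\cong(X^* )^n$ is $|\!|\!|(x_1^*,\ldots,x_n^* )|\!|\!|_{\psi^*}=\max_{t\in\Delta_n}\frac{\sum_i t_i\|x_i^*\|}{\psi(t)}$. The collection $\{\Omega_1,\ldots,\Omega_n\}$ is extremal at $\bar x$ with respect to a norm $|\!|\!|\cdot|\!|\!|$ on $X^n$ if there is $\rho>0$ such that for any $\varepsilon>0$ there exists $(a_1,\ldots,a_n)\in X^n$ with $|\!|\!|(a_1,\ldots,a_n)|\!|\!|<\varepsilon$ and $\bigcap_{i=1}^n(\Omega_i-a_i)\cap B_\rho(\bar x)=\emptyset$. $N^F_{\Omega}(x):=\{x^*\in X^*\mid \limsup_{\Omega\ni u\to x,\,u\ne x}\frac{\langle x^*,u-x\rangle}{\|u-x\|}\le0\}$ is the Fréchet normal cone; $B_\varepsilon(\bar x)$ is the open ball. *)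

theory Defs
  imports "HOL-Analysis.Analysis"
begin

definition asplund :: "'a::banach itself \<Rightarrow> bool" where
  "asplund _ \<longleftrightarrow>
     (\<forall>(U::'a set) (f::'a \<Rightarrow> real). open U \<and> convex U \<and> convex_on U f \<and> continuous_on U f \<longrightarrow>
        (\<exists>G::nat \<Rightarrow> 'a set. (\<forall>k. open (G k)) \<and>
            U \<subseteq> closure (U \<inter> \<Inter>(range G)) \<and>
            (\<forall>x \<in> U \<inter> \<Inter>(range G). f differentiable (at x))))"

definition simplex_n :: "(real^'n) set" where
  "simplex_n = {t. (\<forall>i. 0 \<le> t $ i) \<and> (\<Sum>i\<in>UNIV. t $ i) = 1}"

definition simplex_n_circ :: "(real^'n) set" where
  "simplex_n_circ = {t \<in> simplex_n. \<forall>i. t $ i < 1}"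

definition unit_vec :: "'n \<Rightarrow> real^'n" where
  "unit_vec i = (\<chi> j. if j = i then 1 else 0)"

definition Psi_class :: "((real^'n) \<Rightarrow> real) set" where
  "Psi_class = {\<psi>. convex_on simplex_n \<psi> \<and> continuous_on simplex_n \<psi> \<and>
      (\<forall>i. \<psi> (unit_vec i) = 1) \<and>
      (\<forall>t \<in> simplex_n_circ. \<forall>i.
          \<psi> t \<ge> (1 - t $ i) * \<psi> (\<chi> j. if j = i then 0 else t $ j / (1 - t $ i)))}"

definition psi_norm :: "((real^'n) \<Rightarrow> real) \<Rightarrow> ('n \<Rightarrow> 'a::real_normed_vector) \<Rightarrow> real" where
  "psi_norm \<psi> x =
     (if (\<forall>i. x i = 0) then 0
      else (\<Sum>i\<in>UNIV. norm (x i)) * \<psi> (\<chi> j. norm (x j) / (\<Sum>i\<in>UNIV. norm (x i))))"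

text \<open>Its dual norm on (X^*)^n; a dual element is a bounded linear functional, with
  dual norm given by the operator norm onorm.\<close>
definition psi_dual_norm :: "((real^'n) \<Rightarrow> real) \<Rightarrow> ('n \<Rightarrow> ('a::real_normed_vector \<Rightarrow> real)) \<Rightarrow> real" where
  "psi_dual_norm \<psi> xs = (SUP t\<in>simplex_n. (\<Sum>i\<in>UNIV. t $ i * onorm (xs i)) / \<psi> t)"

definition extremal_wrt :: "(('n \<Rightarrow> 'a) \<Rightarrow> real) \<Rightarrow> ('n \<Rightarrow> 'a::real_normed_vector set) \<Rightarrow> 'a \<Rightarrow> bool" where
  "extremal_wrt N \<Omega> xbar \<longleftrightarrow>
     (\<exists>\<rho>>0. \<forall>\<epsilon>>0. \<exists>a::'n \<Rightarrow> 'a. N a < \<epsilon> \<and>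
        (\<Inter>i. (\<lambda>w. w - a i) ` \<Omega> i) \<inter> ball xbar \<rho> = {})"

text \<open>Frechet normal cone (limsup condition unfolded).\<close>
definition frechet_normal :: "'a::real_normed_vector set \<Rightarrow> 'a \<Rightarrow> ('a \<Rightarrow> real) set" where
  "frechet_normal \<Omega> x = {xs. bounded_linear xs \<and>
     (\<forall>e>0. \<exists>\<delta>>0. \<forall>u\<in>\<Omega>. 0 < norm (u - x) \<and> norm (u - x) < \<delta> \<longrightarrow>
        xs (u - x) \<le> e * norm (u - x))}"

end

theory Submission
imports Defs
begin

text \<open>Comparing values at a minimum needs only an upper first-order estimate of the objective,
  so \<open>N\<close>, its square and the perturbation series are merely shown to be
  superdifferentiable along \<open>Y\<close>. This is why the perturbation consists of squares of
  \<open>N\<close> and is not a multiple of the distance as in Ekeland's principle, which has a kink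
  exactly at the minimiser. Smulian's duality between Frechet differentiability and small weak-star
  slices is used in both directions: from the Asplund property to countably many functionals that
  are dense on \<open>Y\<close>, and from these back to a differentiable norm. Nontriviality of the
  normals is carried along as a lower bound for the pairing with test vectors \<open>w i\<close>,
  not for norms: the best pairing over tuples of functionals obeying the constraints is dual to an
  infimum of \<open>penalty\<close>, and an upper bound for that infimum can be tested inside a
  countable set. Extremality with respect to \<open>psi_norm \<psi>\<close> enters only through
  shifts that are small in every component.\<close>

text \<open>
  Since Frechet normal cones are cones and \<open>\<psi>\<close> is bounded away from \<open>0\<close> on the simplex, it suffices to find
  normals whose sum is small compared with their size. Assume first that there is an equivalent
  Frechet smooth norm \<open>N\<close>. Then minimise \<open>\<surd>(\<Sum>i. N(x i - a i - (x i0 - a i0))\<^sup>2)\<close> over the product of the sets, up to a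
  small smooth perturbation provided by the Borwein-Preiss principle: extremality keeps the minimum
  away from \<open>0\<close>, so the objective is smooth there and its partial derivatives are normals that add up
  to \<open>0\<close> up to the perturbation, while their norm is bounded below.

  An Asplund space need not be known to carry such a norm, but every separable subspace does: it has a
  separable dual, and a Kadec-Klee type dual norm makes the predual norm smooth along the subspace.
  So the minimisation takes place in a separable subspace \<open>Y\<close>. By Hahn-Banach, the
  nonexistence of suitable normals in the whole space is witnessed by finitely many points, and
  \<open>Y\<close> is chosen closed under the selection of such witnesses; hence normals relative to \<open>Y\<close> yield
  normals in the whole space.
\<close>

section \<open>Hahn-Banach\<close>

definition sublinear :: "('a::real_vector \<Rightarrow> real) \<Rightarrow> bool" where
  "sublinear p \<longleftrightarrow> (\<forall>x y. p (x + y) \<le> p x + p y) \<and> (\<forall>c x. 0 \<le> c \<longrightarrow> p (c *\<^sub>R x) = c * p x)"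

lemma sublinear_add: "sublinear p \<Longrightarrow> p (x + y) \<le> p x + p y"
  and sublinear_scale: "sublinear p \<Longrightarrow> 0 \<le> c \<Longrightarrow> p (c *\<^sub>R x) = c * p x"
  by (auto simp: sublinear_def)

lemma sublinear_zero: "sublinear p \<Longrightarrow> p 0 = 0"
  using sublinear_scale[of p 0 0] by simp

lemma sublinear_uminus: "sublinear p \<Longrightarrow> - p (- x) \<le> p x"
  using sublinear_add[of p x "- x"] sublinear_zero[of p] by simp

lemma sublinearI:
  assumes "\<And>x y. p (x + y) \<le> p x + p y" and "\<And>c x. 0 < c \<Longrightarrow> p (c *\<^sub>R x) \<le> c * p x" and "p 0 = 0"
  shows "sublinear p"
  unfolding sublinear_def
proof (intro conjI allI impI)
  fix c :: real and x assume "0 \<le> c"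
  show "p (c *\<^sub>R x) = c * p x"
  proof (cases "c = 0")
    case False
    with \<open>0 \<le> c\<close> have c: "0 < c" by simp
    have "p ((1/c) *\<^sub>R (c *\<^sub>R x)) \<le> (1/c) * p (c *\<^sub>R x)" using c by (intro assms(2)) simp
    then have "c * p x \<le> p (c *\<^sub>R x)" using c by (simp add: field_simps)
    with assms(2)[OF c, of x] show ?thesis by simp
  qed (simp add: assms(3))
qed (rule assms(1))

text \<open>For sublinear \<open>p\<close> this is the largest sublinear functional below
  \<open>p\<close> whose value at \<open>- v\<close> is at most \<open>- p v\<close>. A minimal
  \<open>p\<close> must agree with it for every \<open>v\<close>.\<close>

definition sublinear_step :: "('a::real_vector \<Rightarrow> real) \<Rightarrow> 'a \<Rightarrow> 'a \<Rightarrow> real" where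
  "sublinear_step p v x = (INF t\<in>{0..}. p (x + t *\<^sub>R v) - t * p v)"

lemma sublinear_step_le:
  assumes "sublinear p"
  shows "0 \<le> t \<Longrightarrow> sublinear_step p v x \<le> p (x + t *\<^sub>R v) - t * p v"
    and "- p (- x) \<le> sublinear_step p v x"
proof -
  have *: "- p (- x) \<le> p (x + t *\<^sub>R v) - t * p v" if "0 \<le> t" for t
    using sublinear_add[OF assms(1), of "x + t *\<^sub>R v" "- x"] sublinear_scale[OF assms(1) that, of v]
    by simp
  then have "bdd_below ((\<lambda>t. p (x + t *\<^sub>R v) - t * p v) ` {0..})" by (intro bdd_belowI2) auto
  then show "0 \<le> t \<Longrightarrow> sublinear_step p v x \<le> p (x + t *\<^sub>R v) - t * p v"
    unfolding sublinear_step_def by (rule cINF_lower) (use assms in auto)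
  show "- p (- x) \<le> sublinear_step p v x"
    unfolding sublinear_step_def by (rule cINF_greatest) (use * in auto)
qed

lemma sublinear_sublinear_step:
  assumes p: "sublinear p"
  shows "sublinear (sublinear_step p v)"
proof (rule sublinearI)
  let ?q = "sublinear_step p v"
  fix x y
  have "?q (x + y) - (p (y + s *\<^sub>R v) - s * p v) \<le> ?q x" if s: "0 \<le> s" for s
    unfolding sublinear_step_def[of p v x]
  proof (rule cINF_greatest)
    fix t :: real assume t: "t \<in> {0..}"
    have "?q (x + y) \<le> p (x + y + (t + s) *\<^sub>R v) - (t + s) * p v"
      using s t by (intro sublinear_step_le(1)[OF p]) auto
    also have "x + y + (t + s) *\<^sub>R v = (x + t *\<^sub>R v) + (y + s *\<^sub>R v)" by (simp add: algebra_simps)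
    also have "p \<dots> \<le> p (x + t *\<^sub>R v) + p (y + s *\<^sub>R v)" by (rule sublinear_add[OF p])
    finally show "?q (x + y) - (p (y + s *\<^sub>R v) - s * p v) \<le> p (x + t *\<^sub>R v) - t * p v"
      by (simp add: algebra_simps)
  qed auto
  then have "?q (x + y) - ?q x \<le> ?q y"
    unfolding sublinear_step_def[of p v y]
    by (intro cINF_greatest) (auto simp: algebra_simps)
  then show "?q (x + y) \<le> ?q x + ?q y" by simp
next
  let ?q = "sublinear_step p v"
  fix c :: real and x assume c: "0 < c"
  have "?q (c *\<^sub>R x) / c \<le> ?q x"
    unfolding sublinear_step_def[of p v x]
  proof (rule cINF_greatest)
    fix t :: real assume t: "t \<in> {0..}"
    have "?q (c *\<^sub>R x) \<le> p (c *\<^sub>R x + (c * t) *\<^sub>R v) - (c * t) * p v"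
      using c t by (intro sublinear_step_le(1)[OF p]) auto
    also have "c *\<^sub>R x + (c * t) *\<^sub>R v = c *\<^sub>R (x + t *\<^sub>R v)" by (simp add: algebra_simps)
    also have "p \<dots> = c * p (x + t *\<^sub>R v)" using c by (intro sublinear_scale[OF p]) auto
    finally show "?q (c *\<^sub>R x) / c \<le> p (x + t *\<^sub>R v) - t * p v"
      using c by (simp add: field_simps)
  qed auto
  then show "?q (c *\<^sub>R x) \<le> c * ?q x" using c by (simp add: field_simps)
next
  show "sublinear_step p v 0 = 0"
    using sublinear_step_le(1)[OF p, of 0 v 0] sublinear_step_le(2)[OF p, of 0 v] sublinear_zero[OF p] by simp
qed

text \<open>Supplies the lower bounds for Zorn's lemma. The infimum is finite since every member is
  at least \<open>- p (- x)\<close> at \<open>x\<close>; it is subadditive since any two members of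
  a chain can be replaced by the smaller one.\<close>

lemma sublinear_chain_Inf:
  assumes C: "C \<noteq> {}" "\<And>q. q \<in> C \<Longrightarrow> sublinear q \<and> q \<le> p"
    and chain: "\<And>q r. q \<in> C \<Longrightarrow> r \<in> C \<Longrightarrow> q \<le> r \<or> r \<le> q"
    and p: "sublinear p"
  shows "sublinear (\<lambda>x. INF q\<in>C. q x)" "q \<in> C \<Longrightarrow> (INF q\<in>C. q x) \<le> q x"
proof -
  let ?m = "\<lambda>x. INF q\<in>C. q x"
  have bdd: "bdd_below ((\<lambda>q. q x) ` C)" for x
  proof (rule bdd_belowI2)
    fix q assume "q \<in> C"
    with C(2) have "- q (- x) \<le> q x" "q (- x) \<le> p (- x)"
      by (auto intro: sublinear_uminus simp: le_fun_def)
    then show "- p (- x) \<le> q x" by simp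
  qed
  have low: "?m x \<le> q x" if "q \<in> C" for q x by (rule cINF_lower[OF bdd that])
  show "(INF q\<in>C. q x) \<le> q x" if "q \<in> C" by (rule low[OF that])
  show "sublinear ?m"
  proof (rule sublinearI)
    fix x y
    have "?m (x + y) - r y \<le> ?m x" if r: "r \<in> C" for r
    proof (rule cINF_greatest[OF C(1)])
      fix q assume q: "q \<in> C"
      obtain s where s: "s \<in> C" "s \<le> q" "s \<le> r" using chain[OF q r] q r by blast
      have "?m (x + y) \<le> s (x + y)" by (rule low[OF s(1)])
      also have "\<dots> \<le> s x + s y" using C(2)[OF s(1)] by (intro sublinear_add) auto
      also have "\<dots> \<le> q x + r y" using s by (simp add: le_fun_def add_mono)
      finally show "?m (x + y) - r y \<le> q x" by simp
    qed
    then have "?m (x + y) - ?m x \<le> ?m y"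
      by (intro cINF_greatest[OF C(1)]) (auto simp: algebra_simps)
    then show "?m (x + y) \<le> ?m x + ?m y" by simp
  next
    fix c :: real and x assume c: "0 < c"
    have "?m (c *\<^sub>R x) / c \<le> ?m x"
    proof (rule cINF_greatest[OF C(1)])
      fix q assume q: "q \<in> C"
      have "?m (c *\<^sub>R x) \<le> q (c *\<^sub>R x)" by (rule low[OF q])
      also have "\<dots> = c * q x" using C(2)[OF q] c by (intro sublinear_scale) auto
      finally show "?m (c *\<^sub>R x) / c \<le> q x" using c by (simp add: field_simps)
    qed
    then show "?m (c *\<^sub>R x) \<le> c * ?m x" using c by (simp add: field_simps)
  next
    have "(\<lambda>q. q 0) ` C = {0}" using C by (force simp: sublinear_zero)
    then show "?m 0 = 0" by simp
  qed
qed

text \<open>A minimal sublinear \<open>f\<close> below \<open>p\<close>, which Zorn's lemma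
  provides, is linear: minimality gives \<open>sublinear_step f v = f\<close>, and the parameter 1
  in the infimum turns this into \<open>f x \<le> f (x + v) - f v\<close>, the missing half of
  additivity.\<close>

lemma linear_below_sublinear:
  fixes p :: "'a::real_vector \<Rightarrow> real"
  assumes p: "sublinear p"
  shows "\<exists>f. linear f \<and> (\<forall>x. f x \<le> p x)"
proof -
  define A where "A = {q. sublinear q \<and> q \<le> p}"
  have "\<exists>m\<in>A. \<forall>a\<in>A. a \<le> m \<longrightarrow> a = m"
  proof (rule predicate_Zorn)
    show "partial_order_on A (relation_of (\<lambda>a b. b \<le> a) A)"
      by (rule partial_order_on_relation_ofI) auto
    fix C assume "C \<in> Chains (relation_of (\<lambda>a b. b \<le> a) A)"
    then have CA: "C \<subseteq> A" and ch: "\<And>q r. q \<in> C \<Longrightarrow> r \<in> C \<Longrightarrow> q \<le> r \<or> r \<le> q"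
      by (auto simp: Chains_def relation_of_def)
    show "\<exists>u\<in>A. \<forall>a\<in>C. u \<le> a"
    proof (cases "C = {}")
      case True with p show ?thesis by (auto simp: A_def)
    next
      case False
      have C: "\<And>q. q \<in> C \<Longrightarrow> sublinear q \<and> q \<le> p" using CA by (auto simp: A_def)
      have inf: "sublinear (\<lambda>x. INF q\<in>C. q x)" "\<And>q x. q \<in> C \<Longrightarrow> (INF q\<in>C. q x) \<le> q x"
        using sublinear_chain_Inf[OF False C ch p] by blast+
      obtain q where q: "q \<in> C" using False by blast
      have "(\<lambda>x. INF q\<in>C. q x) \<le> p"
        using inf(2)[OF q] C[OF q] by (auto simp: le_fun_def intro: order_trans)
      with inf show ?thesis by (intro bexI[of _ "\<lambda>x. INF q\<in>C. q x"]) (auto simp: A_def le_fun_def)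
    qed
  qed
  then obtain f where f: "f \<in> A" and min: "\<And>a. a \<in> A \<Longrightarrow> a \<le> f \<Longrightarrow> a = f" by blast
  have sf: "sublinear f" and fp: "f \<le> p" using f by (auto simp: A_def)
  have step: "sublinear_step f v = f" for v
  proof (rule min)
    show le: "sublinear_step f v \<le> f"
      using sublinear_step_le(1)[OF sf, of 0 v] by (simp add: le_fun_def)
    show "sublinear_step f v \<in> A"
      using sublinear_sublinear_step[OF sf, of v] order_trans[OF le fp] by (simp add: A_def)
  qed
  have add: "f (x + v) = f x + f v" for x v
    using sublinear_step_le(1)[OF sf, of 1 v x] sublinear_add[OF sf, of x v] by (simp add: step)
  have "f (- x) = - f x" for x using add[of x "- x"] sublinear_zero[OF sf] by simp
  then have "f (c *\<^sub>R x) = c * f x" for c x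
  proof (cases "0 \<le> c")
    case False
    then have "f ((- c) *\<^sub>R (- x)) = (- c) * f (- x)" by (intro sublinear_scale[OF sf]) simp
    with \<open>\<And>x. f (- x) = - f x\<close> show ?thesis by simp
  qed (rule sublinear_scale[OF sf])
  with add have "linear f" by (intro linearI) auto
  with fp show ?thesis by (auto simp: le_fun_def)
qed

text \<open>Lowering \<open>p\<close> in the direction \<open>w\<close> beforehand forces
  \<open>f (- w) \<le> - p w\<close>, which leaves the minorant no room at \<open>w\<close>.\<close>

lemma linear_below_sublinear_attaining:
  fixes p :: "'a::real_vector \<Rightarrow> real"
  assumes p: "sublinear p"
  obtains f where "linear f" "\<And>x. f x \<le> p x" "f w = p w"
proof -
  obtain f where f: "linear f" "\<And>x. f x \<le> sublinear_step p w x"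
    using linear_below_sublinear[OF sublinear_sublinear_step[OF p, of w]] by blast
  have le: "f x \<le> p x" for x
    using f(2)[of x] sublinear_step_le(1)[OF p, of 0 w x] by simp
  have "f (- w) \<le> - p w"
    using f(2)[of "- w"] sublinear_step_le(1)[OF p, of 1 w "- w"] sublinear_zero[OF p] by simp
  then have "p w \<le> f w" using linear_neg[OF f(1), of w] by simp
  with le[of w] have "f w = p w" by simp
  with f(1) le show ?thesis by (rule that)
qed

lemma norming_functional:
  fixes x :: "'a::real_normed_vector"
  obtains f :: "'a \<Rightarrow> real" where "linear f" "\<And>y. \<bar>f y\<bar> \<le> norm y" "f x = norm x"
proof -
  have "sublinear (norm :: 'a \<Rightarrow> real)" by (auto simp: sublinear_def norm_triangle_ineq)
  then obtain f :: "'a \<Rightarrow> real" where f: "linear f" "\<And>y. f y \<le> norm y" "f x = norm x"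
    using linear_below_sublinear_attaining by blast
  have "- f y \<le> norm y" for y using f(2)[of "- y"] linear_neg[OF f(1), of y] by simp
  with f(2) have "\<bar>f y\<bar> \<le> norm y" for y by (simp add: abs_le_iff)
  with f that show ?thesis by blast
qed

section \<open>Separable subspaces of Asplund spaces have separable duals\<close>

text \<open>Functionals are plain functions, so the product topology of
  \<open>'a \<Rightarrow> real\<close> induces the weak-star topology on this set.\<close>

definition dual_ball :: "('a::real_normed_vector \<Rightarrow> real) set" where
  "dual_ball = {f. linear f \<and> (\<forall>x. \<bar>f x\<bar> \<le> norm x)}"

lemma dual_ballD:
  assumes "f \<in> dual_ball"
  shows "linear f" "\<bar>f x\<bar> \<le> norm x" "f x \<le> norm x" "f (x + y) = f x + f y" "f (x - y) = f x - f y"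
    "f (c *\<^sub>R x) = c * f x" "f (- x) = - f x"
  using assms by (auto simp: dual_ball_def abs_le_iff linear_add linear_diff linear_cmul linear_neg)

lemma bounded_linear_dual_ball: "f \<in> dual_ball \<Longrightarrow> bounded_linear f"
  by (intro bounded_linear_intro[of f 1]) (auto simp: dual_ballD)

lemma zero_dual_ball: "(\<lambda>_. 0) \<in> dual_ball"
  by (simp add: dual_ball_def linear_iff)

lemma continuous_on_apply: "continuous_on S (\<lambda>f::'a \<Rightarrow> real. f x)"
  by (rule continuous_on_subset[OF continuous_on_product_coordinates]) simp

text \<open>Banach-Alaoglu: Tychonoff's theorem for the product of the intervals
  \<open>{- norm x..norm x}\<close>, in which linearity is a closed condition.\<close>

lemma compact_dual_ball: "compact (dual_ball :: ('a::real_normed_vector \<Rightarrow> real) set)"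
proof -
  have "compactin (product_topology (\<lambda>_::'a. euclidean :: real topology) UNIV)
          (Pi\<^sub>E UNIV (\<lambda>x. {- norm x..norm x}))"
    unfolding compactin_PiE by simp
  then have "compact (Pi\<^sub>E UNIV (\<lambda>x::'a. {- norm x..norm x}))"
    by (simp add: euclidean_product_topology)
  moreover have "closed {f :: 'a \<Rightarrow> real. (\<forall>x y. f (x + y) = f x + f y) \<and> (\<forall>c x. f (c *\<^sub>R x) = c * f x)}"
    by (intro closed_Collect_conj closed_Collect_all closed_Collect_eq continuous_intros continuous_on_apply)
  ultimately have "compact (Pi\<^sub>E UNIV (\<lambda>x::'a. {- norm x..norm x}) \<inter>
      {f. (\<forall>x y. f (x + y) = f x + f y) \<and> (\<forall>c x. f (c *\<^sub>R x) = c * f x)})"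
    by (rule compact_Int_closed)
  also have "\<dots> = dual_ball"
    by (auto simp: dual_ball_def PiE_iff abs_le_iff linear_add linear_cmul intro!: linearI)
       (metis minus_le_iff)+
  finally show ?thesis .
qed

section \<open>Support functions of subsets of the dual ball and their slices\<close>

definition support_fun :: "('a::real_normed_vector \<Rightarrow> real) set \<Rightarrow> 'a \<Rightarrow> real" where
  "support_fun K x = (SUP f\<in>K. f x)"

context
  fixes K :: "('a::real_normed_vector \<Rightarrow> real) set"
  assumes K: "K \<subseteq> dual_ball" "K \<noteq> {}"
begin

lemma bdd_above_support_fun: "bdd_above ((\<lambda>f. f x) ` K)"
  using K dual_ballD(3) by (intro bdd_aboveI2[where M = "norm x"]) auto

lemma support_fun_upper: "f \<in> K \<Longrightarrow> f x \<le> support_fun K x"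
  unfolding support_fun_def by (rule cSUP_upper[OF _ bdd_above_support_fun])

lemma support_fun_least: "(\<And>f. f \<in> K \<Longrightarrow> f x \<le> c) \<Longrightarrow> support_fun K x \<le> c"
  unfolding support_fun_def using K(2) by (rule cSUP_least)

lemma support_fun_diff_le: "support_fun K x - support_fun K y \<le> norm (x - y)"
proof -
  have "support_fun K x \<le> support_fun K y + norm (x - y)"
  proof (rule support_fun_least)
    fix f assume f: "f \<in> K"
    then have "f \<in> dual_ball" using K by auto
    then have "f x = f y + f (x - y)" "f (x - y) \<le> norm (x - y)"
      using dual_ballD(3)[of f "x - y"] by (auto simp: dual_ballD(5))
    with support_fun_upper[OF f, of y] show "f x \<le> support_fun K y + norm (x - y)" by simp
  qed
  then show ?thesis by simp
qed

lemma abs_support_fun_diff_le: "\<bar>support_fun K x - support_fun K y\<bar> \<le> norm (x - y)"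
  using support_fun_diff_le[of x y] support_fun_diff_le[of y x] by (simp add: abs_le_iff norm_minus_commute)

lemma continuous_on_support_fun: "continuous_on S (support_fun K)"
proof (rule continuous_on_subset)
  show "continuous_on UNIV (support_fun K)"
  proof (rule lipschitz_on_continuous_on)
    show "1-lipschitz_on UNIV (support_fun K)"
      using abs_support_fun_diff_le by (intro lipschitz_onI) (auto simp: dist_norm)
  qed
qed simp

lemma convex_on_support_fun: "convex_on UNIV (support_fun K)"
proof (rule convex_onI)
  fix t :: real and x y :: 'a assume t: "0 < t" "t < 1"
  show "support_fun K ((1 - t) *\<^sub>R x + t *\<^sub>R y) \<le> (1 - t) * support_fun K x + t * support_fun K y"
  proof (rule support_fun_least)
    fix f assume f: "f \<in> K"
    then have "f \<in> dual_ball" using K by auto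
    then have "f ((1 - t) *\<^sub>R x + t *\<^sub>R y) = (1 - t) * f x + t * f y" by (simp add: dual_ballD)
    also have "\<dots> \<le> (1 - t) * support_fun K x + t * support_fun K y"
      using t f by (intro add_mono mult_left_mono support_fun_upper) auto
    finally show "f ((1 - t) *\<^sub>R x + t *\<^sub>R y) \<le> (1 - t) * support_fun K x + t * support_fun K y" .
  qed
qed simp

text \<open>The easy half of Smulian's criterion.\<close>
lemma small_slice_if_differentiable:
  assumes "support_fun K differentiable (at x)" and e: "0 < e"
  obtains k \<delta> where "bounded_linear k" "0 < \<delta>"
    "\<And>f h. f \<in> K \<Longrightarrow> support_fun K x - \<delta> \<le> f x \<Longrightarrow> \<bar>f h - k h\<bar> \<le> e * norm h"
proof -
  obtain k where k: "(support_fun K has_derivative k) (at x)"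
    using assms(1) by (auto simp: differentiable_def)
  then have blk: "bounded_linear k" by (rule has_derivative_bounded_linear)
  interpret k: bounded_linear k by (rule blk)
  obtain d where d: "0 < d"
    "\<And>y. norm (y - x) < d \<Longrightarrow> norm (support_fun K y - support_fun K x - k (y - x)) \<le> e/2 * norm (y - x)"
    using k e unfolding has_derivative_at_alt by (meson half_gt_zero)
  define t where "t = d / 2"
  have t: "0 < t" "t < d" using d by (auto simp: t_def)
  have "f h - k h \<le> e * norm h" if f: "f \<in> K" "support_fun K x - e/2 * t \<le> f x" for f h
  proof (cases "h = 0")
    case True
    have "f \<in> dual_ball" using f K by auto
    with True show ?thesis by (simp add: dual_ballD(1) linear_0 k.zero)
  next
    case False
    have fb: "f \<in> dual_ball" using f K by auto
    \<comment> \<open>Rescales \<open>h\<close> to length \<open>t\<close>. The derivative error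
      \<open>e/2 * t\<close> and the slack \<open>e/2 * t\<close> of the slice then add up to
      \<open>e * t\<close>, which scales back to \<open>e * norm h\<close>.\<close>
    define c where "c = t / norm h"
    have c: "0 < c" "norm (c *\<^sub>R h) = t" using t False by (auto simp: c_def)
    have "f (x + c *\<^sub>R h) \<le> support_fun K (x + c *\<^sub>R h)" by (rule support_fun_upper[OF f(1)])
    also have "\<dots> \<le> support_fun K x + k (c *\<^sub>R h) + e/2 * t"
    proof -
      have "\<bar>support_fun K (x + c *\<^sub>R h) - support_fun K x - k (c *\<^sub>R h)\<bar> \<le> e/2 * t"
        using d(2)[of "x + c *\<^sub>R h"] c(2) t(2) by simp
      then show ?thesis by linarith
    qed
    finally have "f x + c * f h \<le> f x + e/2 * t + c * k h + e/2 * t"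
      using f(2) fb by (simp add: dual_ballD k.scaleR)
    then have "c * (f h - k h) \<le> c * (e * norm h)" using False by (simp add: c_def algebra_simps)
    with c(1) show ?thesis by simp
  qed note * = this
  have "\<bar>f h - k h\<bar> \<le> e * norm h" if f: "f \<in> K" "support_fun K x - e/2 * t \<le> f x" for f h
  proof -
    have fb: "f \<in> dual_ball" using f K by auto
    show ?thesis using *[OF f, of h] *[OF f, of "- h"] fb by (simp add: dual_ballD k.neg abs_le_iff)
  qed
  then show ?thesis using e t by (intro that[OF blk, of "e/2 * t"]) auto
qed

end

text \<open>The radius refers to the dual norm of restrictions to \<open>Y\<close>. The centres may
  be arbitrary functions, so the derivative of a support function can serve as one without a check
  that it lies in \<open>dual_ball\<close>.\<close>

definition covered :: "'a::real_normed_vector set \<Rightarrow> real \<Rightarrow> ('a \<Rightarrow> real) set \<Rightarrow> bool" where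
  "covered Y e A \<longleftrightarrow> (\<exists>Z. countable Z \<and> (\<forall>f\<in>A. \<exists>z\<in>Z. \<forall>y\<in>Y. \<bar>f y - z y\<bar> \<le> e * norm y))"

lemma covered_mono: "covered Y e B \<Longrightarrow> A \<subseteq> B \<Longrightarrow> covered Y e A"
  unfolding covered_def by (meson subsetD)

lemma covered_UN:
  assumes "countable I" "\<And>i. i \<in> I \<Longrightarrow> covered Y e (A i)"
  shows "covered Y e (\<Union>i\<in>I. A i)"
proof -
  obtain Z where Z: "\<And>i. i \<in> I \<Longrightarrow> countable (Z i)"
    "\<And>i f. i \<in> I \<Longrightarrow> f \<in> A i \<Longrightarrow> \<exists>z\<in>Z i. \<forall>y\<in>Y. \<bar>f y - z y\<bar> \<le> e * norm y"
    using assms(2) unfolding covered_def by metis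
  have "countable (\<Union>i\<in>I. Z i)" using assms(1) Z(1) by (rule countable_UN)
  moreover have "\<exists>z\<in>(\<Union>i\<in>I. Z i). \<forall>y\<in>Y. \<bar>f y - z y\<bar> \<le> e * norm y" if "f \<in> (\<Union>i\<in>I. A i)" for f
    using that Z(2) by fastforce
  ultimately show ?thesis unfolding covered_def by blast
qed

lemma covered_Un: "covered Y e A \<Longrightarrow> covered Y e B \<Longrightarrow> covered Y e (A \<union> B)"
  using covered_UN[of "UNIV :: bool set" Y e "\<lambda>b. if b then A else B"] by (simp add: UNIV_bool Un_commute)

text \<open>Otherwise remove from the dual ball all weak-star open sets whose trace is countably covered. The
  rest \<open>K\<close> is nonempty by compactness, and it has no small weak-star slices: such a slice would be
  covered by one ball and countably many compact sets disjoint from \<open>K\<close>. So the support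
  function of \<open>K\<close> is nowhere Frechet differentiable.\<close>
lemma covered_dual_ball:
  fixes Y :: "'a::banach set"
  assumes aspl: "asplund TYPE('a)" and D: "countable D" "Y \<subseteq> closure D" and e: "0 < e"
  shows "covered Y e dual_ball"
proof (rule ccontr)
  assume ncov: "\<not> covered Y e dual_ball"
  define \<G> where "\<G> = {G :: ('a \<Rightarrow> real) set. open G \<and> covered Y e (G \<inter> dual_ball)}"
  define K where "K = dual_ball - \<Union>\<G>"
  have compact_cov: "covered Y e C" if C: "compact C" "C \<subseteq> dual_ball" "C \<inter> K = {}" for C
  proof -
    have "C \<subseteq> \<Union>\<G>" using C by (auto simp: K_def)
    then obtain \<F> where F: "\<F> \<subseteq> \<G>" "finite \<F>" "C \<subseteq> \<Union>\<F>"
      using C(1) by (auto simp: \<G>_def intro: compactE)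
    have "covered Y e (\<Union>G\<in>\<F>. G \<inter> dual_ball)"
      using F by (intro covered_UN countable_finite) (auto simp: \<G>_def)
    then show ?thesis by (rule covered_mono) (use F C in auto)
  qed
  have Ksub: "K \<subseteq> dual_ball" by (auto simp: K_def)
  have Kne: "K \<noteq> {}" using compact_cov[OF compact_dual_ball] ncov by auto
  let ?p = "support_fun K"
  obtain G :: "nat \<Rightarrow> 'a set" where G: "UNIV \<subseteq> closure (UNIV \<inter> \<Inter>(range G))"
      "\<forall>x\<in>UNIV \<inter> \<Inter>(range G). ?p differentiable (at x)"
    using aspl convex_on_support_fun[OF Ksub Kne] continuous_on_support_fun[OF Ksub Kne]
    unfolding asplund_def by (metis convex_UNIV open_UNIV)
  have "\<Inter>(range G) \<noteq> {}" using G(1) by auto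
  then obtain x where "?p differentiable (at x)" using G(2) by auto
  then obtain k \<delta> where k: "bounded_linear k" and \<delta>: "0 < \<delta>"
    and slice: "\<And>f h. f \<in> K \<Longrightarrow> ?p x - \<delta> \<le> f x \<Longrightarrow> \<bar>f h - k h\<bar> \<le> e * norm h"
    using small_slice_if_differentiable[OF Ksub Kne _ e] by blast
  define H where "H = {f :: 'a \<Rightarrow> real. ?p x - \<delta> < f x}"
  \<comment> \<open>The margin \<open>1 / (m + 1)\<close> allows a closed condition that still
    excludes every element of \<open>K\<close>, so \<open>C y m\<close> is a compact set disjoint
    from \<open>K\<close>.\<close>
  define C where "C y m = dual_ball \<inter> {f. ?p x - \<delta> \<le> f x \<and> e * norm y + 1 / real (Suc m) \<le> \<bar>f y - k y\<bar>}" for y m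
  have "compact (C y m)" for y m
    unfolding C_def
    by (intro compact_Int_closed compact_dual_ball closed_Collect_conj closed_Collect_le continuous_intros continuous_on_apply)
  moreover have "C y m \<inter> K = {}" for y m
  proof -
    have "0 < 1 / real (Suc m)" by simp
    then have "\<not> e * norm y + 1 / real (Suc m) \<le> \<bar>f y - k y\<bar>" if "f \<in> K" "?p x - \<delta> \<le> f x" for f
      using slice[OF that, of y] by linarith
    then show ?thesis unfolding C_def by blast
  qed
  ultimately have covC: "covered Y e (C y m)" for y m
    by (intro compact_cov) (auto simp: C_def)
  define V where "V = {f \<in> dual_ball. \<forall>y\<in>Y. \<bar>f y - k y\<bar> \<le> e * norm y}"
  have "covered Y e V"
    unfolding covered_def by (intro exI[of _ "{k}"]) (auto simp: V_def)
  moreover have "covered Y e (\<Union>(y, m)\<in>D \<times> UNIV. C y m)"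
    using D(1) covC by (intro covered_UN) auto
  ultimately have "covered Y e (V \<union> (\<Union>(y, m)\<in>D \<times> UNIV. C y m))" by (rule covered_Un)
  \<comment> \<open>A functional of the slice outside all \<open>C y m\<close> obeys the estimate at
    every point of the countable \<open>D\<close>, hence on \<open>closure D\<close> by
    continuity.\<close>
  moreover have "H \<inter> dual_ball \<subseteq> V \<union> (\<Union>(y, m)\<in>D \<times> UNIV. C y m)"
  proof
    fix f assume f: "f \<in> H \<inter> dual_ball"
    show "f \<in> V \<union> (\<Union>(y, m)\<in>D \<times> UNIV. C y m)"
    proof (rule ccontr)
      assume n: "f \<notin> V \<union> (\<Union>(y, m)\<in>D \<times> UNIV. C y m)"
      have onD: "\<bar>f y - k y\<bar> \<le> e * norm y" if y: "y \<in> D" for y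
      proof (rule ccontr)
        assume "\<not> ?thesis"
        then obtain m where "1 / real (Suc m) < \<bar>f y - k y\<bar> - e * norm y"
          using nat_approx_posE[of "\<bar>f y - k y\<bar> - e * norm y"] by auto
        then have "f \<in> C y m" using f by (auto simp: C_def H_def)
        with n y show False by auto
      qed
      have "bounded_linear f" using f bounded_linear_dual_ball by auto
      then have "closed {y. \<bar>f y - k y\<bar> \<le> e * norm y}"
        using k by (intro closed_Collect_le continuous_intros) (auto intro: linear_continuous_on)
      then have "closure D \<subseteq> {y. \<bar>f y - k y\<bar> \<le> e * norm y}"
        using onD by (intro closure_minimal) auto
      then show False using n f D(2) by (auto simp: V_def)
    qed
  qed
  ultimately have "covered Y e (H \<inter> dual_ball)" by (rule covered_mono)
  moreover have "open H" unfolding H_def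
    by (intro open_Collect_less continuous_intros continuous_on_apply)
  ultimately have "H \<in> \<G>" by (simp add: \<G>_def)
  \<comment> \<open>\<open>H\<close> is now one of the open sets removed from the dual ball, so
    \<open>K\<close> misses the slice, although \<open>?p x\<close> is the supremum of
    \<open>f x\<close> over \<open>K\<close>.\<close>
  then have "f x \<le> ?p x - \<delta>" if "f \<in> K" for f
    using that by (force simp: K_def H_def)
  then have "?p x \<le> ?p x - \<delta>" by (rule support_fun_least[OF Ksub Kne])
  with \<delta> show False by simp
qed

text \<open>The coverings of radius \<open>1 / (n + 1)\<close> are pooled. Each useful centre is
  exchanged for a member of the dual ball near it; this doubles the radius, whence the choice
  \<open>1 / (n + 1) < e / 2\<close>.\<close>

lemma separable_dual:
  fixes Y :: "'a::banach set"
  assumes aspl: "asplund TYPE('a)" and D: "countable D" "Y \<subseteq> closure D"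
  obtains Z where "countable Z" "Z \<subseteq> dual_ball"
    "\<And>f e. f \<in> dual_ball \<Longrightarrow> 0 < e \<Longrightarrow> \<exists>z\<in>Z. \<forall>y\<in>Y. \<bar>f y - z y\<bar> \<le> e * norm y"
proof -
  have "\<forall>n::nat. \<exists>W. countable W \<and> (\<forall>f\<in>dual_ball. \<exists>w\<in>W. \<forall>y\<in>Y. \<bar>f y - w y\<bar> \<le> (1 / real (Suc n)) * norm y)"
  proof
    fix n
    have "covered Y (1 / real (Suc n)) dual_ball" by (intro covered_dual_ball[OF aspl D]) simp
    then show "\<exists>W. countable W \<and> (\<forall>f\<in>dual_ball. \<exists>w\<in>W. \<forall>y\<in>Y. \<bar>f y - w y\<bar> \<le> (1 / real (Suc n)) * norm y)"
      unfolding covered_def .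
  qed
  then obtain W where W: "\<And>n. countable (W n)"
    "\<And>n f. f \<in> dual_ball \<Longrightarrow> \<exists>w\<in>W n. \<forall>y\<in>Y. \<bar>f y - w y\<bar> \<le> (1 / real (Suc n)) * norm y"
    by metis
  define near where "near n w f \<longleftrightarrow> f \<in> dual_ball \<and> (\<forall>y\<in>Y. \<bar>f y - w y\<bar> \<le> (1 / real (Suc n)) * norm y)"
    for n w and f :: "'a \<Rightarrow> real"
  define Z where "Z = (\<Union>n. (\<lambda>w. SOME f. near n w f) ` {w \<in> W n. \<exists>f. near n w f})"
  have "countable Z" unfolding Z_def using W(1) by (auto intro!: countable_UN countable_image)
  moreover have "Z \<subseteq> dual_ball"
  proof -
    have "(SOME f. near n w f) \<in> dual_ball" if "\<exists>f. near n w f" for n w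
      using someI_ex[OF that] by (simp add: near_def)
    then show ?thesis unfolding Z_def by blast
  qed
  moreover have "\<exists>z\<in>Z. \<forall>y\<in>Y. \<bar>f y - z y\<bar> \<le> e * norm y" if f: "f \<in> dual_ball" and e: "0 < e" for f and e :: real
  proof -
    obtain n where n: "1 / real (Suc n) < e / 2" using nat_approx_posE[of "e/2"] e by auto
    obtain w where w: "w \<in> W n" "near n w f" using W(2)[OF f, of n] f by (auto simp: near_def)
    define z where "z = (SOME f. near n w f)"
    have z: "near n w z" unfolding z_def using someI[of "near n w", OF w(2)] by simp
    have "z \<in> Z" unfolding Z_def z_def using w by auto
    moreover have "\<bar>f y - z y\<bar> \<le> e * norm y" if y: "y \<in> Y" for y
    proof -
      have "\<bar>f y - z y\<bar> \<le> (1 / real (Suc n)) * norm y + (1 / real (Suc n)) * norm y"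
      proof -
        have "\<bar>f y - w y\<bar> \<le> (1 / real (Suc n)) * norm y" "\<bar>z y - w y\<bar> \<le> (1 / real (Suc n)) * norm y"
          using w(2) z y unfolding near_def by blast+
        then show ?thesis by linarith
      qed
      also have "\<dots> = (2 * (1 / real (Suc n))) * norm y" by simp
      also have "\<dots> \<le> e * norm y" using n by (intro mult_right_mono) auto
      finally show ?thesis .
    qed
    ultimately show ?thesis by blast
  qed
  ultimately show ?thesis by (rule that)
qed

section \<open>A norm that is smooth along a subspace with separable dual\<close>

text \<open>The polar of the unit ball of an equivalent norm: \<open>f\<close> belongs to it iff
  \<open>(\<Sum>k. 2^{-k} sup\<^bsub>S k\<^esub> \<bar>f\<bar>\<^sup>2) \<le> 1\<close>. Expressing the suprema through selections \<open>s\<close> makes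
  weak-star closedness immediate.\<close>
definition lur_ball :: "(nat \<Rightarrow> 'a::real_normed_vector set) \<Rightarrow> ('a \<Rightarrow> real) set" where
  "lur_ball S = {f. linear f \<and> (\<forall>s m. (\<forall>k. s k \<in> S k) \<longrightarrow> (\<Sum>k<m. (1/2)^k * (f (s k))\<^sup>2) \<le> 1)}"

lemma lur_ballD: "f \<in> lur_ball S \<Longrightarrow> (\<And>k. s k \<in> S k) \<Longrightarrow> (\<Sum>k<m. (1/2)^k * (f (s k))\<^sup>2) \<le> 1"
  by (auto simp: lur_ball_def)

context
  fixes S :: "nat \<Rightarrow> 'a::real_normed_vector set"
  assumes S0: "S 0 = cball 0 1" and Sne: "\<And>k. S k \<noteq> {}" and Sball: "\<And>k. S k \<subseteq> cball 0 1"
begin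

lemma lur_ball_subset: "lur_ball S \<subseteq> dual_ball"
proof
  fix f assume f: "f \<in> lur_ball S"
  then have lin: "linear f" by (simp add: lur_ball_def)
  have unit: "\<bar>f x\<bar> \<le> 1" if "norm x \<le> 1" for x
  proof -
    define s where "s k = (if k = 0 then x else SOME y. y \<in> S k)" for k
    have "s k \<in> S k" for k using that S0 Sne[of k] by (auto simp: s_def intro: some_in_eq[THEN iffD2])
    then have "(\<Sum>k<1. (1/2)^k * (f (s k))\<^sup>2) \<le> 1" by (rule lur_ballD[OF f])
    then show ?thesis by (simp add: s_def abs_square_le_1)
  qed
  have "\<bar>f x\<bar> \<le> norm x" for x
  proof (cases "x = 0")
    case False
    have "\<bar>f ((1 / norm x) *\<^sub>R x)\<bar> \<le> 1" using False by (intro unit) simp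
    then show ?thesis using False by (simp add: linear_cmul[OF lin] field_simps)
  qed (simp add: linear_0[OF lin])
  with lin show "f \<in> dual_ball" by (simp add: dual_ball_def)
qed

text \<open>All \<open>S k\<close> lie in the unit ball and the weights add up to at most 2, so
  halving is enough. This is the origin of the bound \<open>norm x / 2 \<le> N x\<close> for the new
  norm.\<close>

lemma half_dual_ball_lur_ball:
  assumes f: "f \<in> dual_ball"
  shows "(\<lambda>x. f x / 2) \<in> lur_ball S"
proof -
  have "linear (\<lambda>x. f x / 2)"
    using dual_ballD(4,6)[OF f] by (intro linearI) (auto simp: add_divide_distrib)
  moreover have "(\<Sum>k<m. (1/2)^k * (f (s k) / 2)\<^sup>2) \<le> 1" if s: "\<forall>k. s k \<in> S k" for s m
  proof -
    have "(f (s k) / 2)\<^sup>2 \<le> 1 / 4" for k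
    proof -
      have "norm (s k) \<le> 1" using s Sball[of k] by (metis mem_cball_0 subsetD)
      then have "\<bar>f (s k)\<bar> \<le> 1" using dual_ballD(2)[OF f, of "s k"] by linarith
      then have "(f (s k))\<^sup>2 \<le> 1" by (simp add: abs_square_le_1)
      then show ?thesis by (simp add: power_divide)
    qed
    then have "(\<Sum>k<m. (1/2)^k * (f (s k) / 2)\<^sup>2) \<le> (\<Sum>k<m. (1/2)^k * (1/4 :: real))"
      by (intro sum_mono mult_left_mono) auto
    also have "\<dots> = (\<Sum>k<m. (1/2)^k) / 4" by (simp add: sum_divide_distrib)
    also have "(\<Sum>k<m. (1/2)^k) = 2 - 2 * (1/2 :: real)^m" by (induction m) auto
    also have "\<dots> / 4 \<le> 1" proof -
      have "0 \<le> (1/2 :: real)^m" by simp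
      then show ?thesis by argo
    qed
    finally show ?thesis .
  qed
  ultimately show ?thesis by (simp add: lur_ball_def)
qed

lemma lur_ball_nonempty: "lur_ball S \<noteq> {}"
  using half_dual_ball_lur_ball[OF zero_dual_ball] by blast

lemma compact_lur_ball: "compact (lur_ball S)"
proof -
  have "lur_ball S = dual_ball \<inter>
      {f. \<forall>s m. (\<forall>k. s k \<in> S k) \<longrightarrow> (\<Sum>k<m. (1/2)^k * (f (s k))\<^sup>2) \<le> 1}"
    using lur_ball_subset by (auto simp: lur_ball_def dual_ball_def)
  moreover have "closed {f. \<forall>s m. (\<forall>k. s k \<in> S k) \<longrightarrow> (\<Sum>k<m. (1/2)^k * (f (s k))\<^sup>2) \<le> (1 :: real)}"
    by (intro closed_Collect_all closed_Collect_imp closed_Collect_le continuous_intros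
        continuous_on_apply open_Collect_const)
  ultimately show ?thesis using compact_Int_closed[OF compact_dual_ball] by simp
qed

lemma lur_ball_maximizer:
  obtains f where "f \<in> lur_ball S" "f x = support_fun (lur_ball S) x"
proof -
  obtain f where f: "f \<in> lur_ball S" "\<And>g. g \<in> lur_ball S \<Longrightarrow> g x \<le> f x"
    using continuous_attains_sup[OF compact_lur_ball lur_ball_nonempty continuous_on_apply[of _ x]] by blast
  have "support_fun (lur_ball S) x \<le> f x"
    by (rule support_fun_least[OF lur_ball_subset lur_ball_nonempty f(2)])
  then have "f x = support_fun (lur_ball S) x"
    using support_fun_upper[OF lur_ball_subset lur_ball_nonempty f(1), of x] by simp
  with f(1) show ?thesis by (rule that)
qed

lemma half_norm_le_support_fun_lur_ball: "norm x / 2 \<le> support_fun (lur_ball S) x"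
proof -
  obtain f :: "'a \<Rightarrow> real" where f: "linear f" "\<And>y. \<bar>f y\<bar> \<le> norm y" "f x = norm x"
    using norming_functional[of x] by metis
  then have "f \<in> dual_ball" by (simp add: dual_ball_def)
  from support_fun_upper[OF lur_ball_subset lur_ball_nonempty half_dual_ball_lur_ball[OF this], of x] f(3)
  show ?thesis by simp
qed

text \<open>Parallelogram identity in every summand.\<close>
lemma lur_ball_midpoint:
  assumes u: "u \<in> lur_ball S" and v: "v \<in> lur_ball S" and l: "0 < l"
    and nin: "(\<lambda>x. (u x + v x) / 2 / l) \<notin> lur_ball S"
  obtains t where "t \<in> S k" "(u t - v t)\<^sup>2 \<le> 4 * 2^k * (1 - l\<^sup>2)"
    "\<And>s'. s' \<in> S k \<Longrightarrow> (v s')\<^sup>2 \<le> (v t)\<^sup>2 + 2 * 2^k * (1 - l\<^sup>2)"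
proof -
  have "linear u" "linear v" using u v by (auto simp: lur_ball_def)
  then have "linear (\<lambda>x. (u x + v x) / 2 / l)"
    using l by (intro linearI) (auto simp: linear_add linear_cmul add_divide_distrib algebra_simps)
  then obtain s m where s: "\<And>k. s k \<in> S k"
    and m: "1 < (\<Sum>k<m. (1/2)^k * ((u (s k) + v (s k)) / 2 / l)\<^sup>2)"
    using nin by (force simp: lur_ball_def not_le)
  \<comment> \<open>Extends the partial sum so that it contains the index \<open>k\<close> of
    interest.\<close>
  define M where "M = max m (Suc k)"
  let ?w = "\<lambda>k. (1/2)^k :: real"
  have "1 < (\<Sum>k<M. ?w k * ((u (s k) + v (s k)) / 2 / l)\<^sup>2)"
    using m by (rule less_le_trans) (auto simp: M_def intro!: sum_mono2)
  also have "\<dots> = (\<Sum>k<M. ?w k * ((u (s k) + v (s k)) / 2)\<^sup>2) / l\<^sup>2"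
    by (simp add: sum_divide_distrib power_divide mult.assoc)
  finally have big: "l\<^sup>2 < (\<Sum>k<M. ?w k * ((u (s k) + v (s k)) / 2)\<^sup>2)"
    using l by (simp add: field_simps)
  have split: "(\<Sum>k<M. ?w k * ((u (s k) + v (s k)) / 2)\<^sup>2) =
     (\<Sum>k<M. ?w k * (u (s k))\<^sup>2) / 2 + (\<Sum>k<M. ?w k * (v (s k))\<^sup>2) / 2
     - (\<Sum>k<M. ?w k * (u (s k) - v (s k))\<^sup>2) / 4"
    unfolding sum_divide_distrib sum.distrib[symmetric] sum_subtractf[symmetric]
    by (intro sum.cong refl) (simp add: field_simps power2_eq_square)
  have ku: "(\<Sum>k<M. ?w k * (u (s k))\<^sup>2) \<le> 1" and kv: "(\<Sum>k<M. ?w k * (v (s k))\<^sup>2) \<le> 1"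
    using lur_ballD[OF u s] lur_ballD[OF v s] by auto
  have arith: "D \<le> 4 * (1 - L)" if "L < A" "A = B / 2 + C / 2 - D / 4" "B \<le> 1" "C \<le> 1" for A B C D L :: real
    using that by simp
  have kM: "k \<in> {..<M}" by (auto simp: M_def)
  have pos: "0 \<le> (\<Sum>k<M. ?w k * (u (s k) - v (s k))\<^sup>2)" by (intro sum_nonneg) simp
  have "?w k * (u (s k) - v (s k))\<^sup>2 \<le> (\<Sum>k<M. ?w k * (u (s k) - v (s k))\<^sup>2)"
    using kM by (intro member_le_sum) auto
  also have "\<dots> \<le> 4 * (1 - l\<^sup>2)" by (rule arith[OF big split ku kv])
  finally have 1: "(u (s k) - v (s k))\<^sup>2 \<le> 4 * 2^k * (1 - l\<^sup>2)"
    by (simp add: power_one_over field_simps)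
  \<comment> \<open>Exchanging only the entry \<open>k\<close> of the selection keeps the sum for
    \<open>v\<close> at most 1, while along \<open>s\<close> it is already at least
    \<open>2 * l\<^sup>2 - 1\<close>; so no \<open>s'\<close> can do much better than
    \<open>s k\<close>.\<close>
  have 2: "(v s')\<^sup>2 \<le> (v (s k))\<^sup>2 + 2 * 2^k * (1 - l\<^sup>2)" if s': "s' \<in> S k" for s'
  proof -
    define r where "r = s(k := s')"
    have "\<And>j. r j \<in> S j" using s s' by (auto simp: r_def)
    then have "(\<Sum>j<M. ?w j * (v (r j))\<^sup>2) \<le> 1" by (rule lur_ballD[OF v])
    also have "(\<Sum>j<M. ?w j * (v (r j))\<^sup>2) = ?w k * (v s')\<^sup>2 + (\<Sum>j\<in>{..<M}-{k}. ?w j * (v (s j))\<^sup>2)"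
      using kM by (subst sum.remove[of _ k]) (auto simp: r_def intro!: sum.cong)
    also have "\<dots> = ?w k * (v s')\<^sup>2 - ?w k * (v (s k))\<^sup>2 + (\<Sum>j<M. ?w j * (v (s j))\<^sup>2)"
      using kM by (simp add: sum.remove[of _ k])
    finally have "?w k * ((v s')\<^sup>2 - (v (s k))\<^sup>2) \<le> 2 * (1 - l\<^sup>2)"
      using big split ku pos by (simp add: right_diff_distrib)
    then show ?thesis by (simp add: power_one_over field_simps)
  qed
  show ?thesis by (rule that[OF s 1 2])
qed

end

text \<open>The supremum of \<open>z\<close> over the unit ball of \<open>Y\<close> need not be
  attained; the factor 2 is the price. With such a \<open>d\<close>, every \<open>h\<close> in that
  ball is an element of the kernel of \<open>z\<close> plus a multiple of \<open>d\<close> with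
  coefficient at most 2 in absolute value.\<close>

lemma almost_norming_point:
  assumes z: "z \<in> dual_ball" and Y: "subspace Y"
  obtains d where "d \<in> Y" "norm d \<le> 1" "\<And>h. h \<in> Y \<Longrightarrow> norm h \<le> 1 \<Longrightarrow> \<bar>z h\<bar> \<le> 2 * \<bar>z d\<bar>"
proof -
  define B where "B = {h \<in> Y. norm h \<le> 1}"
  define \<sigma> where "\<sigma> = (SUP h\<in>B. \<bar>z h\<bar>)"
  have B0: "0 \<in> B" using subspace_0[OF Y] by (simp add: B_def)
  have bdd: "bdd_above ((\<lambda>h. \<bar>z h\<bar>) ` B)"
    using dual_ballD(2)[OF z] by (intro bdd_aboveI2[where M = 1]) (auto simp: B_def intro: order_trans)
  have up: "\<bar>z h\<bar> \<le> \<sigma>" if "h \<in> B" for h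
    unfolding \<sigma>_def by (rule cSUP_upper[OF that bdd])
  have "\<exists>d\<in>B. \<sigma> \<le> 2 * \<bar>z d\<bar>"
  proof (cases "\<sigma> \<le> 0")
    case True with B0 show ?thesis by (intro bexI[of _ 0]) auto
  next
    case False
    then have "\<sigma> / 2 < \<sigma>" by simp
    then obtain d where "d \<in> B" "\<sigma> / 2 < \<bar>z d\<bar>"
      unfolding \<sigma>_def using less_cSUP_iff[OF _ bdd] B0 by (metis empty_iff)
    then show ?thesis by (intro bexI[of _ d]) auto
  qed
  then show ?thesis using up that by (force simp: B_def)
qed

text \<open>The converse half of Smulian's criterion, for the support function \<open>N\<close> of
  \<open>lur_ball S\<close>. If \<open>v\<close> nearly maximises at \<open>y\<close>, its midpoint
  with the maximiser \<open>u\<close> leaves the ball after a slight dilation, and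
  \<open>lur_ball_midpoint\<close> makes \<open>v\<close> close to \<open>u\<close> uniformly on the
  unit ball of \<open>Y\<close>. For small \<open>h\<close>, a maximiser at \<open>y + h\<close> is
  such a \<open>v\<close>.\<close>

lemma smooth_renorming:
  fixes Y :: "'a::real_normed_vector set"
  assumes Y: "subspace Y" and Z: "countable Z" "Z \<subseteq> dual_ball"
    and dense: "\<And>f e. f \<in> dual_ball \<Longrightarrow> 0 < e \<Longrightarrow> \<exists>z\<in>Z. \<forall>y\<in>Y. \<bar>f y - z y\<bar> \<le> e * norm y"
  obtains N :: "'a \<Rightarrow> real" where "\<And>x. norm x / 2 \<le> N x" "\<And>x. N x \<le> norm x"
    "\<And>x y. \<bar>N x - N y\<bar> \<le> norm (x - y)"
    "\<And>y. y \<in> Y \<Longrightarrow> y \<noteq> 0 \<Longrightarrow> \<exists>u\<in>dual_ball. u y = N y \<and>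
       (\<forall>e>0. \<exists>\<delta>>0. \<forall>h\<in>Y. norm h < \<delta> \<longrightarrow> N (y + h) \<le> N y + u h + e * norm h)"
proof -
  have Zne: "Z \<noteq> {}" using dense[OF zero_dual_ball, of 1] by auto
  define z where "z = from_nat_into Z"
  have zran: "range z = Z" unfolding z_def by (rule range_from_nat_into[OF Zne Z(1)])
  then have zB: "z m \<in> dual_ball" for m using Z(2) by blast
  obtain d where d: "\<And>m. d m \<in> Y" "\<And>m. norm (d m) \<le> 1"
    "\<And>m h. h \<in> Y \<Longrightarrow> norm h \<le> 1 \<Longrightarrow> \<bar>z m h\<bar> \<le> 2 * \<bar>z m (d m)\<bar>"
  proof -
    have "\<exists>d. d \<in> Y \<and> norm d \<le> 1 \<and> (\<forall>h. h \<in> Y \<longrightarrow> norm h \<le> 1 \<longrightarrow> \<bar>z m h\<bar> \<le> 2 * \<bar>z m d\<bar>)" for m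
      by (rule almost_norming_point[OF zB[of m] Y]) blast
    then show ?thesis using that by metis
  qed
  \<comment> \<open>Over the set of index \<open>2*m+1\<close> the supremum of
    \<open>\<bar>f\<bar>\<close> is the distance of \<open>f\<close> from the line spanned by
    \<open>z m\<close> in the dual norm of \<open>Y\<close>; the point of index \<open>2*m+2\<close>
    controls the coordinate along that line. Index 0 bounds the ordinary dual norm.\<close>
  define S where "S k = (if k = 0 then cball 0 1 else if odd k then {h \<in> Y. norm h \<le> 1 \<and> z (k div 2) h = 0}
    else {d (k div 2 - 1)})" for k
  have S0: "S 0 = cball 0 1" by (simp add: S_def)
  have z0: "z m 0 = 0" for m using zB[of m] by (simp add: dual_ballD(1) linear_0)
  have Sne: "S k \<noteq> {}" for k using subspace_0[OF Y] z0 by (auto simp: S_def intro: exI[of _ 0])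
  have Sball: "S k \<subseteq> cball 0 1" for k using d by (auto simp: S_def)
  have S1: "S (2 * m + 1) = {h \<in> Y. norm h \<le> 1 \<and> z m h = 0}" and S2: "S (2 * m + 2) = {d m}" for m
    by (auto simp: S_def)
  define U where "U = lur_ball S"
  define N where "N = support_fun U"
  note US = lur_ball_subset[of S, OF S0 Sne Sball, folded U_def]
  note Une = lur_ball_nonempty[of S, OF S0 Sne Sball, folded U_def]
  note up = support_fun_upper[OF US Une, folded N_def]
  have slice: "\<exists>\<delta>>0. \<forall>v\<in>U. N y - \<delta> \<le> v y \<longrightarrow> (\<forall>h\<in>Y. v h - u h \<le> e * norm h)"
    if y: "y \<noteq> 0" and u: "u \<in> U" "u y = N y" and e: "0 < e" for y u and e :: real
  proof -
    \<comment> \<open>A tenth, since the final estimate collects \<open>9 * \<epsilon>\<close> from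
      the kernel of \<open>z m\<close> and \<open>\<epsilon>\<close> from the multiple of
      \<open>d m\<close>.\<close>
    define \<epsilon> where "\<epsilon> = e / 10"
    have \<epsilon>: "0 < \<epsilon>" using e by (simp add: \<epsilon>_def)
    have Ny: "0 < N y"
      using half_norm_le_support_fun_lur_ball[of S y, OF S0 Sne Sball] zero_less_norm_iff[of y] y
      unfolding N_def U_def by linarith
    have uB: "u \<in> dual_ball" using u US by auto
    obtain m where m: "\<And>h. h \<in> Y \<Longrightarrow> \<bar>u h - z m h\<bar> \<le> \<epsilon> * norm h"
      using dense[OF uB \<epsilon>] zran by blast
    \<comment> \<open>\<open>\<kappa>\<close> will be the defect \<open>1 - l\<^sup>2\<close> in
      \<open>lur_ball_midpoint\<close>. Its size makes the error \<open>4 * 2^k * \<kappa>\<close>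
      at most \<open>(\<epsilon>/2)\<^sup>2\<close> for both indices \<open>k\<close> attached to
      \<open>m\<close>; the bound \<open>1/2\<close> keeps \<open>l\<close> positive.\<close>
    define \<kappa> where "\<kappa> = min (1/2) (\<epsilon>\<^sup>2 / (16 * 2^(2*m+2)))"
    have \<kappa>: "0 < \<kappa>" "\<kappa> \<le> 1/2" "4 * 2^(2*m+2) * \<kappa> \<le> (\<epsilon>/2)\<^sup>2"
      using \<epsilon> by (auto simp: \<kappa>_def min_def field_simps power2_eq_square)
    have "(2::real)^(2*m+1) \<le> 2^(2*m+2)" by (rule power_increasing) auto
    then have \<kappa>1: "4 * 2^(2*m+1) * \<kappa> \<le> (\<epsilon>/2)\<^sup>2"
      using \<kappa> by (intro order_trans[OF _ \<kappa>(3)] mult_right_mono) auto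
    define l where "l = sqrt (1 - \<kappa>)"
    have l: "0 < l" "l < 1" "1 - l\<^sup>2 = \<kappa>" using \<kappa> by (auto simp: l_def)
    \<comment> \<open>Then \<open>u y + v y\<close> is at least \<open>(1 + l) * N y\<close>, more
      than \<open>2 * l * N y\<close>: the midpoint divided by \<open>l\<close> is too large at
      \<open>y\<close> to lie in the ball.\<close>
    define \<delta> where "\<delta> = N y * (1 - l)"
    have \<delta>: "0 < \<delta>" using Ny l by (simp add: \<delta>_def)
    have "v h - u h \<le> e * norm h" if v: "v \<in> U" "N y - \<delta> \<le> v y" and h: "h \<in> Y" for v h
    proof -
      have vB: "v \<in> dual_ball" using v US by auto
      have nin: "(\<lambda>x. (u x + v x) / 2 / l) \<notin> lur_ball S"
      proof
        assume "(\<lambda>x. (u x + v x) / 2 / l) \<in> lur_ball S"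
        then have "(u y + v y) / 2 / l \<le> N y" using up unfolding U_def by fastforce
        then have "u y + v y \<le> 2 * l * N y" using l by (simp add: field_simps)
        moreover have "l * N y < N y" using Ny l by simp
        ultimately show False using v(2) u(2) by (simp add: \<delta>_def algebra_simps)
      qed
      note mid = lur_ball_midpoint[of S, OF S0 Sne Sball u(1)[unfolded U_def] v(1)[unfolded U_def] l(1) nin, unfolded l(3)]
      obtain t where t: "t \<in> S (2*m+1)" "(u t - v t)\<^sup>2 \<le> 4 * 2^(2*m+1) * \<kappa>"
        "\<And>s'. s' \<in> S (2*m+1) \<Longrightarrow> (v s')\<^sup>2 \<le> (v t)\<^sup>2 + 2 * 2^(2*m+1) * \<kappa>"
        using mid[of "2*m+1"] by blast
      obtain t2 where t2: "t2 \<in> S (2*m+2)" "(u t2 - v t2)\<^sup>2 \<le> 4 * 2^(2*m+2) * \<kappa>"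
        using mid[of "2*m+2"] by blast
      have "(u (d m) - v (d m))\<^sup>2 \<le> (\<epsilon>/2)\<^sup>2" using t2 \<kappa>(3) unfolding S2 by force
      then have dm: "\<bar>u (d m) - v (d m)\<bar> \<le> \<epsilon>/2" using \<epsilon> abs_le_square_iff[of _ "\<epsilon>/2"] by auto
      have uS: "\<bar>u s\<bar> \<le> \<epsilon>" if s: "s \<in> S (2*m+1)" for s
      proof -
        have "\<bar>u s\<bar> \<le> \<epsilon> * norm s" using m[of s] s unfolding S1 by simp
        also have "\<dots> \<le> \<epsilon> * 1" using s \<epsilon> unfolding S1 by (intro mult_left_mono) auto
        finally show ?thesis by simp
      qed
      have "(u t - v t)\<^sup>2 \<le> (\<epsilon>/2)\<^sup>2" using t(2) \<kappa>1 by simp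
      then have "\<bar>u t - v t\<bar> \<le> \<epsilon>/2" using \<epsilon> abs_le_square_iff[of _ "\<epsilon>/2"] by auto
      then have "\<bar>v t\<bar> \<le> \<bar>3/2 * \<epsilon>\<bar>" using uS[OF t(1)] by linarith
      then have vt: "(v t)\<^sup>2 \<le> (3/2 * \<epsilon>)\<^sup>2" by (simp only: abs_le_square_iff)
      \<comment> \<open>\<open>u\<close> is near \<open>z m\<close>, hence small on the kernel part
        of the unit ball. So \<open>v\<close> is small at \<open>t\<close>, and since it almost
        attains its supremum over that part at \<open>t\<close>, it is small on all of it.\<close>
      have vS: "\<bar>v s\<bar> \<le> 2 * \<epsilon>" if s: "s \<in> S (2*m+1)" for s
      proof -
        have "(v s)\<^sup>2 \<le> (3/2 * \<epsilon>)\<^sup>2 + (\<epsilon>/2)\<^sup>2" 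
        proof -
          have "2 * 2^(2*m+1) * \<kappa> \<le> 4 * 2^(2*m+1) * \<kappa>" using \<kappa>(1) by simp
          then show ?thesis using t(3)[OF s] vt \<kappa>1 by linarith
        qed
        also have "\<dots> \<le> (2 * \<epsilon>)\<^sup>2" by (simp add: power2_eq_square)
        finally show ?thesis using \<epsilon> abs_le_square_iff[of "v s" "2 * \<epsilon>"] by auto
      qed
      have ker: "v s - u s \<le> 3 * \<epsilon>" if "s \<in> S (2*m+1)" for s using uS[OF that] vS[OF that] by linarith
      have unit: "v h - u h \<le> e" if h: "h \<in> Y" "norm h \<le> 1" for h
      proof -
        \<comment> \<open>If \<open>z m (d m) = 0\<close>, the choice of \<open>d m\<close> makes
          \<open>z m\<close> vanish on the unit ball of \<open>Y\<close>, so \<open>c = 0\<close> is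
          right in that case.\<close>
        define c where "c = (if z m (d m) = 0 then 0 else z m h / z m (d m))"
        have c: "z m h = c * z m (d m)" "\<bar>c\<bar> \<le> 2"
          using d(3)[OF h, of m] by (auto simp: c_def field_simps)
        define g where "g = h - c *\<^sub>R d m"
        have g: "g \<in> Y" "z m g = 0"
          using h d(1) Y c zB[of m] by (auto simp: g_def subspace_diff subspace_scale dual_ballD)
        have "norm g \<le> norm h + \<bar>c\<bar> * norm (d m)"
          unfolding g_def by (metis norm_triangle_ineq4 norm_scaleR)
        also have "\<dots> \<le> 1 + 2 * 1" using h c d(2) by (intro add_mono mult_mono) auto
        finally have "(1/3) *\<^sub>R g \<in> S (2*m+1)"
          using g Y zB[of m] unfolding S1 by (auto simp: subspace_scale dual_ballD)
        from ker[OF this] have gg: "v g - u g \<le> 9 * \<epsilon>" using uB vB by (simp add: dual_ballD)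
        have "h = g + c *\<^sub>R d m" by (simp add: g_def)
        then have "v h - u h = (v g - u g) + c * (v (d m) - u (d m))"
          using uB vB by (simp add: dual_ballD algebra_simps)
        also have "c * (v (d m) - u (d m)) \<le> \<bar>c\<bar> * \<bar>u (d m) - v (d m)\<bar>"
          by (metis abs_ge_self abs_minus_commute abs_mult)
        also have "\<dots> \<le> 2 * (\<epsilon>/2)" using c dm by (intro mult_mono) auto
        finally show ?thesis using gg by (simp add: \<epsilon>_def)
      qed
      show ?thesis
      proof (cases "h = 0")
        case False
        have "v ((1 / norm h) *\<^sub>R h) - u ((1 / norm h) *\<^sub>R h) \<le> e"
          using False h Y by (intro unit) (auto simp: subspace_scale)
        then show ?thesis using False uB vB by (simp add: dual_ballD field_simps)
      qed (use uB vB in \<open>simp add: dual_ballD(1) linear_0\<close>)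
    qed
    with \<delta> show ?thesis by blast
  qed
  show ?thesis
  proof (rule that[of N])
    show "norm x / 2 \<le> N x" for x
      unfolding N_def U_def by (rule half_norm_le_support_fun_lur_ball[of S, OF S0 Sne Sball])
    have Nx: "N x \<le> norm x" for x
      unfolding N_def using dual_ballD(3) US by (intro support_fun_least[OF US Une]) auto
    then show "N x \<le> norm x" for x .
    show lip: "\<bar>N x - N y\<bar> \<le> norm (x - y)" for x y
      unfolding N_def by (rule abs_support_fun_diff_le[OF US Une])
    fix y assume y: "y \<in> Y" "y \<noteq> 0"
    obtain u where u: "u \<in> U" "u y = N y"
      unfolding N_def U_def by (rule lur_ball_maximizer[of S, OF S0 Sne Sball])
    have "\<exists>\<delta>>0. \<forall>h\<in>Y. norm h < \<delta> \<longrightarrow> N (y + h) \<le> N y + u h + e * norm h" if e: "0 < e" for e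
    proof -
      obtain \<delta> where \<delta>: "0 < \<delta>" "\<forall>v\<in>U. N y - \<delta> \<le> v y \<longrightarrow> (\<forall>h\<in>Y. v h - u h \<le> e * norm h)"
        using slice[OF y(2) u e] by blast
      \<comment> \<open>Half of \<open>\<delta>\<close>, because a maximiser \<open>v\<close> at
        \<open>y + h\<close> satisfies \<open>v y \<ge> N y - 2 * norm h\<close>.\<close>
      have "N (y + h) \<le> N y + u h + e * norm h" if h: "h \<in> Y" "norm h < \<delta> / 2" for h
      proof -
        obtain v where v: "v \<in> U" "v (y + h) = N (y + h)"
          unfolding N_def U_def by (rule lur_ball_maximizer[of S, OF S0 Sne Sball])
        have vB: "v \<in> dual_ball" using v US by auto
        have sum: "N (y + h) = v y + v h" using v vB by (simp add: dual_ballD)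
        moreover have "v h \<le> norm h" by (rule dual_ballD(3)[OF vB])
        moreover have "N y - N (y + h) \<le> norm h" using lip[of y "y + h"] by simp
        ultimately have "N y - \<delta> \<le> v y" using h by linarith
        then have "v h - u h \<le> e * norm h" using \<delta>(2) v h by blast
        with sum up[OF v(1), of y] show ?thesis by linarith
      qed
      with \<delta>(1) show ?thesis by (intro exI[of _ "\<delta>/2"]) auto
    qed
    with u US show "\<exists>u\<in>dual_ball. u y = N y \<and>
       (\<forall>e>0. \<exists>\<delta>>0. \<forall>h\<in>Y. norm h < \<delta> \<longrightarrow> N (y + h) \<le> N y + u h + e * norm h)" by blast
  qed
qed

section \<open>A smooth variational principle\<close>

text \<open>The Borwein-Preiss principle for a gauge \<open>g\<close> that dominates the squared
  distance. Step \<open>k\<close> adds a penalty of weight \<open>\<mu> * (1/2)^k\<close> at a point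
  that is minimal up to \<open>\<eta> * (1/4)^k\<close>; the quotient of the two bounds the gauge on
  the next set, so the closed sets shrink to one point.\<close>

lemma smooth_variational_principle:
  fixes f :: "'b::complete_space \<Rightarrow> real" and g :: "'b \<Rightarrow> 'b \<Rightarrow> real"
  assumes C: "closed C" "x0 \<in> C" and f: "continuous_on C f" "\<And>u. u \<in> C \<Longrightarrow> 0 \<le> f u" "f x0 \<le> \<eta>"
    and pos: "0 < \<eta>" "0 < \<mu>" "0 < \<kappa>"
    and g: "\<And>y. continuous_on C (\<lambda>u. g u y)" "\<And>u. g u u = 0" "\<And>u y. \<kappa> * (dist u y)\<^sup>2 \<le> g u y"
      "\<And>u y. u \<in> C \<Longrightarrow> y \<in> C \<Longrightarrow> g u y \<le> B"
  obtains x xs where "x \<in> C" "\<And>k. xs k \<in> C" "xs 0 = x0" "\<And>k. \<mu> * g x (xs k) \<le> \<eta>"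
    "\<And>u. u \<in> C \<Longrightarrow> summable (\<lambda>k. \<mu> * (1/2)^k * g u (xs k))"
    "\<And>u. u \<in> C \<Longrightarrow> f x + (\<Sum>k. \<mu> * (1/2)^k * g x (xs k)) \<le> f u + (\<Sum>k. \<mu> * (1/2)^k * g u (xs k))"
proof -
  have g0: "0 \<le> g u y" for u y using g(3)[of u y] pos by (intro order_trans[OF _ g(3)]) auto
  define step where "step k s s' \<longleftrightarrow> (case s of (x, F, S) \<Rightarrow> case s' of (x', F', S') \<Rightarrow>
      F' = (\<lambda>u. F u + \<mu> * (1/2)^k * g u x) \<and> S' = {u\<in>S. F' u \<le> F x})"
    for k :: nat and s s' :: "'b \<times> ('b \<Rightarrow> real) \<times> 'b set"
  \<comment> \<open>The clause for \<open>k = 0\<close> pins the sequence produced by dependent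
    choice to the start \<open>(x0, f, C)\<close>.\<close>
  define inv where "inv k s \<longleftrightarrow> (k = 0 \<longrightarrow> s = (x0, f, C)) \<and> (case s of (x, F, S) \<Rightarrow>
      x \<in> S \<and> S \<subseteq> C \<and> closed S \<and> continuous_on C F \<and> (\<forall>u\<in>C. 0 \<le> F u) \<and> (\<forall>u\<in>S. F x \<le> F u + \<eta> * (1/4)^k))"
    for k :: nat and s :: "'b \<times> ('b \<Rightarrow> real) \<times> 'b set"
  have "\<exists>st. \<forall>n. inv n (st n) \<and> step n (st n) (st (Suc n))"
  proof (rule dependent_nat_choice)
    have "f x0 \<le> f u + \<eta>" if "u \<in> C" for u using f(2)[OF that] f(3) by linarith
    then show "\<exists>s. inv 0 s" using C f by (intro exI[of _ "(x0, f, C)"]) (auto simp: inv_def)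
  next
    fix s and n :: nat assume "inv n s"
    then obtain x F S where s: "s = (x, F, S)" "x \<in> S" "S \<subseteq> C" "closed S" "continuous_on C F"
      "\<forall>u\<in>C. 0 \<le> F u"
      by (cases s) (auto simp: inv_def)
    define F' where "F' = (\<lambda>u. F u + \<mu> * (1/2)^n * g u x)"
    define S' where "S' = {u\<in>S. F' u \<le> F x}"
    have contF': "continuous_on C F'" unfolding F'_def using s(5) g(1) by (intro continuous_intros)
    have F'0: "\<forall>u\<in>C. 0 \<le> F' u" using s(6) g0 pos by (auto simp: F'_def)
    have xS': "x \<in> S'" using s(2) g(2) by (simp add: S'_def F'_def)
    have "continuous_on S F'" using contF' s(3) by (rule continuous_on_subset)
    then have "closed (S \<inter> F' -` {..F x})" using s(4) closed_atMost by (rule continuous_closed_preimage)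
    moreover have "S \<inter> F' -` {..F x} = S'" by (auto simp: S'_def)
    ultimately have "closed S'" by simp
    have bdd: "bdd_below (F' ` S')" using F'0 s(3) by (intro bdd_belowI2[where m = 0]) (auto simp: S'_def)
    have "0 < \<eta> * (1/4)^Suc n" using pos by simp
    then have "Inf (F' ` S') < Inf (F' ` S') + \<eta> * (1/4)^Suc n" by simp
    then obtain x' where x': "x' \<in> S'" "F' x' < Inf (F' ` S') + \<eta> * (1/4)^Suc n"
      using cINF_less_iff[OF _ bdd] xS' by blast
    have "F' x' \<le> F' u + \<eta> * (1/4)^Suc n" if "u \<in> S'" for u
      using x'(2) cINF_lower[OF bdd that] by linarith
    then have "inv (Suc n) (x', F', S')"
      using x'(1) s(3) \<open>closed S'\<close> contF' F'0 by (auto simp: inv_def S'_def)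
    moreover have "step n s (x', F', S')" by (simp add: step_def s(1) F'_def S'_def)
    ultimately show "\<exists>s'. inv (Suc n) s' \<and> step n s s'" by blast
  qed
  then obtain st where st: "\<And>n. inv n (st n)" "\<And>n. step n (st n) (st (Suc n))" by blast
  define xs where "xs n = fst (st n)" for n
  define F where "F n = fst (snd (st n))" for n
  define S where "S n = snd (snd (st n))" for n
  have st_eq: "st n = (xs n, F n, S n)" for n by (simp add: xs_def F_def S_def)
  have init: "xs 0 = x0" "F 0 = f" "S 0 = C" using st(1)[of 0] by (auto simp: inv_def st_eq)
  have xS: "xs n \<in> S n" and SC: "S n \<subseteq> C" and clS: "closed (S n)" and contF: "continuous_on C (F n)"
    and near: "u \<in> S n \<Longrightarrow> F n (xs n) \<le> F n u + \<eta> * (1/4)^n" for n u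
    using st(1)[of n] by (auto simp: inv_def st_eq)
  have FSuc: "F (Suc n) u = F n u + \<mu> * (1/2)^n * g u (xs n)"
    and SSuc: "S (Suc n) = {u\<in>S n. F (Suc n) u \<le> F n (xs n)}" for n u
    using st(2)[of n] by (auto simp: step_def st_eq)
  have Fsum: "F n u = f u + (\<Sum>k<n. \<mu> * (1/2)^k * g u (xs k))" for n u
    by (induction n) (simp_all add: init FSuc)
  have S_anti: "S n \<subseteq> S m" if "m \<le> n" for m n
    using that by (induction rule: dec_induct) (auto simp: SSuc)
  have xC: "xs n \<in> C" for n using xS SC by blast
  have small: "\<mu> * g u (xs n) \<le> \<eta> * (1/2)^n" if "u \<in> S (Suc n)" for u n
  proof -
    have "\<mu> * (1/2)^n * g u (xs n) \<le> \<eta> * (1/4)^n"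
      using that near[of u n] FSuc[of n u] by (simp add: SSuc)
    also have "(1/4 :: real)^n = (1/2)^n * (1/2)^n" by (simp flip: power_mult_distrib)
    finally have "(1/2)^n * (\<mu> * g u (xs n)) \<le> (1/2)^n * (\<eta> * (1/2)^n)" by (simp add: mult_ac)
    then show ?thesis by (rule mult_left_le_imp_le) simp
  qed
  have dist_le: "(dist u (xs n))\<^sup>2 \<le> \<eta> / (\<mu> * \<kappa>) * (1/2)^n" if "u \<in> S (Suc n)" for u n
  proof -
    have "(\<mu> * \<kappa>) * (dist u (xs n))\<^sup>2 \<le> \<mu> * g u (xs n)"
      using g(3)[of u "xs n"] pos by (simp add: mult.assoc)
    also have "\<dots> \<le> \<eta> * (1/2)^n" by (rule small[OF that])
    finally show ?thesis using pos by (simp add: field_simps)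
  qed
  have lim0: "(\<lambda>n. \<eta> / (\<mu> * \<kappa>) * (1/2)^n) \<longlonglongrightarrow> 0"
    by (intro tendsto_mult_right_zero LIMSEQ_realpow_zero) auto
  have "Cauchy xs"
  proof (rule CauchyI')
    fix e :: real assume e: "0 < e"
    have "\<forall>\<^sub>F n in sequentially. \<eta> / (\<mu> * \<kappa>) * (1/2)^n < e\<^sup>2"
      using order_tendstoD(2)[OF lim0] e by simp
    then obtain M where M: "\<And>n. n \<ge> M \<Longrightarrow> \<eta> / (\<mu> * \<kappa>) * (1/2)^n < e\<^sup>2"
      unfolding eventually_sequentially by blast
    show "\<exists>M. \<forall>m\<ge>M. \<forall>n>m. dist (xs m) (xs n) < e"
    proof (intro exI[of _ M] allI impI)
      fix m n assume mn: "m \<ge> M" "n > m"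
      then have "xs n \<in> S (Suc m)" using xS[of n] S_anti[of "Suc m" n] by auto
      then have "(dist (xs n) (xs m))\<^sup>2 < e\<^sup>2" using dist_le M[OF mn(1)] by (meson order_le_less_trans)
      then show "dist (xs m) (xs n) < e" using e by (simp add: dist_commute power2_less_imp_less)
    qed
  qed
  then obtain x where x: "xs \<longlonglongrightarrow> x" using Cauchy_convergent_iff convergent_def by blast
  have xSn: "x \<in> S n" for n
  proof (rule closed_sequentially[OF clS])
    show "xs (k + n) \<in> S n" for k using xS[of "k + n"] S_anti[of n "k + n"] by auto
    show "(\<lambda>k. xs (k + n)) \<longlonglongrightarrow> x" using x by (rule LIMSEQ_ignore_initial_segment)
  qed
  have summ: "summable (\<lambda>k. \<mu> * (1/2)^k * g u (xs k))" if "u \<in> C" for u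
  proof (rule summable_comparison_test)
    show "\<exists>N. \<forall>n\<ge>N. norm (\<mu> * (1/2)^n * g u (xs n)) \<le> (\<mu> * B) * (1/2)^n"
      using g(4)[OF that xC] g0 pos by (auto simp: abs_mult)
    show "summable (\<lambda>n. (\<mu> * B) * (1/2)^n)" by (intro summable_mult summable_geometric) simp
  qed
  define \<Phi> where "\<Phi> u = f u + (\<Sum>k. \<mu> * (1/2)^k * g u (xs k))" for u
  have Flim: "(\<lambda>n. F n u) \<longlonglongrightarrow> \<Phi> u" if "u \<in> C" for u
    unfolding Fsum \<Phi>_def using summable_LIMSEQ[OF summ[OF that]] by (intro tendsto_intros)
  have F_le: "F n u \<le> \<Phi> u" if "u \<in> C" for n u
    unfolding Fsum \<Phi>_def using g0 pos by (intro add_left_mono sum_le_suminf summ that) auto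
  have dec: "F n (xs n) \<le> F m (xs m)" if "m \<le> n" for m n
    using that
  proof (induction rule: dec_induct)
    case (step n)
    have "F (Suc n) (xs (Suc n)) \<le> F n (xs n)" using xS[of "Suc n"] by (simp add: SSuc)
    with step show ?case by simp
  qed simp
  have "\<Phi> x \<le> \<Phi> u" if u: "u \<in> C" for u
  \<comment> \<open>Only \<open>u = x\<close> lies in all \<open>S n\<close>. Any other
    \<open>u\<close> is dropped at some stage \<open>m\<close> because its perturbed value exceeds
    \<open>F m (xs m)\<close>, and no later stage lifts the value at \<open>x\<close> above
    that.\<close>
  proof (cases "\<forall>n. u \<in> S n")
    case True
    have "(dist u (xs n))\<^sup>2 \<le> \<eta> / (\<mu> * \<kappa>) * (1/2)^n" for n using True by (intro dist_le) auto
    then have "(\<lambda>n. (dist u (xs n))\<^sup>2) \<longlonglongrightarrow> 0"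
      by (intro tendsto_sandwich[OF _ _ tendsto_const lim0]) auto
    then have "(\<lambda>n. dist (xs n) u) \<longlonglongrightarrow> 0" by (simp add: dist_commute)
    then have "xs \<longlonglongrightarrow> u" by (rule tendsto_dist_iff[THEN iffD2])
    then have "u = x" using x LIMSEQ_unique by blast
    then show ?thesis by simp
  next
    case False
    then obtain m where m: "u \<in> S m" "u \<notin> S (Suc m)"
    proof -
      have "\<exists>m. u \<in> S m \<and> u \<notin> S (Suc m)"
      proof (rule ccontr)
        assume "\<nexists>m. u \<in> S m \<and> u \<notin> S (Suc m)"
        then have "u \<in> S n" for n by (induction n) (use u init in auto)
        with False show False by blast
      qed
      then show ?thesis using that by blast
    qed
    have "\<Phi> x \<le> F m (xs m)"
    proof (rule LIMSEQ_le_const2[OF Flim])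
      show "x \<in> C" using xSn SC by blast
      have "F n x \<le> F m (xs m)" if nm: "n \<ge> Suc m" for n
      proof -
        obtain k where k: "n = Suc k" using nm by (cases n) auto
        have "F n x \<le> F k (xs k)" using xSn[of n] by (simp add: k SSuc)
        also have "\<dots> \<le> F m (xs m)" using nm k by (intro dec) simp
        finally show ?thesis .
      qed
      then show "\<exists>N. \<forall>n\<ge>N. F n x \<le> F m (xs m)" by blast
    qed
    also have "\<dots> \<le> F (Suc m) u" using m by (simp add: SSuc)
    also have "\<dots> \<le> \<Phi> u" by (rule F_le[OF u])
    finally show ?thesis .
  qed
  moreover have "\<mu> * g x (xs k) \<le> \<eta>" for k
  proof -
    have "\<eta> * (1/2)^k \<le> \<eta> * 1" using pos by (intro mult_left_mono power_le_one) auto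
    with small[OF xSn, of k] show ?thesis by simp
  qed
  ultimately show ?thesis using xSn[of 0] init xC summ by (intro that[of x xs]) (auto simp: \<Phi>_def)
qed

section \<open>Separable reduction for Frechet normals\<close>

text \<open>An entry \<open>(i, k, m, b, l)\<close> stands for the point \<open>b\<close> of \<open>\<Omega> i\<close> at distance less than \<open>c / (m + 1)\<close>
  from \<open>x i\<close>, taken with the tolerance \<open>1 / (k + 1)\<close> and the weight \<open>l\<close>.\<close>
type_synonym ('n, 'a) witness = "('n \<times> nat \<times> nat \<times> 'a \<times> real) list"

definition witness_shape :: "('n, 'a) witness \<Rightarrow> ('n \<times> nat \<times> nat) list" where
  "witness_shape P = map (\<lambda>(i, k, m, b, l). (i, k, m)) P"

definition witness_points :: "('n, 'a) witness \<Rightarrow> 'a set" where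
  "witness_points P = (\<lambda>(i, k, m, b, l). b) ` set P"

text \<open>Moving the base points by \<open>\<theta>\<close> raises the cost and shifts the drift
  by at most this total weight times \<open>\<theta>\<close>.\<close>

definition witness_mass :: "('n, 'a) witness \<Rightarrow> real" where
  "witness_mass P = (\<Sum>(i, k, m, b, l)\<leftarrow>P. l)"

definition witness_cost :: "('n \<Rightarrow> 'a::real_normed_vector) \<Rightarrow> ('n, 'a) witness \<Rightarrow> real" where
  "witness_cost x P = (\<Sum>(i, k, m, b, l)\<leftarrow>P. l / real (Suc k) * norm (b - x i))"

definition witness_drift :: "('n \<Rightarrow> 'a::real_normed_vector) \<Rightarrow> ('n, 'a) witness \<Rightarrow> 'n \<Rightarrow> 'a" where
  "witness_drift x P j = (\<Sum>(i, k, m, b, l)\<leftarrow>P. if i = j then l *\<^sub>R (b - x i) else 0)"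

definition admissible :: "('n \<Rightarrow> 'a::real_normed_vector set) \<Rightarrow> real \<Rightarrow> ('n \<Rightarrow> 'a) \<Rightarrow> ('n, 'a) witness \<Rightarrow> bool" where
  "admissible \<Omega> c x P \<longleftrightarrow>
     (\<forall>(i, k, m, b, l)\<in>set P. b \<in> \<Omega> i \<and> norm (b - x i) < c / real (Suc m) \<and> 0 \<le> l)"

text \<open>The three terms are dual to three constraints on a tuple of functionals: the approximate
  normal inequality, the bound \<open>\<epsilon>\<close> for the norm of the sum, and the bound
  \<open>r\<close> for each norm. The infimum over \<open>P\<close> and \<open>s\<close> is an
  infimal convolution, whose linear minorants in \<open>w\<close> meet all constraints at
  once.\<close>

definition penalty :: "real \<Rightarrow> real \<Rightarrow> ('n::finite \<Rightarrow> 'a::real_normed_vector) \<Rightarrow> ('n \<Rightarrow> 'a) \<Rightarrow> ('n, 'a) witness \<Rightarrow> 'a \<Rightarrow> real" where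
  "penalty r \<epsilon> x w P s =
     witness_cost x P + \<epsilon> * norm s + r * (\<Sum>i\<in>UNIV. norm (w i - witness_drift x P i - s))"

text \<open>Only the countable data \<open>(witness_shape P, M, q)\<close> are prescribed, so a countable \<open>D\<close> can be closed
  under the choice of \<open>P'\<close> and \<open>s'\<close>.\<close>
definition witness_closed :: "('n::finite \<Rightarrow> 'a::real_normed_vector set) \<Rightarrow> real \<Rightarrow> real \<Rightarrow> 'a set \<Rightarrow> bool" where
  "witness_closed \<Omega> r \<epsilon> D \<longleftrightarrow> (\<forall>x w (M::nat) q P s. range x \<subseteq> D \<longrightarrow> range w \<subseteq> D \<longrightarrow>
     admissible \<Omega> 1 x P \<longrightarrow> witness_mass P \<le> real M \<longrightarrow> penalty r \<epsilon> x w P s < real_of_rat q \<longrightarrow>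
     (\<exists>P' s'. witness_shape P' = witness_shape P \<and> witness_points P' \<subseteq> D \<and> s' \<in> D \<and>
       admissible \<Omega> 1 x P' \<and> witness_mass P' \<le> real M \<and> penalty r \<epsilon> x w P' s' < real_of_rat q))"

section \<open>Witnesses under a change of base points\<close>

lemma admissible_Cons: "admissible \<Omega> c x ((i, k, m, b, l) # P) \<longleftrightarrow>
    b \<in> \<Omega> i \<and> norm (b - x i) < c / real (Suc m) \<and> 0 \<le> l \<and> admissible \<Omega> c x P"
  by (auto simp: admissible_def)

lemma witness_cost_nonneg: "admissible \<Omega> c x P \<Longrightarrow> 0 \<le> witness_cost x P"
  by (induction P) (auto simp: witness_cost_def admissible_Cons)

lemma penalty_nonneg: "admissible \<Omega> c x P \<Longrightarrow> 0 \<le> r \<Longrightarrow> 0 \<le> \<epsilon> \<Longrightarrow> 0 \<le> penalty r \<epsilon> x w P s"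
  unfolding penalty_def by (intro add_nonneg_nonneg mult_nonneg_nonneg sum_nonneg witness_cost_nonneg) auto

lemma witness_cost_perturb:
  assumes "admissible \<Omega> c x' P" "\<And>i. norm (x i - x' i) \<le> \<theta>"
  shows "witness_cost x P \<le> witness_cost x' P + witness_mass P * \<theta>"
  using assms(1)
proof (induction P)
  case (Cons a P)
  obtain i k m b l where a: "a = (i, k, m, b, l)" by (cases a)
  have l: "0 \<le> l" and P: "admissible \<Omega> c x' P" using Cons.prems by (auto simp: a admissible_Cons)
  have "norm (b - x i) \<le> norm (b - x' i) + \<theta>"
    using norm_triangle_ineq[of "b - x' i" "x' i - x i"] assms(2)[of i] by (simp add: norm_minus_commute)
  then have "l / real (Suc k) * norm (b - x i) \<le> l / real (Suc k) * (norm (b - x' i) + \<theta>)"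
    using l by (intro mult_left_mono) auto
  also have "\<dots> = l / real (Suc k) * norm (b - x' i) + l / real (Suc k) * \<theta>"
    by (simp only: distrib_left)
  also have "l / real (Suc k) * \<theta> \<le> l * \<theta>"
  proof (rule mult_right_mono)
    have "l * 1 \<le> l * real (Suc k)" using l by (intro mult_left_mono) auto
    then show "l / real (Suc k) \<le> l" by (simp add: pos_divide_le_eq)
    show "0 \<le> \<theta>" using order_trans[OF norm_ge_zero assms(2)[of i]] .
  qed
  finally show ?case using Cons.IH[OF P] by (simp add: a witness_cost_def witness_mass_def distrib_right)
qed (simp add: witness_cost_def witness_mass_def)

lemma witness_drift_perturb:
  fixes x x' :: "'n::finite \<Rightarrow> 'a::real_normed_vector"
  assumes "admissible \<Omega> c x' P" "\<And>i. norm (x i - x' i) \<le> \<theta>"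
  shows "(\<Sum>i\<in>UNIV. norm (witness_drift x P i - witness_drift x' P i)) \<le> witness_mass P * \<theta>"
  using assms(1)
proof (induction P)
  case (Cons a P)
  obtain i k m b l where a: "a = (i, k, m, b, l)" by (cases a)
  have l: "0 \<le> l" and P: "admissible \<Omega> c x' P" using Cons.prems by (auto simp: a admissible_Cons)
  let ?e = "\<lambda>j. if j = i then l *\<^sub>R (x' i - x i) else 0"
  have "(\<Sum>j\<in>UNIV. norm (witness_drift x (a # P) j - witness_drift x' (a # P) j))
      = (\<Sum>j\<in>UNIV. norm (?e j + (witness_drift x P j - witness_drift x' P j)))"
    by (intro sum.cong) (auto simp: a witness_drift_def algebra_simps)
  also have "\<dots> \<le> (\<Sum>j\<in>UNIV. norm (?e j) + norm (witness_drift x P j - witness_drift x' P j))"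
    by (intro sum_mono norm_triangle_ineq)
  also have "\<dots> = (\<Sum>j\<in>UNIV. if j = i then l * norm (x' i - x i) else 0)
      + (\<Sum>j\<in>UNIV. norm (witness_drift x P j - witness_drift x' P j))"
    unfolding sum.distrib using l by (intro arg_cong2[where f = "(+)"] sum.cong) auto
  also have "(\<Sum>j\<in>UNIV. if j = i then l * norm (x' i - x i) else 0) \<le> l * \<theta>"
    using l assms(2)[of i] by (simp add: norm_minus_commute mult_left_mono)
  finally show ?case using Cons.IH[OF P] by (simp add: a witness_mass_def distrib_right)
qed (simp add: witness_drift_def witness_mass_def)

text \<open>Lets points of \<open>D\<close> stand in for base points that are only in
  \<open>closure D\<close>; a bound on the mass makes the error uniform over witnesses.\<close>

lemma penalty_perturb:
  assumes adm: "admissible \<Omega> c x' P" and x: "\<And>i. norm (x i - x' i) \<le> \<theta>" and r: "0 \<le> r"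
  shows "penalty r \<epsilon> x w P s \<le> penalty r \<epsilon> x' w P s + (1 + r) * (witness_mass P * \<theta>)"
proof -
  have "(\<Sum>i\<in>UNIV. norm (w i - witness_drift x P i - s))
      \<le> (\<Sum>i\<in>UNIV. norm (w i - witness_drift x' P i - s) + norm (witness_drift x P i - witness_drift x' P i))"
  proof (rule sum_mono)
    fix i
    have "w i - witness_drift x P i - s
        = (w i - witness_drift x' P i - s) - (witness_drift x P i - witness_drift x' P i)" by simp
    then show "norm (w i - witness_drift x P i - s)
      \<le> norm (w i - witness_drift x' P i - s) + norm (witness_drift x P i - witness_drift x' P i)"
      by (metis norm_triangle_ineq4)
  qed
  also have "\<dots> \<le> (\<Sum>i\<in>UNIV. norm (w i - witness_drift x' P i - s)) + witness_mass P * \<theta>"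
    using witness_drift_perturb[of \<Omega> c x' P x \<theta>, OF adm x] by (simp add: sum.distrib)
  finally have "r * (\<Sum>i\<in>UNIV. norm (w i - witness_drift x P i - s))
      \<le> r * ((\<Sum>i\<in>UNIV. norm (w i - witness_drift x' P i - s)) + witness_mass P * \<theta>)"
    using r by (rule mult_left_mono)
  with witness_cost_perturb[of \<Omega> c x' P x \<theta>, OF adm x] show ?thesis
    unfolding penalty_def by (simp add: algebra_simps)
qed

text \<open>Countably many rounds of adding points are enough: the index type is finite, so a tuple
  with values in the union of the stages lies in one stage, and a countable stage has only countably
  many tuples.\<close>

lemma countable_witness_closure:
  fixes W :: "('n::finite \<Rightarrow> 'a) \<Rightarrow> ('n \<Rightarrow> 'a) \<Rightarrow> 'a set"
  assumes W: "\<And>x w. countable (W x w)" and D0: "countable D0"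
  obtains D where "countable D" "D0 \<subseteq> D" "\<And>x w. range x \<subseteq> D \<Longrightarrow> range w \<subseteq> D \<Longrightarrow> W x w \<subseteq> D"
proof -
  define ext where "ext D = D \<union> (\<Union>x\<in>(UNIV \<rightarrow>\<^sub>E D). \<Union>w\<in>(UNIV \<rightarrow>\<^sub>E D). W x w)" for D
  define E where "E n = (ext ^^ n) D0" for n
  have cext: "countable (ext D)" if "countable D" for D
    unfolding ext_def by (intro countable_Un countable_UN countable_PiE W that finite)
  have E0: "E 0 = D0" and ESuc: "E (Suc n) = ext (E n)" for n by (simp_all add: E_def)
  have cE: "countable (E n)" for n
  proof (induction n)
    case (Suc n)
    then show ?case unfolding ESuc by (rule cext)
  qed (simp add: E0 D0)
  have "E n \<subseteq> E (Suc n)" for n unfolding ESuc ext_def by (rule Un_upper1)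
  then have mono: "E m \<subseteq> E n" if "m \<le> n" for m n using that by (rule lift_Suc_mono_le)
  have fin: "\<exists>n. range x \<subseteq> E n" if x: "range x \<subseteq> (\<Union>n. E n)" for x :: "'n \<Rightarrow> 'a"
  proof -
    have "\<forall>i. \<exists>n. x i \<in> E n" using x by blast
    then obtain n where n: "\<And>i. x i \<in> E (n i)" using choice[of "\<lambda>i n. x i \<in> E n"] by blast
    have "x i \<in> E (Max (range n))" for i 
    proof -
      have "n i \<le> Max (range n)" by simp
      then show ?thesis using n[of i] mono by blast
    qed
    then show ?thesis by blast
  qed
  show ?thesis
  proof (rule that[of "\<Union>n. E n"])
    show "countable (\<Union>n. E n)" using cE by auto
    show "D0 \<subseteq> (\<Union>n. E n)" unfolding E0[symmetric] by (rule UN_upper) simp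
    fix x w :: "'n \<Rightarrow> 'a" assume "range x \<subseteq> (\<Union>n. E n)" "range w \<subseteq> (\<Union>n. E n)"
    then obtain m n where mn: "range x \<subseteq> E m" "range w \<subseteq> E n" using fin[of x] fin[of w] by blast
    have "range x \<subseteq> E (max m n)" "range w \<subseteq> E (max m n)"
      using subset_trans[OF mn(1) mono] subset_trans[OF mn(2) mono] by simp_all
    then have "x \<in> UNIV \<rightarrow>\<^sub>E E (max m n)" "w \<in> UNIV \<rightarrow>\<^sub>E E (max m n)" by (simp_all add: PiE_iff image_subset_iff)
    then have "W x w \<subseteq> E (Suc (max m n))" unfolding ESuc ext_def by blast
    then show "W x w \<subseteq> (\<Union>n. E n)" by blast
  qed
qed

text \<open>\<open>D\<close> has to stay countable and so can be closed under rational multiples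
  only; real scalars are reached in the closure.\<close>

lemma subspace_closure_rational:
  fixes D :: "'a::real_normed_vector set"
  assumes ne: "D \<noteq> {}" and add: "\<And>x y. x \<in> D \<Longrightarrow> y \<in> D \<Longrightarrow> x + y \<in> D"
    and scale: "\<And>x q. x \<in> D \<Longrightarrow> real_of_rat q *\<^sub>R x \<in> D"
  shows "subspace (closure D)"
  unfolding subspace_def
proof (intro conjI allI impI ballI)
  obtain x where "x \<in> D" using ne by blast
  then have "0 \<in> D" using scale[of x 0] by simp
  then show "0 \<in> closure D" using closure_subset by blast
next
  fix x y assume "x \<in> closure D" "y \<in> closure D"
  then obtain f g where "\<And>n. f n \<in> D" "f \<longlonglongrightarrow> x" "\<And>n. g n \<in> D" "g \<longlonglongrightarrow> y"
    unfolding closure_sequential by blast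
  then have "\<forall>n. f n + g n \<in> D" "(\<lambda>n. f n + g n) \<longlonglongrightarrow> x + y"
    by (simp_all add: add tendsto_add)
  then show "x + y \<in> closure D" unfolding closure_sequential by (intro exI[of _ "\<lambda>n. f n + g n"] conjI)
next
  fix c :: real and x assume "x \<in> closure D"
  then obtain f where f: "\<And>n. f n \<in> D" "f \<longlonglongrightarrow> x" unfolding closure_sequential by blast
  have "\<exists>q. c < real_of_rat q \<and> real_of_rat q < c + inverse (real (Suc n))" for n
    by (rule of_rat_dense) simp
  then obtain q where q: "\<And>n. c < real_of_rat (q n)" "\<And>n. real_of_rat (q n) < c + inverse (real (Suc n))"
    using choice[of "\<lambda>n q. c < real_of_rat q \<and> real_of_rat q < c + inverse (real (Suc n))"] by blast
  have "(\<lambda>n. c + inverse (real (Suc n))) \<longlonglongrightarrow> c"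
    by (rule LIMSEQ_inverse_real_of_nat_add)
  then have "(\<lambda>n. real_of_rat (q n)) \<longlonglongrightarrow> c"
  proof (rule tendsto_sandwich[rotated 2, OF tendsto_const])
    show "\<forall>\<^sub>F n in sequentially. c \<le> real_of_rat (q n)"
      using q(1) by (intro always_eventually allI less_imp_le)
    show "\<forall>\<^sub>F n in sequentially. real_of_rat (q n) \<le> c + inverse (real (Suc n))"
      using q(2) by (intro always_eventually allI less_imp_le)
  qed
  then have "(\<lambda>n. real_of_rat (q n) *\<^sub>R f n) \<longlonglongrightarrow> c *\<^sub>R x" using f(2) by (rule tendsto_scaleR)
  moreover have "\<forall>n. real_of_rat (q n) *\<^sub>R f n \<in> D" using f(1) scale by blast
  ultimately show "c *\<^sub>R x \<in> closure D" unfolding closure_sequential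
    by (intro exI[of _ "\<lambda>n. real_of_rat (q n) *\<^sub>R f n"] conjI)
qed

lemma rich_separable_subspace:
  fixes \<Omega> :: "'n::finite \<Rightarrow> 'a::real_normed_vector set"
  assumes D0: "countable D0" "D0 \<noteq> {}"
  obtains D where "countable D" "D0 \<subseteq> D" "subspace (closure D)"
    "witness_closed \<Omega> r \<epsilon> D"
proof -
  define good where "good x w L M q Ps \<longleftrightarrow> (case Ps of (P, s) \<Rightarrow> witness_shape P = L \<and>
      admissible \<Omega> 1 x P \<and> witness_mass P \<le> real M \<and> penalty r \<epsilon> x w P s < real_of_rat q)"
    for x w L and M :: nat and q Ps
  \<comment> \<open>If nothing is good, \<open>SOME\<close> returns an arbitrary pair, which still
    adds only finitely many points.\<close>
  define pick where "pick x w = (\<lambda>(L, M, q). let Ps = SOME Ps. good x w L M q Ps in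
      insert (snd Ps) (witness_points (fst Ps)))" for x w
  define W where "W x w = (\<Union>i. \<Union>j. {x i + w j}) \<union> (\<Union>i. \<Union>q. {real_of_rat q *\<^sub>R x i}) \<union>
      (\<Union>t\<in>lists UNIV \<times> UNIV \<times> UNIV. pick x w t)" for x w :: "'n \<Rightarrow> 'a"
  have "countable (UNIV :: 'n set)" by (simp add: countable_finite)
  then have "countable (UNIV :: ('n \<times> nat \<times> nat) set)"
    by (simp flip: UNIV_Times_UNIV)
  then have cL: "countable (lists (UNIV :: ('n \<times> nat \<times> nat) set) \<times> (UNIV :: nat set) \<times> (UNIV :: rat set))"
    by (intro countable_SIGMA countable_lists) auto
  have cpick: "countable (pick x w t)" for x w t
    by (cases t) (simp add: pick_def Let_def witness_points_def countable_finite)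
  then have cW: "countable (W x w)" for x w
    unfolding W_def by (intro countable_Un countable_UN cL cpick \<open>countable (UNIV :: 'n set)\<close>) auto
  obtain D where D: "countable D" "D0 \<subseteq> D" "\<And>x w. range x \<subseteq> D \<Longrightarrow> range w \<subseteq> D \<Longrightarrow> W x w \<subseteq> D"
    using countable_witness_closure[of W D0, OF cW D0(1)] by blast
  have scale: "real_of_rat q *\<^sub>R x \<in> D" if "x \<in> D" for x q
  proof -
    have "real_of_rat q *\<^sub>R x \<in> W (\<lambda>_. x) (\<lambda>_. x)" unfolding W_def by (rule UnI1, rule UnI2) blast
    then show ?thesis using D(3)[of "\<lambda>_. x" "\<lambda>_. x"] that by blast
  qed
  have sub: "subspace (closure D)"
  proof (rule subspace_closure_rational[OF _ _ scale])
    show "D \<noteq> {}" using D0 D by blast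
    show "x + y \<in> D" if "x \<in> D" "y \<in> D" for x y
    proof -
      have "x + y \<in> W (\<lambda>_. x) (\<lambda>_. y)" unfolding W_def by (rule UnI1, rule UnI1) blast
      then show ?thesis using D(3)[of "\<lambda>_. x" "\<lambda>_. y"] that by blast
    qed
  qed
  have "witness_closed \<Omega> r \<epsilon> D"
    unfolding witness_closed_def
  proof (intro allI impI)
    fix x w and M :: nat and q and P :: "('n, 'a) witness" and s
    assume xw: "range x \<subseteq> D" "range w \<subseteq> D" and P: "admissible \<Omega> 1 x P" "witness_mass P \<le> real M"
      "penalty r \<epsilon> x w P s < real_of_rat q"
    let ?L = "witness_shape P"
    define Ps where "Ps = (SOME Ps. good x w ?L M q Ps)"
    have "good x w ?L M q (P, s)" using P by (simp add: good_def)
    then have g: "good x w ?L M q Ps" unfolding Ps_def by (rule someI[of "good x w ?L M q"])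
    have "pick x w (?L, M, q) \<subseteq> (\<Union>t\<in>lists UNIV \<times> UNIV \<times> UNIV. pick x w t)" by (rule UN_upper) simp
    also have "\<dots> \<subseteq> W x w" unfolding W_def by (rule Un_upper2)
    also have "\<dots> \<subseteq> D" by (rule D(3)[OF xw])
    finally have "pick x w (?L, M, q) \<subseteq> D" .
    then have "snd Ps \<in> D" "witness_points (fst Ps) \<subseteq> D"
      by (simp_all add: pick_def Ps_def Let_def)
    with g show "\<exists>P' s'. witness_shape P' = ?L \<and> witness_points P' \<subseteq> D \<and> s' \<in> D \<and>
         admissible \<Omega> 1 x P' \<and> witness_mass P' \<le> real M \<and> penalty r \<epsilon> x w P' s' < real_of_rat q"
      by (intro exI[of _ "fst Ps"] exI[of _ "snd Ps"]) (auto simp: good_def split: prod.splits)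
  qed
  with D(1,2) sub show ?thesis by (rule that)
qed

text \<open>Weak duality: \<open>w i\<close> is split into \<open>witness_drift x P i\<close>,
  \<open>s\<close> and a remainder, and each piece is estimated by one property of
  \<open>\<xi>\<close>.\<close>

lemma penalty_ge_functionals:
  fixes x w :: "'n::finite \<Rightarrow> 'a::real_normed_vector"
  assumes \<xi>: "\<And>i. linear (\<xi> i)" "\<And>i h. \<bar>\<xi> i h\<bar> \<le> r * norm h" "\<And>s. \<bar>\<Sum>i\<in>UNIV. \<xi> i s\<bar> \<le> \<epsilon> * norm s"
    and P: "\<And>i k m b l. (i, k, m, b, l) \<in> set P \<Longrightarrow> 0 \<le> l \<and> \<xi> i (b - x i) \<le> 1 / real (Suc k) * norm (b - x i)"
  shows "(\<Sum>i\<in>UNIV. \<xi> i (w i)) \<le> penalty r \<epsilon> x w P s"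
proof -
  have drift: "(\<Sum>i\<in>UNIV. \<xi> i (witness_drift x P i)) \<le> witness_cost x P" using P
  proof (induction P)
    case Nil
    then show ?case using \<xi>(1) by (simp add: witness_drift_def witness_cost_def linear_0)
  next
    case (Cons a P)
    obtain i k m b l where a: "a = (i, k, m, b, l)" by (cases a)
    have l: "0 \<le> l" "\<xi> i (b - x i) \<le> 1 / real (Suc k) * norm (b - x i)"
      using Cons.prems[of i k m b l] by (simp_all add: a)
    have "(\<Sum>j\<in>UNIV. \<xi> j (witness_drift x (a # P) j))
       = (\<Sum>j\<in>UNIV. (if j = i then l * \<xi> i (b - x i) else 0) + \<xi> j (witness_drift x P j))"
      using \<xi>(1) by (intro sum.cong) (auto simp: a witness_drift_def linear_add linear_cmul linear_0)
    also have "\<dots> = l * \<xi> i (b - x i) + (\<Sum>j\<in>UNIV. \<xi> j (witness_drift x P j))"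
      by (simp add: sum.distrib)
    also have "l * \<xi> i (b - x i) \<le> l * (1 / real (Suc k) * norm (b - x i))"
      using l by (intro mult_left_mono)
    also have "(\<Sum>j\<in>UNIV. \<xi> j (witness_drift x P j)) \<le> witness_cost x P"
    proof (rule Cons.IH)
      show "0 \<le> l \<and> \<xi> i (b - x i) \<le> 1 / real (Suc k) * norm (b - x i)"
        if "(i, k, m, b, l) \<in> set P" for i k m b l
        using Cons.prems[of i k m b l] that by simp
    qed
    finally show ?case by (simp add: a witness_cost_def)
  qed
  have "\<xi> i (w i) \<le> r * norm (w i - witness_drift x P i - s) + \<xi> i (witness_drift x P i) + \<xi> i s" for i
    using \<xi>(2)[of i "w i - witness_drift x P i - s"] by (simp add: linear_diff[OF \<xi>(1)] abs_le_iff)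
  then have "(\<Sum>i\<in>UNIV. \<xi> i (w i)) \<le>
      (\<Sum>i\<in>UNIV. r * norm (w i - witness_drift x P i - s) + \<xi> i (witness_drift x P i) + \<xi> i s)"
    by (rule sum_mono)
  also have "\<dots> = r * (\<Sum>i\<in>UNIV. norm (w i - witness_drift x P i - s))
      + (\<Sum>i\<in>UNIV. \<xi> i (witness_drift x P i)) + (\<Sum>i\<in>UNIV. \<xi> i s)"
    by (simp add: sum.distrib sum_distrib_left)
  also have "\<dots> \<le> penalty r \<epsilon> x w P s"
    using drift \<xi>(3)[of s] by (simp add: penalty_def abs_le_iff)
  finally show ?thesis .
qed

text \<open>Hahn-Banach turns the absence of a cheap finite witness into exact Frechet normals.\<close>
lemma frechet_normals_if_penalty_ge:
  fixes \<Omega> :: "'n::finite \<Rightarrow> 'a::real_normed_vector set"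
  assumes r: "0 \<le> r" "0 \<le> \<epsilon>"
    and low: "\<And>P s. admissible \<Omega> 1 x P \<Longrightarrow> (\<And>i k m b l. (i, k, m, b, l) \<in> set P \<Longrightarrow> m = M i k) \<Longrightarrow>
        c \<le> penalty r \<epsilon> x w P s"
  obtains xs where "\<And>i. xs i \<in> frechet_normal (\<Omega> i) (x i)"
    "\<And>s. \<bar>\<Sum>i\<in>UNIV. xs i s\<bar> \<le> \<epsilon> * norm s" "c \<le> (\<Sum>i\<in>UNIV. xs i (w i))"
proof -
  \<comment> \<open>The radius index \<open>m\<close> is tied to \<open>i\<close> and the tolerance
    index \<open>k\<close> by \<open>M\<close>, so that a functional below the penalty obeys, for
    every \<open>k\<close>, the normal inequality on a whole ball around \<open>x i\<close>.\<close>
  define A where "A = {(P, s :: 'a). admissible \<Omega> 1 x P \<and> (\<forall>(i, k, m, b, l)\<in>set P. m = M i k)}"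
  define pen where "pen h = (\<lambda>(P, s). penalty r \<epsilon> x (($) h) P s)" for h :: "'a ^ 'n"
  define p where "p h = (INF a\<in>A. pen h a)" for h
  have A0: "([], s) \<in> A" for s by (simp add: A_def admissible_def)
  then have Ane: "A \<noteq> {}" by blast
  have pen0: "0 \<le> pen h a" if "a \<in> A" for h a
    using that r by (auto simp: A_def pen_def intro: penalty_nonneg)
  then have bdd: "bdd_below (pen h ` A)" for h by (rule bdd_belowI2)
  have p_le: "p h \<le> pen h a" if "a \<in> A" for h a
    unfolding p_def by (rule cINF_lower[OF bdd that])
  have "sublinear p"
  proof (rule sublinearI)
    fix h h' :: "'a ^ 'n"
    have add: "p (h + h') \<le> pen h a + pen h' a'" if a: "a \<in> A" "a' \<in> A" for a a'
    proof -
      obtain P s P' s' where Ps: "a = (P, s)" "a' = (P', s')" by (cases a, cases a')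
      \<comment> \<open>Concatenation of lists adds costs and drifts, and scaling the weights scales
        both; this is what makes \<open>p\<close> sublinear.\<close>
      have "(P @ P', s + s') \<in> A" using a by (auto simp: Ps A_def admissible_def)
      then have "p (h + h') \<le> pen (h + h') (P @ P', s + s')" by (rule p_le)
      also have "\<dots> \<le> pen h a + pen h' a'"
      proof -
        have "(\<Sum>i\<in>UNIV. norm ((h + h') $ i - witness_drift x (P @ P') i - (s + s')))
          \<le> (\<Sum>i\<in>UNIV. norm (h $ i - witness_drift x P i - s) + norm (h' $ i - witness_drift x P' i - s'))"
        proof (rule sum_mono)
          fix i
          have "(h + h') $ i - witness_drift x (P @ P') i - (s + s')
            = (h $ i - witness_drift x P i - s) + (h' $ i - witness_drift x P' i - s')"
            by (simp add: witness_drift_def)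
          then show "norm ((h + h') $ i - witness_drift x (P @ P') i - (s + s'))
            \<le> norm (h $ i - witness_drift x P i - s) + norm (h' $ i - witness_drift x P' i - s')"
            by (metis norm_triangle_ineq)
        qed
        also have "\<dots> = (\<Sum>i\<in>UNIV. norm (h $ i - witness_drift x P i - s))
            + (\<Sum>i\<in>UNIV. norm (h' $ i - witness_drift x P' i - s'))"
          by (rule sum.distrib)
        finally have 1: "r * (\<Sum>i\<in>UNIV. norm ((h + h') $ i - witness_drift x (P @ P') i - (s + s')))
          \<le> r * ((\<Sum>i\<in>UNIV. norm (h $ i - witness_drift x P i - s))
            + (\<Sum>i\<in>UNIV. norm (h' $ i - witness_drift x P' i - s')))"
          using r(1) by (rule mult_left_mono)
        have 2: "\<epsilon> * norm (s + s') \<le> \<epsilon> * (norm s + norm s')"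
          using r(2) by (intro mult_left_mono norm_triangle_ineq)
        show ?thesis
          using 1 2 by (simp add: Ps pen_def penalty_def witness_cost_def distrib_left)
      qed
      finally show ?thesis .
    qed
    have "p (h + h') - pen h' a' \<le> p h" if "a' \<in> A" for a'
      unfolding p_def[of h] using add that Ane by (intro cINF_greatest) (auto simp: algebra_simps)
    then have "p (h + h') - p h \<le> p h'"
      unfolding p_def[of h'] using Ane by (intro cINF_greatest) (auto simp: algebra_simps)
    then show "p (h + h') \<le> p h + p h'" by simp
  next
    fix c :: real and h :: "'a ^ 'n" assume c: "0 < c"
    have "p (c *\<^sub>R h) / c \<le> p h"
      unfolding p_def[of h]
    proof (rule cINF_greatest[OF Ane])
      fix a assume a: "a \<in> A"
      obtain P s where Ps: "a = (P, s)" by (cases a)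
      define P' where "P' = map (\<lambda>(i, k, m, b, l). (i, k, m, b, c * l)) P"
      have "(P', c *\<^sub>R s) \<in> A" using a c by (auto simp: Ps P'_def A_def admissible_def)
      then have "p (c *\<^sub>R h) \<le> pen (c *\<^sub>R h) (P', c *\<^sub>R s)" by (rule p_le)
      also have "\<dots> = c * pen h a"
      proof -
        have cost: "witness_cost x P' = c * witness_cost x P"
          unfolding P'_def by (induction P) (auto simp: witness_cost_def algebra_simps)
        have drift: "witness_drift x P' i = c *\<^sub>R witness_drift x P i" for i
          unfolding P'_def by (induction P) (auto simp: witness_drift_def algebra_simps)
        have "norm ((c *\<^sub>R h) $ i - witness_drift x P' i - c *\<^sub>R s)
            = c * norm (h $ i - witness_drift x P i - s)" for i
        proof -
          have "(c *\<^sub>R h) $ i - witness_drift x P' i - c *\<^sub>R s = c *\<^sub>R (h $ i - witness_drift x P i - s)"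
            by (simp add: drift algebra_simps)
          then show ?thesis using c by simp
        qed
        then show ?thesis
          using c by (simp add: Ps pen_def penalty_def cost algebra_simps flip: sum_distrib_left)
      qed
      finally show "p (c *\<^sub>R h) / c \<le> pen h a" using c by (simp add: field_simps)
    qed
    then show "p (c *\<^sub>R h) \<le> c * p h" using c by (simp add: field_simps)
  next
    have "0 \<le> p 0" unfolding p_def using pen0 Ane by (intro cINF_greatest) auto
    moreover have "pen 0 ([], 0) = 0"
      by (simp add: pen_def penalty_def witness_cost_def witness_drift_def)
    ultimately show "p 0 = 0" using p_le[OF A0, of 0 0] by simp
  qed
  then obtain F where F: "linear F" "\<And>h. F h \<le> p h" "F (\<chi> i. w i) = p (\<chi> i. w i)"
    using linear_below_sublinear_attaining by blast
  have F_pen: "F h \<le> pen h a" if "a \<in> A" for h a using F(2)[of h] p_le[OF that, of h] by simp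
  define xs where "xs i v = F (axis i v)" for i v
  have axis: "axis i (u + v) = axis i u + axis i v" "axis i (c *\<^sub>R u) = c *\<^sub>R axis i u"
    for i :: 'n and u v :: 'a and c
    by (auto simp: vec_eq_iff axis_def)
  have lin: "linear (xs i)" for i
    by (rule linearI) (simp_all add: xs_def axis linear_add[OF F(1)] linear_cmul[OF F(1)])
  \<comment> \<open>The pairs \<open>([], 0)\<close>, \<open>([], s)\<close> and a one-entry list
    each isolate one term of the penalty. They yield the norm bound, the bound for the sum and the
    normal inequality.\<close>
  have bound: "xs i v \<le> r * norm v" for i v
  proof -
    have "(\<Sum>j\<in>UNIV. norm (axis i v $ j)) = (\<Sum>j\<in>UNIV. if j = i then norm v else 0)"
      by (intro sum.cong) (auto simp: axis_def)
    then have "pen (axis i v) ([], 0) = r * norm v"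
      by (simp add: pen_def penalty_def witness_cost_def witness_drift_def)
    then show ?thesis using F_pen[OF A0, of "axis i v" 0] by (simp add: xs_def)
  qed
  have bl: "bounded_linear (xs i)" for i
  proof (rule bounded_linear_intro[where K = r])
    fix v show "norm (xs i v) \<le> norm v * r"
      using bound[of i v] bound[of i "- v"] linear_neg[OF lin, of i v] by (simp add: abs_le_iff mult.commute)
  qed (simp_all add: linear_add[OF lin] linear_cmul[OF lin])
  have sum_xs: "(\<Sum>i\<in>UNIV. xs i (h i)) = F (\<chi> i. h i)" for h
  proof -
    have "(\<chi> i. h i) = (\<Sum>i\<in>UNIV. axis i (h i))"
      by (auto simp: vec_eq_iff axis_def sum.delta)
    then show ?thesis by (simp add: xs_def linear_sum[OF F(1)])
  qed
  have sum_le: "(\<Sum>i\<in>UNIV. xs i s) \<le> \<epsilon> * norm s" for s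
  proof -
    have "pen (\<chi> i. s) ([], s) = \<epsilon> * norm s"
      by (simp add: pen_def penalty_def witness_cost_def witness_drift_def)
    then show ?thesis using F_pen[OF A0, of "\<chi> i. s" s] by (simp add: sum_xs)
  qed
  show ?thesis
  proof (rule that[of xs])
    show "xs i \<in> frechet_normal (\<Omega> i) (x i)" for i
      unfolding frechet_normal_def mem_Collect_eq
    proof (intro conjI allI impI bl)
      fix e :: real assume "0 < e"
      then obtain k where k: "1 / real (Suc k) < e" using nat_approx_posE by blast
      show "\<exists>\<delta>>0. \<forall>u\<in>\<Omega> i. 0 < norm (u - x i) \<and> norm (u - x i) < \<delta> \<longrightarrow> xs i (u - x i) \<le> e * norm (u - x i)"
      proof (intro exI[of _ "1 / real (Suc (M i k))"] conjI ballI impI)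
        fix u assume u: "u \<in> \<Omega> i" "0 < norm (u - x i) \<and> norm (u - x i) < 1 / real (Suc (M i k))"
        \<comment> \<open>The drift of this entry cancels \<open>axis i (u - x i)\<close>, so only
          its cost remains.\<close>
        let ?P = "[(i, k, M i k, u, 1 :: real)]"
        have "(?P, 0) \<in> A" using u by (simp add: A_def admissible_def)
        then have "xs i (u - x i) \<le> pen (axis i (u - x i)) (?P, 0)" unfolding xs_def by (rule F_pen)
        also have "\<dots> = 1 / real (Suc k) * norm (u - x i)"
        proof -
          have "axis i (u - x i) $ j - witness_drift x ?P j - 0 = 0" for j
            by (simp add: witness_drift_def axis_def)
          then show ?thesis by (simp add: pen_def penalty_def witness_cost_def)
        qed
        also have "\<dots> \<le> e * norm (u - x i)" using k by (intro mult_right_mono) auto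
        finally show "xs i (u - x i) \<le> e * norm (u - x i)" .
      qed simp
    qed
    show "\<bar>\<Sum>i\<in>UNIV. xs i s\<bar> \<le> \<epsilon> * norm s" for s
      using sum_le[of s] sum_le[of "- s"] by (simp add: linear_neg[OF lin] sum_negf abs_le_iff)
    have "c \<le> p (\<chi> i. w i)"
      unfolding p_def using Ane
    proof (rule cINF_greatest)
      fix a assume "a \<in> A"
      moreover have "($) (\<chi> i. w i) = w" by auto
      ultimately show "c \<le> pen (\<chi> i. w i) a" using low by (fastforce simp: A_def pen_def)
    qed
    then show "c \<le> (\<Sum>i\<in>UNIV. xs i (w i))" by (simp add: sum_xs F(3))
  qed
qed

text \<open>A cheap witness at \<open>x\<close> would, after moving \<open>x\<close> slightly into
  \<open>D\<close>, be matched by a cheap one with points in \<open>D\<close>. Seen from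
  \<open>x\<close> again, these points lie in \<open>closure D\<close> near \<open>x i\<close>,
  where \<open>\<xi>\<close> obeys the normal inequality, and \<open>penalty_ge_functionals\<close>
  rules this out. So functionals that are normal relative to \<open>closure D\<close> exclude cheap
  witnesses in the whole space.\<close>

lemma separable_reduction:
  fixes \<Omega> :: "'n::finite \<Rightarrow> 'a::real_normed_vector set"
  assumes r: "0 \<le> r" "0 \<le> \<epsilon>"
    and rich: "witness_closed \<Omega> r \<epsilon> D"
    and xD: "\<And>i. x i \<in> closure D" and wD: "\<And>i. w i \<in> D"
    and \<xi>: "\<And>i. linear (\<xi> i)" "\<And>i h. \<bar>\<xi> i h\<bar> \<le> r * norm h" "\<And>s. \<bar>\<Sum>i\<in>UNIV. \<xi> i s\<bar> \<le> \<epsilon> * norm s"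
    and normal: "\<And>i e. 0 < e \<Longrightarrow> \<exists>\<delta>>0. \<forall>u\<in>\<Omega> i \<inter> closure D. norm (u - x i) < \<delta> \<longrightarrow>
       \<xi> i (u - x i) \<le> e * norm (u - x i)"
  obtains xs where "\<And>i. xs i \<in> frechet_normal (\<Omega> i) (x i)"
    "\<And>s. \<bar>\<Sum>i\<in>UNIV. xs i s\<bar> \<le> \<epsilon> * norm s" "(\<Sum>i\<in>UNIV. \<xi> i (w i)) \<le> (\<Sum>i\<in>UNIV. xs i (w i))"
proof -
  define c where "c = (\<Sum>i\<in>UNIV. \<xi> i (w i))"
  \<comment> \<open>Radius \<open>2 / (m + 1)\<close> instead of \<open>1 / (m + 1)\<close>: the new
    witness points are close to a perturbed \<open>x'\<close>, and the way back to \<open>x\<close>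
    has to be absorbed.\<close>
  have "\<exists>m. \<forall>u\<in>\<Omega> i \<inter> closure D. norm (u - x i) < 2 / real (Suc m) \<longrightarrow>
       \<xi> i (u - x i) \<le> 1 / real (Suc k) * norm (u - x i)" for i k
  proof -
    obtain \<delta> where \<delta>: "0 < \<delta>" "\<forall>u\<in>\<Omega> i \<inter> closure D. norm (u - x i) < \<delta> \<longrightarrow>
       \<xi> i (u - x i) \<le> 1 / real (Suc k) * norm (u - x i)"
      using normal[of "1 / real (Suc k)" i] by auto
    obtain m where "1 / real (Suc m) < \<delta> / 2" using nat_approx_posE[of "\<delta>/2"] \<delta>(1) by auto
    then have "2 / real (Suc m) < \<delta>" by (simp add: field_simps)
    with \<delta>(2) show ?thesis by (intro exI[of _ m]) auto
  qed
  then obtain M where M: "\<And>i k u. u \<in> \<Omega> i \<Longrightarrow> u \<in> closure D \<Longrightarrow> norm (u - x i) < 2 / real (Suc (M i k)) \<Longrightarrow>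
       \<xi> i (u - x i) \<le> 1 / real (Suc k) * norm (u - x i)"
    by (metis IntI)
  have "c \<le> penalty r \<epsilon> x w P s"
    if adm: "admissible \<Omega> 1 x P" and PM: "\<And>i k m b l. (i, k, m, b, l) \<in> set P \<Longrightarrow> m = M i k" for P s
  proof (rule ccontr)
    assume neg: "\<not> c \<le> penalty r \<epsilon> x w P s"
    \<comment> \<open>A quarter of the gap each for the passage to \<open>x'\<close>, for fitting in
      the rational \<open>q\<close>, for the passage back, and as a reserve.\<close>
    define \<gamma> where "\<gamma> = (c - penalty r \<epsilon> x w P s) / 4"
    have \<gamma>: "0 < \<gamma>" using neg by (simp add: \<gamma>_def)
    obtain K :: nat where K: "witness_mass P \<le> real K" using real_arch_simple by blast
    have "\<forall>\<^sub>F \<theta> in at_right (0::real). \<theta> < 1 / real (Suc m) - norm (b - x i) \<and> \<theta> < 1 / real (Suc m)"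
      if "(i, k, m, b, l) \<in> set P" for i k m b l
    proof -
      have "0 < 1 / real (Suc m) - norm (b - x i)" using adm that by (force simp: admissible_def)
      then show ?thesis by (intro eventually_conj order_tendstoD(2)[OF tendsto_ident_at]) auto
    qed
    then have ev1: "\<forall>\<^sub>F \<theta> in at_right (0::real). \<forall>(i, k, m, b, l)\<in>set P.
        \<theta> < 1 / real (Suc m) - norm (b - x i) \<and> \<theta> < 1 / real (Suc m)"
      by (intro eventually_ball_finite) auto
    have "((\<lambda>\<theta>. (1 + r) * (real K * \<theta>)) \<longlongrightarrow> (1 + r) * (real K * 0)) (at_right 0)"
      by (intro tendsto_intros)
    then have ev2: "\<forall>\<^sub>F \<theta> in at_right (0::real). (1 + r) * (real K * \<theta>) < \<gamma>"
      using \<gamma> by (intro order_tendstoD(2)[of _ "(1 + r) * (real K * 0)"]) auto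
    have "\<forall>\<^sub>F \<theta> in at_right (0::real). 0 < \<theta>" by (simp add: eventually_at_right_less)
    then have "\<forall>\<^sub>F \<theta> in at_right (0::real). 0 < \<theta> \<and> (1 + r) * (real K * \<theta>) < \<gamma> \<and> (\<forall>(i, k, m, b, l)\<in>set P.
        \<theta> < 1 / real (Suc m) - norm (b - x i) \<and> \<theta> < 1 / real (Suc m))"
      using ev1 ev2 by (intro eventually_conj)
    then obtain \<theta> where \<theta>: "0 < \<theta>" "(1 + r) * (real K * \<theta>) < \<gamma>"
      and \<theta>P: "\<forall>(i, k, m, b, l)\<in>set P. \<theta> < 1 / real (Suc m) - norm (b - x i) \<and> \<theta> < 1 / real (Suc m)"
      using eventually_happens'[OF trivial_limit_at_right_real] by blast
    have \<theta>3: "\<theta> < 1 / real (Suc m) - norm (b - x i)" "\<theta> < 1 / real (Suc m)"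
      if "(i, k, m, b, l) \<in> set P" for i k m b l
      using bspec[OF \<theta>P that] by simp_all
    have err: "(1 + r) * (m * \<theta>) \<le> \<gamma>" if "m \<le> real K" for m
    proof -
      have "(1 + r) * (m * \<theta>) \<le> (1 + r) * (real K * \<theta>)"
        using that \<theta>(1) r by (intro mult_left_mono mult_right_mono) auto
      with \<theta>(2) show ?thesis by simp
    qed
    have "\<exists>y\<in>D. dist y (x i) < \<theta>" for i
      using xD[of i] \<theta>(1) unfolding closure_approachable by blast
    then obtain x' where x': "\<And>i. x' i \<in> D" "\<And>i. dist (x' i) (x i) < \<theta>" by metis
    have xx': "norm (x i - x' i) \<le> \<theta>" "norm (x' i - x i) \<le> \<theta>" for i
      using x'(2)[of i] by (simp_all add: dist_norm norm_minus_commute)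
    have adm': "admissible \<Omega> 1 x' P"
      unfolding admissible_def
    proof safe
      fix i k m b l assume P: "(i, k, m, b, l) \<in> set P"
      then show "b \<in> \<Omega> i" "0 \<le> l" using adm by (auto simp: admissible_def)
      have "norm (b - x' i) \<le> norm (b - x i) + norm (x i - x' i)"
        using norm_triangle_ineq[of "b - x i" "x i - x' i"] by simp
      also have "\<dots> < 1 / real (Suc m)" using \<theta>3(1)[OF P] xx'(1)[of i] by linarith
      finally show "norm (b - x' i) < 1 / real (Suc m)" .
    qed
    have "penalty r \<epsilon> x' w P s \<le> penalty r \<epsilon> x w P s + (1 + r) * (witness_mass P * \<theta>)"
      by (rule penalty_perturb[OF adm xx'(2) r(1)])
    also have "\<dots> \<le> penalty r \<epsilon> x w P s + \<gamma>" using err[OF K] by simp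
    also have "\<dots> = c - 3 * \<gamma>" by (simp add: \<gamma>_def field_simps)
    finally have pen': "penalty r \<epsilon> x' w P s \<le> c - 3 * \<gamma>" .
    have "c - 3 * \<gamma> < c - 2 * \<gamma>" using \<gamma> by simp
    then obtain q where q: "c - 3 * \<gamma> < real_of_rat q" "real_of_rat q < c - 2 * \<gamma>"
      using of_rat_dense by blast
    have "range x' \<subseteq> D" "range w \<subseteq> D" using x'(1) wD by auto
    moreover have "penalty r \<epsilon> x' w P s < real_of_rat q" using pen' q(1) by simp
    ultimately have "\<exists>P' s'. witness_shape P' = witness_shape P \<and> witness_points P' \<subseteq> D \<and> s' \<in> D \<and>
        admissible \<Omega> 1 x' P' \<and> witness_mass P' \<le> real K \<and> penalty r \<epsilon> x' w P' s' < real_of_rat q"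
      using rich[unfolded witness_closed_def, rule_format, of x' w P K s q] adm' K by simp
    then obtain P' s' where P': "witness_shape P' = witness_shape P" "witness_points P' \<subseteq> D"
      "admissible \<Omega> 1 x' P'" "witness_mass P' \<le> real K" "penalty r \<epsilon> x' w P' s' < real_of_rat q"
      by blast
    have "c \<le> penalty r \<epsilon> x w P' s'"
      unfolding c_def
    proof (rule penalty_ge_functionals[OF \<xi>])
      fix i k m b l assume in': "(i, k, m, b, l) \<in> set P'"
      have "(i, k, m) \<in> set (witness_shape P')" using in' by (force simp: witness_shape_def)
      then obtain b0 l0 where in0: "(i, k, m, b0, l0) \<in> set P"
        unfolding P'(1) by (auto simp: witness_shape_def)
      have b: "b \<in> \<Omega> i" "norm (b - x' i) < 1 / real (Suc m)" "0 \<le> l"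
        using P'(3) in' by (auto simp: admissible_def)
      have "b \<in> D" using P'(2) in' by (force simp: witness_points_def)
      then have bc: "b \<in> closure D" using closure_subset by blast
      have "norm (b - x i) \<le> norm (b - x' i) + norm (x' i - x i)"
        using norm_triangle_ineq[of "b - x' i" "x' i - x i"] by simp
      also have "\<dots> < 1 / real (Suc m) + 1 / real (Suc m)"
        using b(2) xx'(2)[of i] \<theta>3(2)[OF in0] by linarith
      also have "\<dots> = 2 / real (Suc (M i k))" using PM[OF in0] by simp
      finally show "0 \<le> l \<and> \<xi> i (b - x i) \<le> 1 / real (Suc k) * norm (b - x i)"
        using M[OF b(1) bc] b(3) by blast
    qed
    also have "\<dots> \<le> penalty r \<epsilon> x' w P' s' + (1 + r) * (witness_mass P' * \<theta>)"
      by (rule penalty_perturb[OF P'(3) xx'(1) r(1)])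
    also have "\<dots> < c" using P'(5) q(2) err[OF P'(4)] \<gamma> by linarith
    finally show False by simp
  qed
  then show ?thesis
    by (rule frechet_normals_if_penalty_ge[OF r, of \<Omega> x M c w]) (auto intro: that simp: c_def)
qed

section \<open>The extremal principle\<close>

context
  fixes Y :: "'a::real_normed_vector set" and N :: "'a \<Rightarrow> real"
  assumes Y: "subspace Y"
    and N_lower: "\<And>x. norm x / 2 \<le> N x" and N_upper: "\<And>x. N x \<le> norm x"
    and N_lip: "\<And>x y. \<bar>N x - N y\<bar> \<le> norm (x - y)"
    and N_smooth: "\<And>y. y \<in> Y \<Longrightarrow> y \<noteq> 0 \<Longrightarrow> \<exists>u\<in>dual_ball. u y = N y \<and>
       (\<forall>e>0. \<exists>\<delta>>0. \<forall>h\<in>Y. norm h < \<delta> \<longrightarrow> N (y + h) \<le> N y + u h + e * norm h)"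
begin

lemma N_nonneg: "0 \<le> N x"
  using N_lower[of x] norm_ge_zero[of x] by linarith

lemma N_square_le: "(N (p + h))\<^sup>2 \<le> (N p)\<^sup>2 + 2 * N p * (N (p + h) - N p) + (norm h)\<^sup>2"
proof -
  have "\<bar>N (p + h) - N p\<bar> \<le> norm h" using N_lip[of "p + h" p] by simp
  then have "(N (p + h) - N p)\<^sup>2 \<le> (norm h)\<^sup>2" by (metis abs_le_square_iff abs_norm_cancel)
  moreover have "(N (p + h))\<^sup>2 = (N p)\<^sup>2 + 2 * N p * (N (p + h) - N p) + (N (p + h) - N p)\<^sup>2"
    by (simp add: power2_eq_square algebra_simps)
  ultimately show ?thesis by linarith
qed

text \<open>Squaring removes the singularity at 0, so \<open>p = 0\<close> is allowed. The value of
  \<open>s p\<close> is Euler's identity for a function homogeneous of degree 2; it later yields the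
  lower bound on the normals.\<close>

lemma square_superdifferentiable:
  assumes p: "p \<in> Y"
  obtains s where "linear s" "\<And>h. \<bar>s h\<bar> \<le> 2 * N p * norm h" "s p = 2 * (N p)\<^sup>2"
    "\<And>e. 0 < e \<Longrightarrow> \<exists>\<delta>>0. \<forall>h\<in>Y. norm h < \<delta> \<longrightarrow> (N (p + h))\<^sup>2 \<le> (N p)\<^sup>2 + s h + e * norm h"
proof (cases "p = 0")
  case True
  have N0: "N 0 = 0" using N_upper[of 0] N_nonneg[of 0] by simp
  have "(N (p + h))\<^sup>2 \<le> (N p)\<^sup>2 + 0 + e * norm h" if "norm h < e" for e h
  proof -
    have "(norm h)\<^sup>2 \<le> e * norm h" using that by (simp add: power2_eq_square mult_right_mono)
    with N_square_le[of p h] show ?thesis by (simp add: True N0)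
  qed
  then show ?thesis by (intro that[of "\<lambda>_. 0"]) (auto simp: True N0 linear_iff)
next
  case False
  obtain u where u: "u \<in> dual_ball" "u p = N p"
    "\<And>e. 0 < e \<Longrightarrow> \<exists>\<delta>>0. \<forall>h\<in>Y. norm h < \<delta> \<longrightarrow> N (p + h) \<le> N p + u h + e * norm h"
    using N_smooth[OF p False] by blast
  have Np: "0 < N p" using N_lower[of p] False zero_less_norm_iff[of p] by linarith
  show ?thesis
  proof (rule that[of "\<lambda>h. 2 * N p * u h"])
    show "linear (\<lambda>h. 2 * N p * u h)" using u(1) by (auto simp: linear_iff dual_ballD algebra_simps)
    show "\<bar>2 * N p * u h\<bar> \<le> 2 * N p * norm h" for h
      using Np dual_ballD(2)[OF u(1), of h] by (simp add: abs_mult)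
    show "2 * N p * u p = 2 * (N p)\<^sup>2" by (simp add: u(2) power2_eq_square)
    fix e :: real assume e: "0 < e"
    have "0 < e / (4 * N p)" using e Np by simp
    then obtain \<delta> where \<delta>: "0 < \<delta>"
      "\<And>h. h \<in> Y \<Longrightarrow> norm h < \<delta> \<Longrightarrow> N (p + h) \<le> N p + u h + e / (4 * N p) * norm h"
      using u(3) by blast
    have "(N (p + h))\<^sup>2 \<le> (N p)\<^sup>2 + 2 * N p * u h + e * norm h"
      if h: "h \<in> Y" "norm h < min \<delta> (e/2)" for h
    proof -
      have "2 * N p * (N (p + h) - N p) \<le> 2 * N p * (u h + e / (4 * N p) * norm h)"
        using \<delta>(2)[of h] h Np by (intro mult_left_mono) auto
      also have "\<dots> = 2 * N p * u h + e/2 * norm h" using Np by (simp add: field_simps)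
      finally have 1: "2 * N p * (N (p + h) - N p) \<le> 2 * N p * u h + e/2 * norm h" .
      have 2: "(norm h)\<^sup>2 \<le> e/2 * norm h"
        using h unfolding power2_eq_square by (intro mult_right_mono) auto
      show ?thesis using N_square_le[of p h] 1 2 by linarith
    qed
    then show "\<exists>\<delta>>0. \<forall>h\<in>Y. norm h < \<delta> \<longrightarrow> (N (p + h))\<^sup>2 \<le> (N p)\<^sup>2 + 2 * N p * u h + e * norm h"
      using \<delta>(1) e by (intro exI[of _ "min \<delta> (e/2)"]) auto
  qed
qed

text \<open>The estimates of the single terms need not hold on a common neighbourhood. Finitely many
  leading terms share one; on the tail a bound linear in \<open>norm h\<close> holds uniformly in
  \<open>k\<close>, and the geometric weights make its sum small.\<close>

lemma series_superdifferentiable: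
  assumes p: "\<And>k. p k \<in> Y" "\<And>k. N (p k) \<le> 1" and \<mu>: "0 < \<mu>"
  obtains t where "linear t" "\<And>h. \<bar>t h\<bar> \<le> 4 * \<mu> * norm h"
    "\<And>e. 0 < e \<Longrightarrow> \<exists>\<delta>>0. \<forall>h\<in>Y. norm h < \<delta> \<longrightarrow>
       summable (\<lambda>k. \<mu> * (1/2)^k * ((N (p k + h))\<^sup>2 - (N (p k))\<^sup>2)) \<longrightarrow>
       (\<Sum>k. \<mu> * (1/2)^k * ((N (p k + h))\<^sup>2 - (N (p k))\<^sup>2)) \<le> t h + e * norm h"
proof -
  have "\<exists>s. linear s \<and> (\<forall>h. \<bar>s h\<bar> \<le> 2 * N (p k) * norm h) \<and>
    (\<forall>e>0. \<exists>\<delta>>0. \<forall>h\<in>Y. norm h < \<delta> \<longrightarrow> (N (p k + h))\<^sup>2 \<le> (N (p k))\<^sup>2 + s h + e * norm h)" for k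
    by (rule square_superdifferentiable[OF p(1)[of k]]) blast
  then obtain s where s: "\<And>k. linear (s k)" "\<And>k h. \<bar>s k h\<bar> \<le> 2 * N (p k) * norm h"
    "\<And>k e. 0 < e \<Longrightarrow> \<exists>\<delta>>0. \<forall>h\<in>Y. norm h < \<delta> \<longrightarrow> (N (p k + h))\<^sup>2 \<le> (N (p k))\<^sup>2 + s k h + e * norm h"
    by metis
  have s2: "\<bar>s k h\<bar> \<le> 2 * norm h" for k h
  proof -
    have "2 * N (p k) * norm h \<le> 2 * norm h" using p(2)[of k] by (intro mult_right_mono) auto
    with s(2)[of k h] show ?thesis by linarith
  qed
  have geo: "(\<lambda>k. \<mu> * (1/2)^k * c) sums (2 * \<mu> * c)" for c
    using sums_mult2[OF sums_mult[OF geometric_sums[of "1/2 :: real"], of \<mu>], of c] by (simp add: mult_ac)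
  have abs_le: "\<bar>\<mu> * (1/2)^k * s k h\<bar> \<le> \<mu> * (1/2)^k * (2 * norm h)" for k h
    using s2[of k h] \<mu> by (simp add: abs_mult)
  have summ: "summable (\<lambda>k. \<mu> * (1/2)^k * s k h)" for h
    by (rule summable_comparison_test'[OF sums_summable[OF geo[of "2 * norm h"]]]) (use abs_le in auto)
  define t where "t h = (\<Sum>k. \<mu> * (1/2)^k * s k h)" for h
  have "linear t"
  proof (rule linearI)
    show "t (x + y) = t x + t y" for x y
      unfolding t_def by (subst suminf_add[OF summ summ]) (simp add: linear_add[OF s(1)] distrib_left)
    show "t (c *\<^sub>R x) = c *\<^sub>R t x" for c x
      unfolding t_def real_scaleR_def
      by (subst suminf_mult[OF summ, symmetric]) (simp add: linear_cmul[OF s(1)] mult_ac)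
  qed
  moreover have "\<bar>t h\<bar> \<le> 4 * \<mu> * norm h" for h
  proof -
    have "\<bar>t h\<bar> \<le> (\<Sum>k. \<bar>\<mu> * (1/2)^k * s k h\<bar>)"
      unfolding t_def
      by (intro summable_rabs summable_comparison_test'[OF sums_summable[OF geo[of "2 * norm h"]]])
        (use abs_le in auto)
    also have "\<dots> \<le> (\<Sum>k. \<mu> * (1/2)^k * (2 * norm h))"
      by (intro suminf_le abs_le sums_summable[OF geo]
          summable_comparison_test'[OF sums_summable[OF geo[of "2 * norm h"]]]) (use abs_le in auto)
    also have "\<dots> = 4 * \<mu> * norm h" using sums_unique[OF geo[of "2 * norm h"]] by simp
    finally show ?thesis .
  qed
  moreover have "\<exists>\<delta>>0. \<forall>h\<in>Y. norm h < \<delta> \<longrightarrow>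
       summable (\<lambda>k. \<mu> * (1/2)^k * ((N (p k + h))\<^sup>2 - (N (p k))\<^sup>2)) \<longrightarrow>
       (\<Sum>k. \<mu> * (1/2)^k * ((N (p k + h))\<^sup>2 - (N (p k))\<^sup>2)) \<le> t h + e * norm h" if e: "0 < e" for e
  proof -
    \<comment> \<open>Half of \<open>e\<close> goes to the leading terms, whose weights sum to at
      most \<open>2 * \<mu>\<close>. The other half goes to the tail, whose bound
      \<open>(1/2)^K * (10 * \<mu> * norm h)\<close> determines \<open>K\<close>.\<close>
    define c where "c = e / (4 * \<mu>)"
    have c: "0 < c" "2 * \<mu> * c = e / 2" using e \<mu> by (auto simp: c_def field_simps)
    obtain K where K: "(1/2 :: real)^K < e / (20 * \<mu>)"
      using real_arch_pow_inv[of "e / (20 * \<mu>)" "1/2"] e \<mu> by auto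
    obtain d where d: "\<And>k. 0 < d k"
      "\<And>k h. h \<in> Y \<Longrightarrow> norm h < d k \<Longrightarrow> (N (p k + h))\<^sup>2 \<le> (N (p k))\<^sup>2 + s k h + c * norm h"
      using s(3)[OF c(1)] by metis
    define \<delta> where "\<delta> = Min (insert 1 (d ` {..<K}))"
    have \<delta>: "0 < \<delta>" "\<delta> \<le> 1" "\<And>k. k < K \<Longrightarrow> \<delta> \<le> d k" using d(1) by (auto simp: \<delta>_def)
    have "(\<Sum>k. \<mu> * (1/2)^k * ((N (p k + h))\<^sup>2 - (N (p k))\<^sup>2)) \<le> t h + e * norm h"
      if h: "h \<in> Y" "norm h < \<delta>"
        and sm: "summable (\<lambda>k. \<mu> * (1/2)^k * ((N (p k + h))\<^sup>2 - (N (p k))\<^sup>2))" for h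
    proof -
      define q where "q k = \<mu> * (1/2)^k * ((N (p k + h))\<^sup>2 - (N (p k))\<^sup>2 - s k h)" for k
      have sq: "summable q" and q_eq: "suminf q = (\<Sum>k. \<mu> * (1/2)^k * ((N (p k + h))\<^sup>2 - (N (p k))\<^sup>2)) - t h"
        using summable_diff[OF sm summ[of h]] suminf_diff[OF sm summ[of h]]
        unfolding q_def t_def by (simp_all only: right_diff_distrib)
      \<comment> \<open>The 5 is 2 + 1 + 2: the first-order term with
        \<open>N (p k) \<le> 1\<close>, the quadratic term with \<open>norm h \<le> 1\<close>, and
        \<open>s k h\<close>.\<close>
      have far: "(N (p k + h))\<^sup>2 - (N (p k))\<^sup>2 - s k h \<le> 5 * norm h" for k
      proof -
        have "2 * N (p k) * (N (p k + h) - N (p k)) \<le> 2 * 1 * norm h"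
          using N_lip[of "p k + h" "p k"] p(2)[of k] N_nonneg[of "p k"]
          by (intro order_trans[OF mult_left_mono mult_right_mono]) auto
        moreover have "(norm h)\<^sup>2 \<le> 1 * norm h"
          using h \<delta>(2) unfolding power2_eq_square by (intro mult_right_mono) auto
        ultimately show ?thesis using N_square_le[of "p k" h] s2[of k h] by (simp add: abs_le_iff)
      qed
      have "q (k + K) \<le> \<mu> * (1/2)^k * ((1/2)^K * (5 * norm h))" for k
      proof -
        have "q (k + K) \<le> \<mu> * (1/2)^(k + K) * (5 * norm h)"
          unfolding q_def using far \<mu> by (intro mult_left_mono) auto
        then show ?thesis by (simp add: power_add mult.assoc)
      qed
      then have "(\<Sum>k. q (k + K)) \<le> (\<Sum>k. \<mu> * (1/2)^k * ((1/2)^K * (5 * norm h)))"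
        by (intro suminf_le sums_summable[OF geo] summable_ignore_initial_segment[OF sq])
      also have "\<dots> = (1/2)^K * (10 * \<mu> * norm h)"
        using sums_unique[OF geo[of "(1/2)^K * (5 * norm h)"]] by (simp add: mult_ac)
      also have "\<dots> \<le> e / (20 * \<mu>) * (10 * \<mu> * norm h)" using K \<mu> by (intro mult_right_mono) auto
      also have "\<dots> = e/2 * norm h" using \<mu> by simp
      finally have tail: "(\<Sum>k. q (k + K)) \<le> e/2 * norm h" .
      have "(\<Sum>k<K. q k) \<le> (\<Sum>k<K. \<mu> * (1/2)^k * (c * norm h))"
      proof (rule sum_mono)
        fix k assume "k \<in> {..<K}"
        then have "(N (p k + h))\<^sup>2 - (N (p k))\<^sup>2 - s k h \<le> c * norm h"
          using d(2)[OF h(1), of k] h(2) \<delta>(3)[of k] by simp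
        then show "q k \<le> \<mu> * (1/2)^k * (c * norm h)"
          unfolding q_def using \<mu> by (intro mult_left_mono) auto
      qed
      also have "\<dots> \<le> (\<Sum>k. \<mu> * (1/2)^k * (c * norm h))"
        using \<mu> c(1) by (intro sum_le_suminf sums_summable[OF geo]) auto
      also have "\<dots> = (2 * \<mu> * c) * norm h"
        using sums_unique[OF geo[of "c * norm h"]] by (simp add: mult_ac)
      finally have "(\<Sum>k<K. q k) \<le> e/2 * norm h" unfolding c(2) .
      with tail have "suminf q \<le> e/2 * norm h + e/2 * norm h"
        by (subst suminf_split_initial_segment[OF sq, of K]) simp
      then show ?thesis unfolding q_eq by simp
    qed
    with \<delta>(1) show ?thesis by blast
  qed
  ultimately show ?thesis by (rule that)
qed

end

text \<open>Concavity of the square root; it passes an upper first-order estimate on from a positive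
  quantity to its root.\<close>

lemma sqrt_le_tangent:
  assumes "0 < q" "0 \<le> q'"
  shows "sqrt q' \<le> sqrt q + (q' - q) / (2 * sqrt q)"
proof -
  have "0 \<le> (sqrt q' - sqrt q)\<^sup>2" by simp
  also have "(sqrt q' - sqrt q)\<^sup>2 = q' + q - 2 * sqrt q * sqrt q'"
    using assms by (simp add: power2_diff)
  finally have le: "2 * sqrt q * sqrt q' \<le> q' + q" by simp
  define r where "r = sqrt q"
  have r: "0 < r" "q = r * r" using assms by (auto simp: r_def)
  show ?thesis using le r unfolding r_def[symmetric] by (simp add: field_simps)
qed

text \<open>The pairing with the bounded test vectors \<open>w i\<close> says quantitatively that
  the normals are not all small. In this form the bound survives the passage from the separable
  subspace to the whole space.\<close>

lemma fuzzy_extremal_principle: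
  fixes \<Omega> :: "'n::finite \<Rightarrow> 'a::banach set"
  assumes aspl: "asplund TYPE('a)" and cl: "\<And>i. closed (\<Omega> i)" and xbar: "\<And>i. xbar \<in> \<Omega> i"
    and \<rho>: "0 < \<rho>"
    and ext: "\<And>\<eta>. 0 < \<eta> \<Longrightarrow> \<exists>a. (\<forall>i. norm (a i) < \<eta>) \<and> (\<Inter>i. (\<lambda>w. w - a i) ` \<Omega> i) \<inter> ball xbar \<rho> = {}"
    and \<epsilon>: "0 < \<epsilon>"
  obtains x w xs where "\<And>i. x i \<in> \<Omega> i \<inter> ball xbar \<epsilon>" "\<And>i. xs i \<in> frechet_normal (\<Omega> i) (x i)"
    "\<And>s. \<bar>\<Sum>i\<in>UNIV. xs i s\<bar> \<le> \<epsilon> * norm s" "\<And>i. norm (w i) \<le> 3" "1/4 \<le> (\<Sum>i\<in>UNIV. xs i (w i))"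
proof -
  define n where "n = real CARD('n)"
  have n: "1 \<le> n" by (simp add: n_def Suc_le_eq)
  \<comment> \<open>\<open>4 * \<mu>\<close> will bound the derivative of the perturbation in each
    component. Summed over \<open>n\<close> components it has to stay at most
    \<open>\<epsilon>\<close>, and against test vectors of norm 2 at most
    \<open>1/2\<close>.\<close>
  define \<mu> where "\<mu> = min \<epsilon> 1 / (16 * n)"
  have \<mu>: "0 < \<mu>" "n * (4 * \<mu>) \<le> \<epsilon>" "16 * n * \<mu> \<le> 1" using \<epsilon> n by (auto simp: \<mu>_def field_simps min_def)
  have \<mu>1: "4 * \<mu> \<le> 1"
  proof -
    have "16 * 1 * \<mu> \<le> 16 * n * \<mu>" using n \<mu>(1) by (intro mult_right_mono) auto
    with \<mu>(1,3) show ?thesis by linarith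
  qed
  define \<rho>1 where "\<rho>1 = min \<epsilon> \<rho> / 4"
  have \<rho>1: "0 < \<rho>1" "\<rho>1 < \<epsilon>" "\<rho>1 \<le> \<rho> / 4" using \<epsilon> \<rho> by (auto simp: \<rho>1_def)
  \<comment> \<open>Will bound \<open>N (x $ i - ys k $ i)\<close>: by 1 for
    \<open>series_superdifferentiable\<close>, and by \<open>\<rho>1 / 4\<close> to keep
    \<open>x\<close> well inside the localising ball. With \<open>\<eta>\<close> below,
    \<open>\<mu> * g x (ys k) \<le> \<eta>\<close> becomes the bound \<open>\<sigma>\<^sup>2\<close>
    for the gauge.\<close>
  define \<sigma> where "\<sigma> = min 1 (\<rho>1 / 4)"
  have \<sigma>: "0 < \<sigma>" "\<sigma> \<le> 1" "\<sigma> \<le> \<rho>1 / 4" using \<rho>1 by (auto simp: \<sigma>_def)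
  define \<eta> where "\<eta> = \<mu> * \<sigma>\<^sup>2"
  have \<eta>: "0 < \<eta>" using \<mu> \<sigma> by (simp add: \<eta>_def)
  \<comment> \<open>Small enough that the starting value \<open>f x0\<close>, at most
    \<open>2 * n * \<alpha>\<close>, is within \<open>\<eta>\<close> of the infimum, and that a
    common point of the shifted sets would fall into \<open>ball xbar \<rho>\<close>.\<close>
  define \<alpha> where "\<alpha> = min (\<eta> / (2 * n)) (\<rho> / 2)"
  have \<alpha>: "0 < \<alpha>" "2 * n * \<alpha> \<le> \<eta>" "\<alpha> \<le> \<rho> / 2"
    using \<eta> n \<rho> by (auto simp: \<alpha>_def min_def field_simps)
  obtain a where a: "\<And>i. norm (a i) < \<alpha>" "(\<Inter>i. (\<lambda>w. w - a i) ` \<Omega> i) \<inter> ball xbar \<rho> = {}"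
    using ext[OF \<alpha>(1)] by blast
  \<comment> \<open>Fixed before \<open>D\<close>, whose choice depends on it. It dominates the
    norms of the \<open>\<xi> i\<close> below: \<open>n\<close> summands of norm at most 1 and a
    perturbation of norm at most 1.\<close>
  define r where "r = n + 2"
  define D0 where "D0 = insert xbar (range a)"
  have "countable D0" "D0 \<noteq> {}" by (auto simp: D0_def countable_finite)
  then obtain D where D: "countable D" "D0 \<subseteq> D" "subspace (closure D)"
    and rich: "witness_closed \<Omega> r \<epsilon> D"
    using rich_separable_subspace[of D0 \<Omega> r \<epsilon>] by blast
  define Y where "Y = closure D"
  have Y: "subspace Y" "closed Y" "D \<subseteq> Y" using D(3) closure_subset by (auto simp: Y_def)
  have aY: "a i \<in> Y" and xbarY: "xbar \<in> Y" for i using D(2) Y(3) by (auto simp: D0_def)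
  obtain Z where Z: "countable Z" "Z \<subseteq> dual_ball"
    "\<And>f e. f \<in> dual_ball \<Longrightarrow> 0 < e \<Longrightarrow> \<exists>z\<in>Z. \<forall>y\<in>Y. \<bar>f y - z y\<bar> \<le> e * norm y"
    using separable_dual[OF aspl D(1), of Y] by (auto simp: Y_def)
  obtain N :: "'a \<Rightarrow> real" where N: "\<And>x. norm x / 2 \<le> N x" "\<And>x. N x \<le> norm x"
    "\<And>x y. \<bar>N x - N y\<bar> \<le> norm (x - y)"
    "\<And>y. y \<in> Y \<Longrightarrow> y \<noteq> 0 \<Longrightarrow> \<exists>u\<in>dual_ball. u y = N y \<and>
       (\<forall>e>0. \<exists>\<delta>>0. \<forall>h\<in>Y. norm h < \<delta> \<longrightarrow> N (y + h) \<le> N y + u h + e * norm h)"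
    using smooth_renorming[OF Y(1) Z] by blast
  have N0: "0 \<le> N x" for x using N(1)[of x] norm_ge_zero[of x] by linarith
  have Nz: "N 0 = 0" using N(2)[of 0] N0[of 0] by simp
  have N_cont: "continuous_on S N" for S
    by (rule lipschitz_on_continuous_on[of 1]) (auto intro!: lipschitz_onI simp: dist_norm N(3))
  obtain i0 :: 'n where True by blast
  \<comment> \<open>Differences to an arbitrary reference index: for \<open>x i\<close> in
    \<open>\<Omega> i\<close>, \<open>V x\<close> vanishes exactly when the \<open>x i - a i\<close>
    are one common point of the shifted sets.\<close>
  define V where "V x i = x i - a i - (x i0 - a i0)" for x :: "'n \<Rightarrow> 'a" and i
  define Q where "Q x = (\<Sum>i\<in>UNIV. (N (V x i))\<^sup>2)" for x
  define C where "C = {x :: 'a ^ 'n. \<forall>i. x $ i \<in> \<Omega> i \<inter> Y \<inter> cball xbar \<rho>1}"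
  define f where "f x = sqrt (Q (($) x))" for x :: "'a ^ 'n"
  define g where "g u y = (\<Sum>i\<in>UNIV. (N (u $ i - y $ i))\<^sup>2)" for u y :: "'a ^ 'n"
  define x0 :: "'a ^ 'n" where "x0 = (\<chi> i. xbar)"
  have Q0: "0 \<le> Q x" for x by (simp add: Q_def sum_nonneg)
  have C0: "0 < (1/4 :: real)" by simp
  have C1: "closed C"
    unfolding C_def
  proof (intro closed_Collect_all)
    fix i
    have "closed ((\<lambda>x :: 'a ^ 'n. x $ i) -` (\<Omega> i \<inter> Y \<inter> cball xbar \<rho>1))"
      using cl Y(2) by (intro continuous_closed_vimage closed_Int) (auto intro: continuous_intros)
    then show "closed {x :: 'a ^ 'n. x $ i \<in> \<Omega> i \<inter> Y \<inter> cball xbar \<rho>1}" by (simp add: vimage_def)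
  qed
  have C2: "x0 \<in> C" using xbar xbarY \<rho>1(1) by (simp add: C_def x0_def)
  have C3: "continuous_on C f"
    unfolding f_def Q_def V_def
    by (intro continuous_intros continuous_on_compose2[OF N_cont[of UNIV]]) auto
  have C4: "0 \<le> f u" for u by (simp add: f_def Q0)
  have C5: "f x0 \<le> \<eta>"
  proof -
    have "f x0 = L2_set (\<lambda>i. N (a i0 - a i)) UNIV"
      by (simp add: f_def Q_def L2_set_def V_def x0_def)
    also have "\<dots> \<le> (\<Sum>i\<in>UNIV. N (a i0 - a i))" by (intro L2_set_le_sum N0)
    also have "\<dots> \<le> (\<Sum>i\<in>(UNIV :: 'n set). 2 * \<alpha>)"
    proof (rule sum_mono)
      fix i
      have "N (a i0 - a i) \<le> norm (a i0) + norm (a i)"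
        using N(2)[of "a i0 - a i"] norm_triangle_ineq4[of "a i0" "a i"] by linarith
      then show "N (a i0 - a i) \<le> 2 * \<alpha>" using a(1)[of i] a(1)[of i0] by linarith
    qed
    also have "\<dots> \<le> \<eta>" using \<alpha>(2) by (simp add: n_def mult_ac)
    finally show ?thesis .
  qed
  have C6: "continuous_on C (\<lambda>u. g u y)" for y
    unfolding g_def by (intro continuous_intros continuous_on_compose2[OF N_cont[of UNIV]]) auto
  have C7: "g u u = 0" for u by (simp add: g_def Nz)
  have C8: "1/4 * (dist u y)\<^sup>2 \<le> g u y" for u y
  proof -
    have "(dist u y)\<^sup>2 = (\<Sum>i\<in>UNIV. (norm (u $ i - y $ i))\<^sup>2)"
      by (simp add: dist_norm norm_vec_def L2_set_def sum_nonneg)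
    then have "1/4 * (dist u y)\<^sup>2 = (\<Sum>i\<in>UNIV. (norm (u $ i - y $ i) / 2)\<^sup>2)"
      by (simp add: sum_divide_distrib power_divide)
    also have "\<dots> \<le> g u y" unfolding g_def by (intro sum_mono power_mono N(1)) simp
    finally show ?thesis .
  qed
  have C9: "g u y \<le> n * (2 * \<rho>1)\<^sup>2" if "u \<in> C" "y \<in> C" for u y
  proof -
    have "(N (u $ i - y $ i))\<^sup>2 \<le> (2 * \<rho>1)\<^sup>2" for i
    proof (rule power_mono[OF _ N0])
      have "dist (u $ i) (y $ i) \<le> dist xbar (u $ i) + dist xbar (y $ i)" by (rule dist_triangle3)
      also have "\<dots> \<le> \<rho>1 + \<rho>1"
        using that by (intro add_mono) (auto simp: C_def)
      finally show "N (u $ i - y $ i) \<le> 2 * \<rho>1"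
        using N(2)[of "u $ i - y $ i"] by (simp add: dist_norm)
    qed
    then have "g u y \<le> (\<Sum>i\<in>(UNIV :: 'n set). (2 * \<rho>1)\<^sup>2)" unfolding g_def by (rule sum_mono)
    then show ?thesis by (simp add: n_def)
  qed
  obtain x ys where x: "x \<in> C" "\<And>k. ys k \<in> C" "ys 0 = x0" "\<And>k. \<mu> * g x (ys k) \<le> \<eta>"
    and summ: "\<And>u. u \<in> C \<Longrightarrow> summable (\<lambda>k. \<mu> * (1/2)^k * g u (ys k))"
    and min: "\<And>u. u \<in> C \<Longrightarrow> f x + (\<Sum>k. \<mu> * (1/2)^k * g x (ys k)) \<le> f u + (\<Sum>k. \<mu> * (1/2)^k * g u (ys k))"
  proof (rule smooth_variational_principle[where \<kappa> = "1/4", OF C1 C2 C3 C4 C5 \<eta> \<mu>(1) C0 C6 C7 C8 C9])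
    fix z zs
    assume z: "z \<in> C" "\<And>k. zs k \<in> C" "zs 0 = x0" "\<And>k. \<mu> * g z (zs k) \<le> \<eta>"
      "\<And>u. u \<in> C \<Longrightarrow> summable (\<lambda>k. \<mu> * (1/2)^k * g u (zs k))"
      "\<And>u. u \<in> C \<Longrightarrow> f z + (\<Sum>k. \<mu> * (1/2)^k * g z (zs k)) \<le> f u + (\<Sum>k. \<mu> * (1/2)^k * g u (zs k))"
    show ?thesis by (rule that[of z zs, OF z])
  qed
  have xi: "x $ i \<in> \<Omega> i" "x $ i \<in> Y" for i using x(1) by (auto simp: C_def)
  have ysY: "ys k $ i \<in> Y" for k i using x(2)[of k] by (auto simp: C_def)
  have g_small: "N (x $ i - ys k $ i) \<le> \<sigma>" for i k
  proof -
    have "(N (x $ i - ys k $ i))\<^sup>2 \<le> g x (ys k)" unfolding g_def by (rule member_le_sum) auto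
    also have "\<dots> \<le> \<sigma>\<^sup>2" using x(4)[of k] \<mu>(1) by (simp add: \<eta>_def)
    finally show ?thesis by (rule power2_le_imp_le) (use \<sigma>(1) in simp)
  qed
  \<comment> \<open>The start \<open>ys 0 = x0\<close> keeps \<open>x\<close> in the interior of the
    localising ball, so small moves in \<open>\<Omega> i\<close> and \<open>Y\<close> stay in
    \<open>C\<close> and the ball contributes nothing to the normals.\<close>
  have x_near: "norm (x $ i - xbar) \<le> \<rho>1 / 2" for i
    using g_small[of i 0] N(1)[of "x $ i - xbar"] \<sigma>(3) by (simp add: x(3) x0_def)
  define v where "v = V (($) x)"
  have vi0: "v i0 = 0" by (simp add: v_def V_def)
  have vY: "v i \<in> Y" for i
    unfolding v_def V_def by (intro subspace_diff[OF Y(1)] xi aY)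
  have "Q (($) x) \<noteq> 0"
  proof
    assume "Q (($) x) = 0"
    then have "N (v i) = 0" for i by (simp add: Q_def v_def sum_nonneg_eq_0_iff)
    then have "norm (v i) \<le> 0" for i using N(1)[of "v i"] by simp
    then have "v i = 0" for i by simp
    then have "x $ i - a i = x $ i0 - a i0" for i by (simp add: v_def V_def)
    from this[symmetric] have "x $ i0 - a i0 \<in> (\<lambda>w. w - a i) ` \<Omega> i" for i using xi(1) by (rule image_eqI)
    moreover have "norm (x $ i0 - a i0 - xbar) < \<rho>"
    proof -
      have "norm (x $ i0 - a i0 - xbar) \<le> norm (x $ i0 - xbar) + norm (a i0)"
        using norm_triangle_ineq4[of "x $ i0 - xbar" "a i0"] by (simp add: algebra_simps)
      also have "\<dots> < \<rho>" using x_near[of i0] a(1)[of i0] \<alpha>(3) \<rho>1 \<rho> by linarith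
      finally show ?thesis .
    qed
    ultimately have "x $ i0 - a i0 \<in> (\<Inter>i. (\<lambda>w. w - a i) ` \<Omega> i) \<inter> ball xbar \<rho>"
      by (intro IntI INT_I) (simp_all only: mem_ball dist_norm norm_minus_commute)
    with a(2) show False by blast
  qed
  define R where "R = sqrt (Q (($) x))"
  have R: "0 < R" "Q (($) x) = R\<^sup>2" using Q0[of "($) x"] \<open>Q (($) x) \<noteq> 0\<close> by (auto simp: R_def)
  have NvR: "N (v i) \<le> R" for i
  proof -
    have "(N (v i))\<^sup>2 \<le> Q (($) x)" unfolding Q_def v_def by (rule member_le_sum) auto
    then show ?thesis unfolding R_def by (rule real_le_rsqrt)
  qed
  have "\<exists>s. linear s \<and> (\<forall>h. \<bar>s h\<bar> \<le> 2 * N (v j) * norm h) \<and> s (v j) = 2 * (N (v j))\<^sup>2 \<and>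
    (\<forall>e>0. \<exists>\<delta>>0. \<forall>h\<in>Y. norm h < \<delta> \<longrightarrow> (N (v j + h))\<^sup>2 \<le> (N (v j))\<^sup>2 + s h + e * norm h)" for j
    by (rule square_superdifferentiable[OF Y(1) N vY[of j]]) blast+
  then obtain s where s: "\<And>j. linear (s j)" "\<And>j h. \<bar>s j h\<bar> \<le> 2 * N (v j) * norm h"
    "\<And>j. s j (v j) = 2 * (N (v j))\<^sup>2"
    "\<And>j e. 0 < e \<Longrightarrow> \<exists>\<delta>>0. \<forall>h\<in>Y. norm h < \<delta> \<longrightarrow> (N (v j + h))\<^sup>2 \<le> (N (v j))\<^sup>2 + s j h + e * norm h"
    by metis
  define p where "p i k = x $ i - ys k $ i" for i k
  have pY: "p i k \<in> Y" and p1: "N (p i k) \<le> 1" for i k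
    using subspace_diff[OF Y(1) xi(2) ysY] g_small[of i k] \<sigma>(2) by (auto simp: p_def)
  define T where "T i h k = \<mu> * (1/2)^k * ((N (p i k + h))\<^sup>2 - (N (p i k))\<^sup>2)" for i h k
  define G where "G i h \<longleftrightarrow> summable (T i h)" for i h
  define \<Sigma> where "\<Sigma> i h = suminf (T i h)" for i h
  have "\<exists>t. linear t \<and> (\<forall>h. \<bar>t h\<bar> \<le> 4 * \<mu> * norm h) \<and>
    (\<forall>e>0. \<exists>\<delta>>0. \<forall>h\<in>Y. norm h < \<delta> \<longrightarrow> G i h \<longrightarrow> \<Sigma> i h \<le> t h + e * norm h)" for i
    unfolding G_def \<Sigma>_def T_def
    by (rule series_superdifferentiable[where p = "p i", OF Y(1) N pY p1 \<mu>(1)]) blast+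
  then obtain t where t: "\<And>i. linear (t i)" "\<And>i h. \<bar>t i h\<bar> \<le> 4 * \<mu> * norm h"
    "\<And>i e. 0 < e \<Longrightarrow> \<exists>\<delta>>0. \<forall>h\<in>Y. norm h < \<delta> \<longrightarrow> G i h \<longrightarrow> \<Sigma> i h \<le> t i h + e * norm h"
    by metis
  text \<open>\<open>\<theta> i j\<close> is the coefficient with which the \<open>i\<close>-th component of \<open>x\<close> enters \<open>V x j\<close>.\<close>
  define \<theta> :: "'n \<Rightarrow> 'n \<Rightarrow> real" where "\<theta> i j = (if j = i then 1 else 0) - (if i = i0 then 1 else 0)" for i j
  have \<theta>1: "\<bar>\<theta> i j\<bar> \<le> 1" for i j by (simp add: \<theta>_def)
  have \<theta>_sum: "(\<Sum>i\<in>UNIV. \<theta> i j) = 0" for j by (simp add: \<theta>_def sum_subtractf)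
  define \<omega> where "\<omega> j h = s j h / (2 * R)" for j h
  have \<omega>: "\<bar>\<omega> j h\<bar> \<le> norm h" "linear (\<omega> j)" for j h
  proof -
    have "2 * N (v j) * norm h \<le> 2 * R * norm h" using NvR[of j] by (intro mult_right_mono) auto
    then have "\<bar>s j h\<bar> \<le> 2 * R * norm h" using s(2)[of j h] by linarith
    then show "\<bar>\<omega> j h\<bar> \<le> norm h" using R(1) by (simp add: \<omega>_def field_simps)
    show "linear (\<omega> j)" using s(1)[of j] by (auto simp: \<omega>_def linear_iff add_divide_distrib)
  qed
  \<comment> \<open>Minus the derivative of the perturbed objective in the component
    \<open>i\<close>. For each \<open>j\<close> the coefficients \<open>\<theta> i j\<close> sum to
    0 over \<open>i\<close>, so only the perturbation terms survive in the sum of the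
    \<open>\<xi> i\<close>.\<close>
  define \<xi> where "\<xi> i h = - (\<Sum>j\<in>UNIV. \<theta> i j * \<omega> j h) - t i h" for i h
  have \<xi>_lin: "linear (\<xi> i)" for i
    using \<omega>(2) t(1) unfolding linear_iff
    by (auto simp: \<xi>_def algebra_simps sum.distrib sum_distrib_left)
  have \<xi>_bound: "\<bar>\<xi> i h\<bar> \<le> r * norm h" for i h
  proof -
    have "\<bar>\<Sum>j\<in>UNIV. \<theta> i j * \<omega> j h\<bar> \<le> (\<Sum>j\<in>UNIV. \<bar>\<theta> i j * \<omega> j h\<bar>)" by (rule sum_abs)
    also have "\<dots> \<le> (\<Sum>j\<in>(UNIV :: 'n set). norm h)"
    proof (rule sum_mono)
      fix j
      have "\<bar>\<theta> i j\<bar> * \<bar>\<omega> j h\<bar> \<le> 1 * norm h" by (intro mult_mono \<theta>1 \<omega>(1)) auto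
      then show "\<bar>\<theta> i j * \<omega> j h\<bar> \<le> norm h" by (simp add: abs_mult)
    qed
    also have "\<dots> = n * norm h" by (simp add: n_def)
    finally have "\<bar>\<Sum>j\<in>UNIV. \<theta> i j * \<omega> j h\<bar> \<le> n * norm h" .
    moreover have "4 * \<mu> * norm h \<le> 1 * norm h" using \<mu>1 by (intro mult_right_mono) auto
    ultimately have "\<bar>\<xi> i h\<bar> \<le> n * norm h + 1 * norm h"
      using t(2)[of i h] unfolding \<xi>_def by linarith
    also have "\<dots> \<le> r * norm h" by (simp add: r_def distrib_right)
    finally show ?thesis .
  qed
  have t_sum: "\<bar>\<Sum>i\<in>UNIV. t i (h i)\<bar> \<le> n * (4 * \<mu> * c)" if "\<And>i. norm (h i) \<le> c" for h c
  proof -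
    have "\<bar>\<Sum>i\<in>UNIV. t i (h i)\<bar> \<le> (\<Sum>i\<in>UNIV. \<bar>t i (h i)\<bar>)" by (rule sum_abs)
    also have "\<dots> \<le> (\<Sum>i\<in>(UNIV :: 'n set). 4 * \<mu> * c)"
      using t(2) that \<mu>(1) by (intro sum_mono order_trans[OF t(2)] mult_left_mono) auto
    finally show ?thesis by (simp add: n_def)
  qed
  have \<xi>_sum: "\<bar>\<Sum>i\<in>UNIV. \<xi> i h\<bar> \<le> \<epsilon> * norm h" for h
  proof -
    have "(\<Sum>i\<in>UNIV. \<Sum>j\<in>UNIV. \<theta> i j * \<omega> j h) = (\<Sum>j\<in>UNIV. (\<Sum>i\<in>UNIV. \<theta> i j) * \<omega> j h)"
      by (subst sum.swap) (simp add: sum_distrib_right)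
    also have "\<dots> = 0" by (simp add: \<theta>_sum)
    finally have "(\<Sum>i\<in>UNIV. \<xi> i h) = - (\<Sum>i\<in>UNIV. t i h)"
      by (simp add: \<xi>_def sum_subtractf sum_negf)
    then have "\<bar>\<Sum>i\<in>UNIV. \<xi> i h\<bar> \<le> n * (4 * \<mu>) * norm h" using t_sum[of "\<lambda>_. h" "norm h"] by (simp add: mult_ac)
    also have "\<dots> \<le> \<epsilon> * norm h" using \<mu>(2) by (rule mult_right_mono) simp
    finally show ?thesis .
  qed
  \<comment> \<open>By Euler's identity the values \<open>\<omega> j (v j)\<close> sum to
    \<open>R\<close>, and the reference index drops out because \<open>v i0 = 0\<close>. The pairing
    with \<open>W\<close> is therefore 1 up to the perturbation.\<close>
  define W where "W i = (- 1 / R) *\<^sub>R v i" for i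
  have WY: "W i \<in> Y" for i unfolding W_def by (intro subspace_scale[OF Y(1)] vY)
  have W2: "norm (W i) \<le> 2" for i
    using N(1)[of "v i"] NvR[of i] R(1) by (simp add: W_def field_simps)
  have W_low: "1/2 \<le> (\<Sum>i\<in>UNIV. \<xi> i (W i))"
  proof -
    have \<omega>v: "(\<Sum>j\<in>UNIV. \<omega> j (v j)) = R"
    proof -
      have "(\<Sum>j\<in>UNIV. \<omega> j (v j)) = (\<Sum>j\<in>UNIV. (N (v j))\<^sup>2) / R"
        by (simp add: \<omega>_def s(3) sum_divide_distrib)
      also have "(\<Sum>j\<in>UNIV. (N (v j))\<^sup>2) = R\<^sup>2" using R(2) by (simp add: Q_def v_def)
      finally show ?thesis using R(1) by (simp add: power2_eq_square)
    qed
    have "(\<Sum>i\<in>UNIV. \<Sum>j\<in>UNIV. \<theta> i j * \<omega> j (v i))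
        = (\<Sum>j\<in>UNIV. \<Sum>i\<in>UNIV. (if j = i then \<omega> j (v i) else 0) - (if i = i0 then \<omega> j (v i) else 0))"
      by (subst sum.swap) (auto simp: \<theta>_def intro!: sum.cong)
    also have "\<dots> = R" by (simp add: sum_subtractf \<omega>v vi0 linear_0[OF \<omega>(2)])
    finally have main: "(\<Sum>i\<in>UNIV. \<Sum>j\<in>UNIV. \<theta> i j * \<omega> j (v i)) = R" .
    have "\<theta> i j * \<omega> j (W i) = (- 1 / R) * (\<theta> i j * \<omega> j (v i))" for i j
      unfolding W_def linear_cmul[OF \<omega>(2)] real_scaleR_def by (rule mult.left_commute)
    then have "(\<Sum>i\<in>UNIV. \<Sum>j\<in>UNIV. \<theta> i j * \<omega> j (W i)) = (- 1 / R) * R"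
      unfolding main[symmetric] by (simp only: sum_distrib_left)
    then have "(\<Sum>i\<in>UNIV. \<xi> i (W i)) = 1 - (\<Sum>i\<in>UNIV. t i (W i))"
      using R(1) by (simp add: \<xi>_def sum_subtractf sum_negf)
    moreover have "\<bar>\<Sum>i\<in>UNIV. t i (W i)\<bar> \<le> 1/2" using t_sum[of W 2] W2 \<mu>(3) by (simp add: mult_ac)
    ultimately show ?thesis by linarith
  qed
  \<comment> \<open>\<open>separable_reduction\<close> asks for test vectors in \<open>D\<close>
    itself. The exchange costs at most \<open>r * (1 / (4 * n * r))\<close> per component,
    \<open>1/4\<close> in all.\<close>
  have "\<exists>w\<in>D. dist w (W i) < 1 / (4 * n * r)" for i
    using WY[of i] n by (auto simp: Y_def closure_approachable r_def)
  then obtain w where w: "\<And>i. w i \<in> D" "\<And>i. dist (w i) (W i) < 1 / (4 * n * r)" by metis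
  have w3: "norm (w i) \<le> 3" for i
  proof -
    have "1 * 1 \<le> n * r" using n by (intro mult_mono) (auto simp: r_def)
    then have "1 / (4 * n * r) \<le> 1" by (simp add: divide_le_eq mult.assoc)
    then have "norm (w i - W i) \<le> 1" using w(2)[of i] by (simp add: dist_norm)
    then show ?thesis using W2[of i] norm_triangle_ineq[of "w i - W i" "W i"] by simp
  qed
  have w_low: "1/4 \<le> (\<Sum>i\<in>UNIV. \<xi> i (w i))"
  proof -
    have "\<xi> i (W i) - \<xi> i (w i) \<le> 1 / (4 * n)" for i
    proof -
      have "\<xi> i (W i) - \<xi> i (w i) \<le> r * norm (W i - w i)"
        using \<xi>_bound[of i "W i - w i"] by (simp add: linear_diff[OF \<xi>_lin] abs_le_iff)
      also have "\<dots> \<le> r * (1 / (4 * n * r))"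
        using w(2)[of i] n by (intro mult_left_mono) (auto simp: dist_norm norm_minus_commute r_def)
      also have "\<dots> = 1 / (4 * n)" using n by (simp add: r_def)
      finally show ?thesis .
    qed
    then have "(\<Sum>i\<in>UNIV. \<xi> i (W i) - \<xi> i (w i)) \<le> (\<Sum>i\<in>(UNIV :: 'n set). 1 / (4 * n))" by (rule sum_mono)
    also have "\<dots> = 1/4" using n by (simp add: n_def)
    finally show ?thesis using W_low by (simp add: sum_subtractf)
  qed
  have normal: "\<exists>\<delta>>0. \<forall>u\<in>\<Omega> i \<inter> closure D. norm (u - x $ i) < \<delta> \<longrightarrow> \<xi> i (u - x $ i) \<le> e * norm (u - x $ i)"
    if e: "0 < e" for i e
  proof -
    \<comment> \<open>The \<open>n\<close> components add up to \<open>e * R\<close> for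
      \<open>Q\<close>, which the factor \<open>1 / (2 * R)\<close> of the square root turns into
      \<open>e / 2\<close>; the perturbation takes the other half.\<close>
    have e': "0 < e * R / n" using e R(1) n by simp
    obtain d where d: "\<And>j. 0 < d j"
      "\<And>j h. h \<in> Y \<Longrightarrow> norm h < d j \<Longrightarrow> (N (v j + h))\<^sup>2 \<le> (N (v j))\<^sup>2 + s j h + e * R / n * norm h"
      using s(4)[OF e'] by metis
    have "0 < e / 2" using e by simp
    then obtain \<delta>t where \<delta>t: "0 < \<delta>t"
      "\<And>h. h \<in> Y \<Longrightarrow> norm h < \<delta>t \<Longrightarrow> G i h \<Longrightarrow> \<Sigma> i h \<le> t i h + e / 2 * norm h"
      using t(3) by blast
    define \<delta> where "\<delta> = min (min \<delta>t (\<rho>1 / 2)) (Min (range d))"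
    have "Min (range d) \<le> d j" for j by simp
    have \<delta>: "0 < \<delta>" "\<delta> \<le> \<delta>t" "\<delta> \<le> \<rho>1 / 2" "\<And>j. \<delta> \<le> d j"
      using \<open>\<And>j. Min (range d) \<le> d j\<close> \<delta>t(1) \<rho>1(1) d(1) by (auto simp: \<delta>_def min_le_iff_disj)
    have "\<xi> i h \<le> e * norm h" if h: "x $ i + h \<in> \<Omega> i" "h \<in> Y" "norm h < \<delta>" for h
    proof -
      define u :: "'a ^ 'n" where "u = (\<chi> j. if j = i then x $ i + h else x $ j)"
      have u_other: "u $ j = x $ j" if "j \<noteq> i" for j using that by (simp add: u_def)
      have ui: "u $ i = x $ i + h" by (simp add: u_def)
      have "x $ i + h \<in> cball xbar \<rho>1"
      proof -
        have "norm (x $ i + h - xbar) \<le> norm (x $ i - xbar) + norm h"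
          using norm_triangle_ineq[of "x $ i - xbar" h] by (simp add: algebra_simps)
        also have "\<dots> \<le> \<rho>1" using x_near[of i] h(3) \<delta>(3) by linarith
        finally show ?thesis by (simp add: dist_norm norm_minus_commute)
      qed
      then have uC: "u \<in> C"
        using x(1) h xi(2)[of i] Y(1) by (auto simp: C_def u_def subspace_add)
      have Vu: "V (($) u) j = v j + \<theta> i j *\<^sub>R h" for j
        by (auto simp: V_def v_def \<theta>_def u_def algebra_simps)
      have "(N (v j + \<theta> i j *\<^sub>R h))\<^sup>2 \<le> (N (v j))\<^sup>2 + \<theta> i j * s j h + e * R / n * norm h" for j
      proof -
        have \<theta>h: "norm (\<theta> i j *\<^sub>R h) \<le> norm h"
          using mult_right_mono[OF \<theta>1[of i j], of "norm h"] by simp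
        have "(N (v j + \<theta> i j *\<^sub>R h))\<^sup>2 \<le> (N (v j))\<^sup>2 + s j (\<theta> i j *\<^sub>R h) + e * R / n * norm (\<theta> i j *\<^sub>R h)"
          using \<theta>h h(3) \<delta>(4)[of j] by (intro d(2) subspace_scale[OF Y(1) h(2)]) linarith
        also have "e * R / n * norm (\<theta> i j *\<^sub>R h) \<le> e * R / n * norm h"
          using \<theta>h e' by (intro mult_left_mono) auto
        finally show ?thesis by (simp add: linear_cmul[OF s(1)])
      qed
      then have "Q (($) u) \<le> (\<Sum>j\<in>UNIV. (N (v j))\<^sup>2 + \<theta> i j * s j h + e * R / n * norm h)"
        unfolding Q_def Vu by (rule sum_mono)
      also have "\<dots> = Q (($) x) + (\<Sum>j\<in>UNIV. \<theta> i j * s j h) + e * R * norm h"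
        using n by (simp add: sum.distrib Q_def v_def n_def)
      finally have Qu: "Q (($) u) - Q (($) x) \<le> (\<Sum>j\<in>UNIV. \<theta> i j * s j h) + e * R * norm h" by simp
      have "f u \<le> f x + (Q (($) u) - Q (($) x)) / (2 * R)"
        unfolding f_def R_def using Q0 R by (intro sqrt_le_tangent) auto
      also have "(Q (($) u) - Q (($) x)) / (2 * R) \<le> ((\<Sum>j\<in>UNIV. \<theta> i j * s j h) + e * R * norm h) / (2 * R)"
        using Qu R(1) by (intro divide_right_mono) auto
      also have "\<dots> = (\<Sum>j\<in>UNIV. \<theta> i j * \<omega> j h) + e / 2 * norm h"
        using R(1) by (simp add: \<omega>_def add_divide_distrib sum_divide_distrib)
      finally have fu: "f u - f x \<le> (\<Sum>j\<in>UNIV. \<theta> i j * \<omega> j h) + e / 2 * norm h" by simp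
      have gdiff: "g u y - g x y = (N (x $ i - y $ i + h))\<^sup>2 - (N (x $ i - y $ i))\<^sup>2" for y
      proof -
        have "(\<Sum>j\<in>UNIV-{i}. (N (u $ j - y $ j))\<^sup>2) = (\<Sum>j\<in>UNIV-{i}. (N (x $ j - y $ j))\<^sup>2)"
          by (intro sum.cong) (auto simp: u_other)
        then show ?thesis
          unfolding g_def by (simp add: sum.remove[of UNIV i] ui algebra_simps)
      qed
      have terms: "\<mu> * (1/2)^k * g u (ys k) - \<mu> * (1/2)^k * g x (ys k) = T i h k" for k
        unfolding T_def p_def gdiff[symmetric] by (simp only: right_diff_distrib)
      have sm: "G i h"
        using summable_diff[OF summ[OF uC] summ[OF x(1)]] unfolding terms G_def .
      have "(\<Sum>k. \<mu> * (1/2)^k * g u (ys k)) - (\<Sum>k. \<mu> * (1/2)^k * g x (ys k)) = \<Sigma> i h"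
        using suminf_diff[OF summ[OF uC] summ[OF x(1)]] unfolding terms \<Sigma>_def .
      also have "\<dots> \<le> t i h + e / 2 * norm h"
        using h \<delta>(2) by (intro \<delta>t(2) sm) auto
      finally show ?thesis using fu min[OF uC] unfolding \<xi>_def by linarith
    qed
    then have "\<xi> i (u - x $ i) \<le> e * norm (u - x $ i)"
      if "u \<in> \<Omega> i \<inter> closure D" "norm (u - x $ i) < \<delta>" for u
      using that subspace_diff[OF Y(1) _ xi(2)[of i], of u] by (simp add: Y_def)
    with \<delta>(1) show ?thesis by blast
  qed
  have r0: "0 \<le> r" "0 \<le> \<epsilon>" using n \<epsilon> by (auto simp: r_def)
  have xD: "($) x i \<in> closure D" for i using xi(2)[of i] by (simp add: Y_def)
  obtain xs where xs: "\<And>i. xs i \<in> frechet_normal (\<Omega> i) (x $ i)"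
    "\<And>s. \<bar>\<Sum>i\<in>UNIV. xs i s\<bar> \<le> \<epsilon> * norm s" "(\<Sum>i\<in>UNIV. \<xi> i (w i)) \<le> (\<Sum>i\<in>UNIV. xs i (w i))"
    using separable_reduction[where x = "($) x" and w = w and \<xi> = \<xi>, OF r0 rich xD w(1) \<xi>_lin \<xi>_bound \<xi>_sum normal] by blast
  show ?thesis
  proof (rule that[of "($) x" xs w])
    show "x $ i \<in> \<Omega> i \<inter> ball xbar \<epsilon>" for i
      using xi(1)[of i] x_near[of i] \<rho>1 by (simp add: dist_norm norm_minus_commute)
    show "1/4 \<le> (\<Sum>i\<in>UNIV. xs i (w i))" using w_low xs(3) by linarith
  qed (use xs w3 in auto)
qed

section \<open>Norms on the product space\<close>

lemma unit_vec_simplex: "unit_vec i \<in> simplex_n"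
  by (simp add: unit_vec_def simplex_n_def)

lemma simplex_n_le_1:
  assumes "t \<in> simplex_n"
  shows "t $ i \<le> 1"
proof -
  have "t $ i \<le> (\<Sum>j\<in>UNIV. t $ j)" using assms by (intro member_le_sum) (auto simp: simplex_n_def)
  then show ?thesis using assms by (simp add: simplex_n_def)
qed

lemma simplex_n_eq_unit_vec:
  assumes t: "t \<in> simplex_n" and i: "t $ i = 1"
  shows "t = unit_vec i"
proof -
  have "(\<Sum>j\<in>UNIV - {i}. t $ j) = 0"
    using t i by (simp add: simplex_n_def sum.remove[of UNIV i])
  then have "\<forall>j\<in>UNIV - {i}. t $ j = 0"
    using t by (subst (asm) sum_nonneg_eq_0_iff) (auto simp: simplex_n_def)
  with i show ?thesis by (auto simp: vec_eq_iff unit_vec_def)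
qed

text \<open>By (B2), deleting coordinates one at a time reduces to the vertices, where \<open>\<psi> = 1\<close>.\<close>
lemma Psi_class_pos:
  fixes \<psi> :: "(real^'n) \<Rightarrow> real"
  assumes \<psi>: "\<psi> \<in> Psi_class" and t: "t \<in> simplex_n"
  shows "0 < \<psi> t"
  using t
proof (induction "card {i. t $ i \<noteq> 0}" arbitrary: t rule: less_induct)
  case less
  show ?case
  proof (cases "\<exists>i. t $ i = 1")
    case True
    then obtain i where "t = unit_vec i" using simplex_n_eq_unit_vec[OF less.prems] by blast
    then show ?thesis using \<psi> by (simp add: Psi_class_def)
  next
    case False
    then have circ: "t \<in> simplex_n_circ"
      using less.prems simplex_n_le_1[OF less.prems] by (auto simp: simplex_n_circ_def order_less_le)
    have "\<exists>i. t $ i \<noteq> 0"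
    proof (rule ccontr)
      assume "\<not> ?thesis"
      then show False using less.prems by (simp add: simplex_n_def)
    qed
    then obtain i where i: "t $ i \<noteq> 0" by blast
    have ti: "0 < 1 - t $ i" using circ by (simp add: simplex_n_circ_def)
    define t' where "t' = (\<chi> j. if j = i then 0 else t $ j / (1 - t $ i))"
    have "t' \<in> simplex_n"
    proof -
      have "0 \<le> t' $ j" for j using less.prems ti by (simp add: t'_def simplex_n_def)
      moreover have "(\<Sum>j\<in>UNIV. t' $ j) = 1"
      proof -
        have "(\<Sum>j\<in>UNIV. t' $ j) = (\<Sum>j\<in>UNIV - {i}. t $ j / (1 - t $ i))"
          by (simp add: sum.remove[of UNIV i] t'_def)
        also have "\<dots> = (\<Sum>j\<in>UNIV - {i}. t $ j) / (1 - t $ i)" by (simp add: sum_divide_distrib)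
        also have "(\<Sum>j\<in>UNIV - {i}. t $ j) = 1 - t $ i"
          using less.prems by (simp add: simplex_n_def sum.remove[of UNIV i])
        finally show ?thesis using ti by simp
      qed
      ultimately show ?thesis by (simp add: simplex_n_def)
    qed
    moreover have "card {j. t' $ j \<noteq> 0} < card {j. t $ j \<noteq> 0}"
    proof (rule psubset_card_mono)
      show "{j. t' $ j \<noteq> 0} \<subset> {j. t $ j \<noteq> 0}" using i by (auto simp: t'_def split: if_splits)
    qed simp
    ultimately have "0 < \<psi> t'" using less.hyps by blast
    then have "0 < (1 - t $ i) * \<psi> t'" using ti by simp
    also have "\<dots> \<le> \<psi> t" using \<psi> circ by (simp add: Psi_class_def t'_def)
    finally show ?thesis .
  qed
qed

lemma compact_simplex_n: "compact (simplex_n :: (real^'n) set)"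
proof -
  have "bounded (simplex_n :: (real^'n) set)"
  proof (rule boundedI)
    fix t :: "real^'n" assume t: "t \<in> simplex_n"
    have "norm t \<le> (\<Sum>i\<in>UNIV. \<bar>t $ i\<bar>)" by (rule norm_le_l1_cart)
    also have "\<dots> = 1" using t by (simp add: simplex_n_def)
    finally show "norm t \<le> 1" .
  qed
  moreover have "closed (simplex_n :: (real^'n) set)"
    unfolding simplex_n_def
    by (intro closed_Collect_conj closed_Collect_all closed_Collect_le closed_Collect_eq continuous_intros)
  ultimately show ?thesis by (simp add: compact_eq_bounded_closed)
qed

lemma Psi_class_lower_bound:
  fixes \<psi> :: "(real^'n) \<Rightarrow> real"
  assumes \<psi>: "\<psi> \<in> Psi_class"
  obtains m where "0 < m" "\<And>t. t \<in> simplex_n \<Longrightarrow> m \<le> \<psi> t"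
proof -
  have ne: "(simplex_n :: (real^'n) set) \<noteq> {}" using unit_vec_simplex by blast
  have "continuous_on simplex_n \<psi>" using \<psi> by (simp add: Psi_class_def)
  from continuous_attains_inf[OF compact_simplex_n ne this]
  obtain t0 where "t0 \<in> simplex_n" "\<And>t. t \<in> simplex_n \<Longrightarrow> \<psi> t0 \<le> \<psi> t" by blast
  with Psi_class_pos[OF \<psi>] show ?thesis by (intro that[of "\<psi> t0"]) auto
qed

text \<open>Makes shifts that are small for \<open>psi_norm \<psi>\<close> small in every component,
  which is the form of extremality used above.\<close>

lemma psi_norm_lower_bound:
  fixes \<psi> :: "(real^'n) \<Rightarrow> real" and x :: "'n \<Rightarrow> 'a::real_normed_vector"
  assumes m: "\<And>t. t \<in> simplex_n \<Longrightarrow> m \<le> \<psi> t" "0 < m"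
  shows "m * norm (x i) \<le> psi_norm \<psi> x"
proof (cases "\<forall>i. x i = 0")
  case True
  then show ?thesis by (simp add: psi_norm_def)
next
  case False
  define S where "S = (\<Sum>i\<in>UNIV. norm (x i))"
  have le: "norm (x j) \<le> S" for j unfolding S_def by (rule member_le_sum) auto
  obtain j where "x j \<noteq> 0" using False by blast
  with le[of j] have S: "0 < S" using zero_less_norm_iff[of "x j"] by linarith
  have "(\<chi> j. norm (x j) / S) \<in> simplex_n"
    using S by (simp add: simplex_n_def S_def flip: sum_divide_distrib)
  then have "S * m \<le> S * \<psi> (\<chi> j. norm (x j) / S)" using m(1) S by (intro mult_left_mono) auto
  also have "\<dots> = psi_norm \<psi> x" using False by (simp add: psi_norm_def S_def)
  also have "m * norm (x i) \<le> S * m" using le[of i] m(2) by (simp add: mult.commute mult_left_mono)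
  ultimately show ?thesis by linarith
qed

lemma cSUP_mult_left:
  fixes f :: "'b \<Rightarrow> real"
  assumes "A \<noteq> {}" "bdd_above (f ` A)" "0 < c"
  shows "(SUP t\<in>A. c * f t) = c * (SUP t\<in>A. f t)"
proof (rule antisym)
  have up: "c * f t \<le> c * (SUP t\<in>A. f t)" if "t \<in> A" for t
    using cSUP_upper[OF that assms(2)] assms(3) by simp
  then show "(SUP t\<in>A. c * f t) \<le> c * (SUP t\<in>A. f t)" using assms(1) by (intro cSUP_least)
  have "bdd_above ((\<lambda>t. c * f t) ` A)" using up by (rule bdd_aboveI2)
  then have "f t \<le> (SUP t\<in>A. c * f t) / c" if "t \<in> A" for t
    using cSUP_upper[OF that] assms(3) by (simp add: pos_le_divide_eq mult.commute)
  then have "(SUP t\<in>A. f t) \<le> (SUP t\<in>A. c * f t) / c" using assms(1) by (intro cSUP_least)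
  then show "c * (SUP t\<in>A. f t) \<le> (SUP t\<in>A. c * f t)" using assms(3) by (simp add: pos_le_divide_eq mult.commute)
qed

section \<open>The dual norm on tuples of functionals\<close>

context
  fixes \<psi> :: "(real^'n) \<Rightarrow> real" and xs :: "'n \<Rightarrow> 'a::real_normed_vector \<Rightarrow> real"
  assumes \<psi>: "\<psi> \<in> Psi_class" and bl: "\<And>i. bounded_linear (xs i)"
begin

lemma bdd_above_psi_dual_norm: "bdd_above ((\<lambda>t. (\<Sum>i\<in>UNIV. t $ i * onorm (xs i)) / \<psi> t) ` simplex_n)"
proof -
  obtain m where m: "0 < m" "\<And>t. t \<in> simplex_n \<Longrightarrow> m \<le> \<psi> t" using Psi_class_lower_bound[OF \<psi>] by blast
  have on0: "0 \<le> onorm (xs i)" for i by (rule onorm_pos_le[OF bl])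
  show ?thesis
  proof (rule bdd_aboveI2)
    fix t :: "real^'n" assume t: "t \<in> simplex_n"
    have "(\<Sum>i\<in>UNIV. t $ i * onorm (xs i)) \<le> (\<Sum>i\<in>UNIV. 1 * onorm (xs i))"
      using simplex_n_le_1[OF t] on0 by (intro sum_mono mult_right_mono) auto
    then have le: "(\<Sum>i\<in>UNIV. t $ i * onorm (xs i)) \<le> (\<Sum>i\<in>UNIV. onorm (xs i))" by simp
    show "(\<Sum>i\<in>UNIV. t $ i * onorm (xs i)) / \<psi> t \<le> (\<Sum>i\<in>UNIV. onorm (xs i)) / m"
      using le m(1) m(2)[OF t] on0 by (intro frac_le) (auto intro: sum_nonneg)
  qed
qed

lemma psi_dual_norm_scale:
  assumes c: "0 < c"
  shows "psi_dual_norm \<psi> (\<lambda>i v. c * xs i v) = c * psi_dual_norm \<psi> xs"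
proof -
  have on: "onorm (\<lambda>v. c * xs i v) = c * onorm (xs i)" for i
    using onorm_scaleR[OF bl[of i], of c] c by simp
  have "psi_dual_norm \<psi> (\<lambda>i v. c * xs i v) = (SUP t\<in>simplex_n. c * ((\<Sum>i\<in>UNIV. t $ i * onorm (xs i)) / \<psi> t))"
    unfolding psi_dual_norm_def
    by (intro SUP_cong refl) (simp add: on mult.left_commute flip: sum_distrib_left)
  also have "\<dots> = c * psi_dual_norm \<psi> xs"
    unfolding psi_dual_norm_def using unit_vec_simplex
    by (intro cSUP_mult_left bdd_above_psi_dual_norm c) blast
  finally show ?thesis .
qed

text \<open>Evaluation at a vertex of the simplex, where \<open>\<psi>\<close> is 1. It turns the
  lower bound for pairings into one for the dual norm.\<close>

lemma onorm_le_psi_dual_norm: "onorm (xs i) \<le> psi_dual_norm \<psi> xs"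
proof -
  have "(\<Sum>j\<in>UNIV. unit_vec i $ j * onorm (xs j)) = onorm (xs i)"
    by (simp add: unit_vec_def if_distrib[of "\<lambda>z. z * _"] cong: if_cong)
  moreover have "\<psi> (unit_vec i) = 1" using \<psi> by (simp add: Psi_class_def)
  ultimately have "onorm (xs i) = (\<Sum>j\<in>UNIV. unit_vec i $ j * onorm (xs j)) / \<psi> (unit_vec i)" by simp
  also have "\<dots> \<le> psi_dual_norm \<psi> xs"
    unfolding psi_dual_norm_def by (rule cSUP_upper[OF unit_vec_simplex bdd_above_psi_dual_norm])
  finally show ?thesis .
qed

end

lemma frechet_normal_scale:
  assumes x: "f \<in> frechet_normal A x" and c: "0 < c"
  shows "(\<lambda>v. c * f v) \<in> frechet_normal A x"
  unfolding frechet_normal_def mem_Collect_eq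
proof (intro conjI allI impI)
  show "bounded_linear (\<lambda>v. c * f v)"
    using x by (intro bounded_linear_const_mult) (simp add: frechet_normal_def)
  fix e :: real assume "0 < e"
  then have "0 < e / c" using c by simp
  then obtain \<delta> where "0 < \<delta>"
    "\<And>u. u \<in> A \<Longrightarrow> 0 < norm (u - x) \<Longrightarrow> norm (u - x) < \<delta> \<Longrightarrow> f (u - x) \<le> e / c * norm (u - x)"
    using x unfolding frechet_normal_def by blast
  then show "\<exists>\<delta>>0. \<forall>u\<in>A. 0 < norm (u - x) \<and> norm (u - x) < \<delta> \<longrightarrow> c * f (u - x) \<le> e * norm (u - x)"
    using c by (intro exI[of _ \<delta>]) (auto simp: field_simps)
qed

theorem theorem5p7:
  fixes \<psi> :: "(real^'n) \<Rightarrow> real"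
    and \<Omega> :: "'n \<Rightarrow> 'a::banach set"
    and xbar :: 'a
  assumes "CARD('n) \<ge> 2"
    and "\<psi> \<in> Psi_class"
    and "asplund TYPE('a)"
    and "\<And>i. closed (\<Omega> i)"
    and "\<And>i. xbar \<in> \<Omega> i"
    and "extremal_wrt (psi_norm \<psi>) \<Omega> xbar"
  shows "\<forall>\<epsilon>>0. \<exists>x::'n \<Rightarrow> 'a. \<exists>xs::'n \<Rightarrow> ('a \<Rightarrow> real).
           (\<forall>i. x i \<in> \<Omega> i \<inter> ball xbar \<epsilon> \<and> xs i \<in> frechet_normal (\<Omega> i) (x i)) \<and>
           onorm (\<lambda>v. \<Sum>i\<in>UNIV. xs i v) < \<epsilon> \<and>
           psi_dual_norm \<psi> xs = 1"
proof (intro allI impI)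
  fix \<epsilon> :: real assume \<epsilon>: "0 < \<epsilon>"
  define n where "n = real CARD('n)"
  have n: "1 \<le> n" by (simp add: n_def Suc_le_eq)
  \<comment> \<open>Normalising multiplies the normals by \<open>1 / d\<close>, and the pairing
    bound gives \<open>1 / d \<le> 12 * n\<close>; the norm of the sum thus becomes at most
    \<open>12 * n * \<epsilon>'\<close>, half of \<open>\<epsilon>\<close>.\<close>
  define \<epsilon>' where "\<epsilon>' = \<epsilon> / (24 * n)"
  have \<epsilon>': "0 < \<epsilon>'" "\<epsilon>' \<le> \<epsilon>" "\<epsilon>' * (12 * n) < \<epsilon>" using \<epsilon> n by (auto simp: \<epsilon>'_def divide_le_eq mult_le_cancel_left1)
  obtain m where m: "0 < m" "\<And>t. t \<in> simplex_n \<Longrightarrow> m \<le> \<psi> t"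
    using Psi_class_lower_bound[OF assms(2)] by blast
  obtain \<rho> where \<rho>: "0 < \<rho>" "\<And>\<epsilon>. 0 < \<epsilon> \<Longrightarrow> \<exists>a. psi_norm \<psi> a < \<epsilon> \<and>
      (\<Inter>i. (\<lambda>w. w - a i) ` \<Omega> i) \<inter> ball xbar \<rho> = {}"
    using assms(6) unfolding extremal_wrt_def by blast
  have ext: "\<exists>a. (\<forall>i. norm (a i) < \<eta>) \<and> (\<Inter>i. (\<lambda>w. w - a i) ` \<Omega> i) \<inter> ball xbar \<rho> = {}" if "0 < \<eta>" for \<eta>
  proof -
    obtain a where a: "psi_norm \<psi> a < m * \<eta>" "(\<Inter>i. (\<lambda>w. w - a i) ` \<Omega> i) \<inter> ball xbar \<rho> = {}"
      using \<rho>(2)[OF mult_pos_pos[OF m(1) \<open>0 < \<eta>\<close>]] by blast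
    have "m * norm (a i) < m * \<eta>" for i using psi_norm_lower_bound[of m \<psi> a i, OF m(2,1)] a(1) by linarith
    then have "norm (a i) < \<eta>" for i using m(1) by simp
    with a(2) show ?thesis by blast
  qed
  obtain x w xs where x: "\<And>i. x i \<in> \<Omega> i \<inter> ball xbar \<epsilon>'"
    and xs: "\<And>i. xs i \<in> frechet_normal (\<Omega> i) (x i)" "\<And>s. \<bar>\<Sum>i\<in>UNIV. xs i s\<bar> \<le> \<epsilon>' * norm s"
    and w: "\<And>i. norm (w i) \<le> 3" "1/4 \<le> (\<Sum>i\<in>UNIV. xs i (w i))"
  proof (rule fuzzy_extremal_principle[where \<Omega> = \<Omega> and xbar = xbar, OF assms(3) assms(4) assms(5) \<rho>(1) ext \<epsilon>'(1)])
    fix z w zs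
    assume z: "\<And>i. z i \<in> \<Omega> i \<inter> ball xbar \<epsilon>'" "\<And>i. zs i \<in> frechet_normal (\<Omega> i) (z i)"
      "\<And>s. \<bar>\<Sum>i\<in>UNIV. zs i s\<bar> \<le> \<epsilon>' * norm s"
      "\<And>i. norm (w i) \<le> 3" "1/4 \<le> (\<Sum>i\<in>UNIV. zs i (w i))"
    show ?thesis by (rule that[of z zs w, OF z])
  qed
  have bl: "bounded_linear (xs i)" for i using xs(1)[of i] by (simp add: frechet_normal_def)
  define d where "d = psi_dual_norm \<psi> xs"
  have "1/4 \<le> n * (3 * d)"
  proof -
    have "xs i (w i) \<le> 3 * d" for i
    proof -
      have "xs i (w i) \<le> onorm (xs i) * norm (w i)" using onorm[OF bl[of i], of "w i"] by (simp add: abs_le_iff)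
      also have "\<dots> \<le> onorm (xs i) * 3" using w(1) onorm_pos_le[OF bl] by (intro mult_left_mono) auto
      also have "\<dots> \<le> d * 3"
        using onorm_le_psi_dual_norm[of \<psi> xs i, OF assms(2) bl] by (simp add: d_def)
      finally show ?thesis by simp
    qed
    then have "(\<Sum>i\<in>UNIV. xs i (w i)) \<le> (\<Sum>i\<in>(UNIV :: 'n set). 3 * d)" by (rule sum_mono)
    with w(2) show ?thesis by (simp add: n_def)
  qed
  then have d12: "1 \<le> 12 * n * d" by simp
  then have "0 < 12 * n * d" by linarith
  then have d: "0 < d" using n by (simp add: zero_less_mult_iff)
  define c where "c = 1 / d"
  have c: "0 < c" "c * d = 1" "c \<le> 12 * n" using d d12 by (auto simp: c_def field_simps)
  show "\<exists>x::'n \<Rightarrow> 'a. \<exists>xs::'n \<Rightarrow> ('a \<Rightarrow> real).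
           (\<forall>i. x i \<in> \<Omega> i \<inter> ball xbar \<epsilon> \<and> xs i \<in> frechet_normal (\<Omega> i) (x i)) \<and>
           onorm (\<lambda>v. \<Sum>i\<in>UNIV. xs i v) < \<epsilon> \<and> psi_dual_norm \<psi> xs = 1"
  proof (intro exI[of _ x] exI[of _ "\<lambda>i v. c * xs i v"] conjI allI)
    show "x i \<in> \<Omega> i \<inter> ball xbar \<epsilon>" for i using x[of i] \<epsilon>'(2) by auto
    show "(\<lambda>v. c * xs i v) \<in> frechet_normal (\<Omega> i) (x i)" for i by (rule frechet_normal_scale[OF xs(1) c(1)])
    have "onorm (\<lambda>v. \<Sum>i\<in>UNIV. c * xs i v) \<le> c * \<epsilon>'"
    proof (rule onorm_bound)
      show "0 \<le> c * \<epsilon>'" using c(1) \<epsilon>'(1) by simp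
      show "norm (\<Sum>i\<in>UNIV. c * xs i v) \<le> c * \<epsilon>' * norm v" for v
        using mult_left_mono[OF xs(2)[of v], of c] c(1)
        by (simp add: abs_mult mult.assoc flip: sum_distrib_left)
    qed
    also have "\<dots> \<le> 12 * n * \<epsilon>'" using c(3) \<epsilon>'(1) by (intro mult_right_mono) auto
    also have "\<dots> < \<epsilon>" using \<epsilon>'(3) by (simp add: mult_ac)
    finally show "onorm (\<lambda>v. \<Sum>i\<in>UNIV. c * xs i v) < \<epsilon>" .
    show "psi_dual_norm \<psi> (\<lambda>i v. c * xs i v) = 1"
      using psi_dual_norm_scale[of \<psi> xs c, OF assms(2) bl c(1)] c(2) by (simp add: d_def)
  qed
qed

end
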